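(* Let $I\subset\mathbb{R}$ be an interval, let $\mathbf{f}\in L^\infty(I;H)$, and let $\rho$ be a Vishik-Fursikov measure over $I$. Then the strengthened mean energy inequality holds on $I$, i.e. there exists a set $I'\subset I$ of full measure in $I$ such that for any nonnegative, nondecreasing, continuously differentiable function $\psi:[0,\infty)\to\mathbb{R}$ with bounded derivative, for all $t'\in I'$ and all $t\in I$ with $t\ge t'$, $$\int_{\mathcal{U}_I^\sharp}\Big\{\tfrac12\psi(|\mathbf{u}(t)|_{L^2}^2)+\nu\int_{t'}^t\psi'(|\mathbf{u}(s)|_{L^2}^2)\|\mathbf{u}(s)\|_{H^1}^2\,ds\Big\}d\rho(\mathbf{u})\le\int_{\mathcal{U}_I^\sharp}\Big\{\tfrac12\psi(|\mathbf{u}(t')|_{L^2}^2)+\int_{t'}^t\psi'(|\mathbf{u}(s)|_{L^2}^2)(\mathbf{f}(s),\mathbf{u}(s))_{L^2}\,ds\Big\}d\rho(\mathbf{u}).$$ If $I$ is closed and bounded on the left, then this inequality holds in particular for $t'$ being the left end point of $I$.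
   Context: Spaces. Fix $\nu>0$ and one of two cases. Periodic case: $\Omega=\prod_{i=1}^3(0,L_i)$, $L_i>0$, and $\mathcal{V}$ is the set of restrictions to $\Omega$ of fields $\mathbf{w}\in C^\infty(\mathbb{R}^3)^3$ that are divergence-free, periodic with period $L_i$ in each direction $x_i$, and satisfy $\int_\Omega\mathbf{w}\,d\mathbf{x}=0$. No-slip case: $\Omega\subset\mathbb{R}^3$ is a bounded domain with smooth boundary (at least of class $C^2$) and $\mathcal{V}$ is the set of divergence-free fields in $C_c^\infty(\Omega)^3$. $H$ (resp. $V$) is the completion of $\mathcal{V}$ in the $L^2(\Omega)^3$ (resp. $H^1(\Omega)^3$) norm. Write $(\mathbf{u},\mathbf{v})_{L^2}=\int_\Omega\mathbf{u}\cdot\mathbf{v}\,d\mathbf{x}$, $|\mathbf{u}|_{L^2}$ for its norm, $((\mathbf{u},\mathbf{v}))_{H^1}=\int_\Omega\sum_{i=1}^3\partial_{x_i}\mathbf{u}\cdot\partial_{x_i}\mathbf{v}\,d\mathbf{x}$ and $\|\mathbf{u}\|_{H^1}$ for its norm. $H$ is identified with its dual, so $V\subset H\subset V'$, with duality product $\langle\cdot,\cdot\rangle_{V',V}$. Define $A:V\to V'$ by $\langle A\mathbf{u},\mathbf{v}\rangle_{V',V}=((\mathbf{u},\mathbf{v}))_{H^1}$, $b(\mathbf{u},\mathbf{v},\mathbf{w})=\int_\Omega(\mathbf{u}\cdot\nabla)\mathbf{v}\cdot\mathbf{w}\,d\mathbf{x}$, and $B:V\times V\to V'$ by $\langle B(\mathbf{u},\mathbf{v}),\mathbf{w}\rangle_{V',V}=b(\mathbf{u},\mathbf{v},\mathbf{w})$.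 For an interval $I\subset\mathbb{R}$, the subscript "loc" on spaces over $I$ refers to compact subintervals of $I$. $H_{\mathrm{w}}$ is $H$ with its weak topology. $\mathcal{C}_{\mathrm{loc}}(I,H_{\mathrm{w}})$ is the space of weakly continuous functions $I\to H$ with the topology of uniform weak convergence on compact subintervals of $I$. Weak solution (always meaning Leray-Hopf weak solution) on an interval $I$, for a given $\mathbf{f}\in L^\infty(I;H)$: a function $\mathbf{u}:I\to H$ such that (i) $\mathbf{u}\in L^\infty_{\mathrm{loc}}(I;H)\cap L^2_{\mathrm{loc}}(I;V)$; (ii) $\partial_t\mathbf{u}\in L^{4/3}_{\mathrm{loc}}(I;V')$; (iii) $\mathbf{u}\in\mathcal{C}_{\mathrm{loc}}(I,H_{\mathrm{w}})$; (iv) $\frac{d\mathbf{u}}{dt}+\nu A\mathbf{u}+B(\mathbf{u},\mathbf{u})=\mathbf{f}$ in the distribution sense on $I$ with values in $V'$; (v) for almost all $t'\in I$ and all $t\in I$ with $t>t'$, $\frac12|\mathbf{u}(t)|_{L^2}^2+\nu\int_{t'}^t\|\mathbf{u}(s)\|_{H^1}^2ds\le\frac12|\mathbf{u}(t')|_{L^2}^2+\int_{t'}^t(\mathbf{f}(s),\mathbf{u}(s))_{L^2}ds$; (vi) if $I$ is closed and bounded on the left with left end point $t_0$, then $\mathbf{u}(t)\to\mathbf{u}(t_0)$ strongly in $H$ as $t\to t_0^+$. $\mathcal{U}_I^\sharp$ is the set of $\mathbf{u}\in\mathcal{C}_{\mathrm{loc}}(I,H_{\mathrm{w}})$ which are weak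 solutions on the interior $I^\circ$ of $I$. A measure is carried by a measurable set if the complement of that set has measure zero. Vishik-Fursikov measure over $I$: a Borel probability measure $\rho$ on $\mathcal{C}_{\mathrm{loc}}(I,H_{\mathrm{w}})$ such that (i) $\rho$ is carried by $\mathcal{U}_I^\sharp$; (ii) $t\mapsto\int_{\mathcal{U}_I^\sharp}|\mathbf{u}(t)|_{L^2}^2\,d\rho(\mathbf{u})$ belongs to $L^\infty_{\mathrm{loc}}(I)$; (iii) if $I$ is closed and bounded on the left with left end point $t_0$, then for every nonnegative, nondecreasing, continuously differentiable $\psi:[0,\infty)\to\mathbb{R}$ with bounded derivative, $\lim_{t\to t_0^+}\int_{\mathcal{U}_I^\sharp}\psi(|\mathbf{u}(t)|_{L^2}^2)\,d\rho(\mathbf{u})=\int_{\mathcal{U}_I^\sharp}\psi(|\mathbf{u}(t_0)|_{L^2}^2)\,d\rho(\mathbf{u})<\infty$. *)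

theory Defs
  imports "HOL-Probability.Probability"
begin

section \<open>Smooth functions\<close>

primrec C_k :: "nat \<Rightarrow> ('a::euclidean_space \<Rightarrow> 'b::real_normed_vector) \<Rightarrow> bool" where
  "C_k 0 g \<longleftrightarrow> continuous_on UNIV g"
| "C_k (Suc k) g \<longleftrightarrow> (\<forall>x. g differentiable at x) \<and>
     (\<forall>e\<in>Basis. C_k k (\<lambda>x. frechet_derivative g (at x) e))"

definition smooth :: "('a::euclidean_space \<Rightarrow> 'b::real_normed_vector) \<Rightarrow> bool" where
  "smooth g \<longleftrightarrow> (\<forall>k. C_k k g)"

definition compact_supp_in :: "('a::euclidean_space \<Rightarrow> 'b::real_normed_vector) \<Rightarrow> 'a set \<Rightarrow> bool" where
  "compact_supp_in g U \<longleftrightarrow> compact (closure {x. g x \<noteq> 0}) \<and> closure {x. g x \<noteq> 0} \<subseteq> U"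

text \<open>Elements of \<open>C\<^sub>c\<^sup>\<infinity>(U)\<close>, extended by zero to the whole space.\<close>

definition test_functions :: "'a::euclidean_space set \<Rightarrow> ('a \<Rightarrow> 'b::real_normed_vector) set" where
  "test_functions U = {g. smooth g \<and> compact_supp_in g U}"

definition partial_deriv :: "'n::finite \<Rightarrow> (real^'n \<Rightarrow> 'b::real_normed_vector) \<Rightarrow> real^'n \<Rightarrow> 'b" where
  "partial_deriv i g x = frechet_derivative g (at x) (axis i 1)"

definition divergence_free :: "(real^3 \<Rightarrow> real^3) \<Rightarrow> bool" where
  "divergence_free w \<longleftrightarrow> (\<forall>x. (\<Sum>i\<in>UNIV. partial_deriv i w x $ i) = 0)"


section \<open>Square integrable vector fields\<close>

definition square_integrable :: "(real^3 \<Rightarrow> real^3) \<Rightarrow> bool" where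
  "square_integrable u \<longleftrightarrow> u \<in> borel_measurable lebesgue \<and> integrable lebesgue (\<lambda>x. (norm (u x))\<^sup>2)"

definition L2_eq :: "(real^3 \<Rightarrow> real^3) \<Rightarrow> (real^3 \<Rightarrow> real^3) \<Rightarrow> bool" where
  "L2_eq u v \<longleftrightarrow> square_integrable u \<and> square_integrable v \<and> (AE x in lebesgue. u x = v x)"

lemma square_integrable_zero: "square_integrable (\<lambda>x. 0)"
  by (simp add: square_integrable_def)

lemma square_integrable_inner:
  assumes "square_integrable u" "square_integrable v"
  shows "integrable lebesgue (\<lambda>x. u x \<bullet> v x)"
proof (rule Bochner_Integration.integrable_bound)
  show "integrable lebesgue (\<lambda>x. (norm (u x))\<^sup>2 + (norm (v x))\<^sup>2)"
    using assms by (simp add: square_integrable_def)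
  show "(\<lambda>x. u x \<bullet> v x) \<in> borel_measurable lebesgue"
    using assms by (auto simp: square_integrable_def)
  have "\<bar>a \<bullet> b\<bar> \<le> (norm a)\<^sup>2 + (norm b)\<^sup>2" for a b :: "real^3"
  proof -
    have "\<bar>a \<bullet> b\<bar> \<le> norm a * norm b"
      by (rule Cauchy_Schwarz_ineq2)
    moreover have "2 * (norm a * norm b) \<le> (norm a)\<^sup>2 + (norm b)\<^sup>2"
      using sum_squares_bound[of "norm a" "norm b"] by (simp add: mult.assoc)
    moreover have "0 \<le> norm a * norm b"
      by simp
    ultimately show ?thesis
      by linarith
  qed
  then show "AE x in lebesgue. norm (u x \<bullet> v x) \<le> norm ((norm (u x))\<^sup>2 + (norm (v x))\<^sup>2)"
    by (simp add: abs_of_nonneg)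
qed

lemma square_integrable_add:
  assumes "square_integrable u" "square_integrable v"
  shows "square_integrable (\<lambda>x. u x + v x)"
proof -
  have "integrable lebesgue (\<lambda>x. (norm (u x))\<^sup>2 + 2 * (u x \<bullet> v x) + (norm (v x))\<^sup>2)"
    using assms square_integrable_inner[OF assms] by (simp add: square_integrable_def)
  moreover have "(norm (u x + v x))\<^sup>2 = (norm (u x))\<^sup>2 + 2 * (u x \<bullet> v x) + (norm (v x))\<^sup>2" for x
    by (simp add: power2_norm_eq_inner inner_add_left inner_add_right inner_commute)
  ultimately show ?thesis
    using assms by (auto simp: square_integrable_def)
qed

lemma square_integrable_scaleR:
  assumes "square_integrable u"
  shows "square_integrable (\<lambda>x. c *\<^sub>R u x)"
  using assms by (auto simp: square_integrable_def power_mult_distrib)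

quotient_type l2 = "real^3 \<Rightarrow> real^3" / partial: L2_eq
proof (rule part_equivpI)
  show "\<exists>u. L2_eq u u"
    using square_integrable_zero by (auto simp: L2_eq_def)
  show "symp L2_eq"
    by (auto simp: symp_def L2_eq_def)
  show "transp L2_eq"
    unfolding transp_def L2_eq_def by (auto elim: AE_mp)
qed

instantiation l2 :: real_inner
begin

lift_definition zero_l2 :: l2 is "\<lambda>x. 0"
  by (simp add: L2_eq_def square_integrable_zero)

lift_definition plus_l2 :: "l2 \<Rightarrow> l2 \<Rightarrow> l2" is "\<lambda>u v x. u x + v x"
  unfolding L2_eq_def by (auto intro: square_integrable_add elim: AE_mp)

lift_definition scaleR_l2 :: "real \<Rightarrow> l2 \<Rightarrow> l2" is "\<lambda>c u x. c *\<^sub>R u x"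
  unfolding L2_eq_def by (auto intro: square_integrable_scaleR elim: AE_mp)

definition uminus_l2 :: "l2 \<Rightarrow> l2" where "uminus_l2 u = (-1) *\<^sub>R u"

definition minus_l2 :: "l2 \<Rightarrow> l2 \<Rightarrow> l2" where "minus_l2 u v = u + (-1) *\<^sub>R v"

lift_definition inner_l2 :: "l2 \<Rightarrow> l2 \<Rightarrow> real" is "\<lambda>u v. LINT x|lebesgue. u x \<bullet> v x"
  unfolding L2_eq_def square_integrable_def
  by (rule integral_cong_AE) (auto elim: AE_mp)

definition norm_l2 :: "l2 \<Rightarrow> real" where "norm_l2 u = sqrt (u \<bullet> u)"

definition sgn_l2 :: "l2 \<Rightarrow> l2" where "sgn_l2 u = inverse (norm u) *\<^sub>R u"

definition dist_l2 :: "l2 \<Rightarrow> l2 \<Rightarrow> real" where "dist_l2 u v = norm (u - v)"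

definition uniformity_l2 :: "(l2 \<times> l2) filter" where
  "uniformity_l2 = (INF e\<in>{0<..}. principal {(x, y). dist x y < e})"

definition open_l2 :: "l2 set \<Rightarrow> bool" where
  "open_l2 U \<longleftrightarrow> (\<forall>x\<in>U. eventually (\<lambda>(x', y). x' = x \<longrightarrow> y \<in> U) uniformity)"

instance
proof
  fix u v w :: l2 and a b c :: real
  show "u + v + w = u + (v + w)"
    by transfer (auto simp: L2_eq_def algebra_simps intro!: square_integrable_add)
  show "u + v = v + u"
    by transfer (auto simp: L2_eq_def algebra_simps intro!: square_integrable_add)
  show "0 + u = u"
    by transfer (auto simp: L2_eq_def)
  show "- u + u = 0"
    unfolding uminus_l2_def
    by transfer
      (use square_integrable_add[OF square_integrable_scaleR[of _ "-1"]]
        in \<open>auto simp: L2_eq_def square_integrable_zero\<close>)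
  show "u - v = u + - v"
    by (simp add: minus_l2_def uminus_l2_def)
  show "a *\<^sub>R (u + v) = a *\<^sub>R u + a *\<^sub>R v"
    by transfer (auto simp: L2_eq_def scaleR_add_right
        intro!: square_integrable_add square_integrable_scaleR
        dest: square_integrable_scaleR[OF square_integrable_add])
  show "(a + b) *\<^sub>R u = a *\<^sub>R u + b *\<^sub>R u"
    by transfer (auto simp: L2_eq_def scaleR_add_left
        intro!: square_integrable_add square_integrable_scaleR)
  show "a *\<^sub>R b *\<^sub>R u = (a * b) *\<^sub>R u"
    by transfer (auto simp: L2_eq_def intro!: square_integrable_scaleR)
  show "1 *\<^sub>R u = u"
    by transfer (auto simp: L2_eq_def)
  show "dist u v = norm (u - v)"
    by (simp add: dist_l2_def)
  show "sgn u = inverse (norm u) *\<^sub>R u"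
    by (simp add: sgn_l2_def)
  show "u \<bullet> v = v \<bullet> u"
    by transfer (simp add: inner_commute)
  show "(u + v) \<bullet> w = u \<bullet> w + v \<bullet> w"
    by transfer (simp add: L2_eq_def inner_add_left square_integrable_inner)
  show "(a *\<^sub>R u) \<bullet> v = a * (u \<bullet> v)"
    by transfer (simp add: L2_eq_def)
  show "0 \<le> u \<bullet> u"
    by transfer simp
  show "(u \<bullet> u = 0) \<longleftrightarrow> (u = 0)"
  proof transfer
    fix u assume "L2_eq u u"
    then have "integrable lebesgue (\<lambda>x. u x \<bullet> u x)" "square_integrable u"
      by (auto simp: L2_eq_def square_integrable_inner)
    then show "((LINT x|lebesgue. u x \<bullet> u x) = 0) \<longleftrightarrow> L2_eq u (\<lambda>x. 0)"
      by (subst integral_nonneg_eq_0_iff_AE)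
        (auto simp: L2_eq_def square_integrable_zero)
  qed
  show "norm u = sqrt (u \<bullet> u)"
    by (simp add: norm_l2_def)
qed (auto simp: uniformity_l2_def open_l2_def)

end


section \<open>The two settings and the spaces \<open>H\<close> and \<open>V\<close>\<close>

datatype setting = Periodic "real^3" | No_Slip "(real^3) set"

definition C2_boundary :: "(real^3) set \<Rightarrow> bool" where
  "C2_boundary \<Omega> \<longleftrightarrow> (\<forall>x0\<in>frontier \<Omega>. \<exists>r>0.
     \<exists>(Q :: real^3 \<Rightarrow> real^3) (\<gamma> :: real^2 \<Rightarrow> real). orthogonal_transformation Q \<and> C_k 2 \<gamma> \<and>
     \<Omega> \<inter> ball x0 r = {x \<in> ball x0 r. \<gamma> (vector [Q x $ 1, Q x $ 2]) < Q x $ 3})"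

primrec flow_domain :: "setting \<Rightarrow> (real^3) set" where
  "flow_domain (Periodic L) = box 0 L"
| "flow_domain (No_Slip \<Omega>) = \<Omega>"

primrec admissible :: "setting \<Rightarrow> bool" where
  "admissible (Periodic L) \<longleftrightarrow> (\<forall>i. 0 < L $ i)"
| "admissible (No_Slip \<Omega>) \<longleftrightarrow>
     open \<Omega> \<and> connected \<Omega> \<and> \<Omega> \<noteq> {} \<and> bounded \<Omega> \<and> C2_boundary \<Omega>"

primrec test_fields :: "setting \<Rightarrow> (real^3 \<Rightarrow> real^3) set" where
  "test_fields (Periodic L) = {w. smooth w \<and> divergence_free w \<and>
     (\<forall>i x. w (x + axis i (L $ i)) = w x) \<and> (LINT x:box 0 L|lebesgue. w x) = 0}"
| "test_fields (No_Slip \<Omega>) = {w \<in> test_functions \<Omega>. divergence_free w}"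

text \<open>\<open>L\<^sup>2(\<Omega>)\<^sup>3\<close> is the subspace of \<^typ>\<open>l2\<close> of the fields that vanish outside \<open>\<Omega>\<close>.\<close>

definition L2_domain :: "setting \<Rightarrow> l2 set" where
  "L2_domain S = {u. AE x in lebesgue. x \<notin> flow_domain S \<longrightarrow> rep_l2 u x = 0}"

definition L2_class :: "setting \<Rightarrow> (real^3 \<Rightarrow> real^3) \<Rightarrow> l2" where
  "L2_class S w = abs_l2 (\<lambda>x. indicator (flow_domain S) x *\<^sub>R w x)"

definition space_H :: "setting \<Rightarrow> l2 set" where
  "space_H S = closure (L2_class S ` test_fields S)"

definition is_weak_partial :: "setting \<Rightarrow> 3 \<Rightarrow> l2 \<Rightarrow> l2 \<Rightarrow> bool" where
  "is_weak_partial S i u g \<longleftrightarrow> g \<in> L2_domain S \<and>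
     (\<forall>\<phi>\<in>test_functions (flow_domain S).
        (LINT x:flow_domain S|lebesgue. partial_deriv i \<phi> x *\<^sub>R rep_l2 u x) =
        - (LINT x:flow_domain S|lebesgue. (\<phi> x :: real) *\<^sub>R rep_l2 g x))"

definition weak_partial :: "setting \<Rightarrow> 3 \<Rightarrow> l2 \<Rightarrow> l2" where
  "weak_partial S i u = (THE g. is_weak_partial S i u g)"

definition space_H1 :: "setting \<Rightarrow> l2 set" where
  "space_H1 S = {u \<in> L2_domain S. \<forall>i. \<exists>g. is_weak_partial S i u g}"

text \<open>\<open>H1_inner\<close> and \<open>H1_norm\<close> involve the derivatives only; \<open>H1_full_norm\<close> is the norm
  of \<open>H\<^sup>1(\<Omega>)\<^sup>3\<close>. They are meaningful on \<open>space_H1\<close> only.\<close>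

definition H1_inner :: "setting \<Rightarrow> l2 \<Rightarrow> l2 \<Rightarrow> real" where
  "H1_inner S u v = (\<Sum>i\<in>UNIV. weak_partial S i u \<bullet> weak_partial S i v)"

definition H1_norm :: "setting \<Rightarrow> l2 \<Rightarrow> real" where
  "H1_norm S u = sqrt (H1_inner S u u)"

definition H1_full_norm :: "setting \<Rightarrow> l2 \<Rightarrow> real" where
  "H1_full_norm S u = sqrt ((norm u)\<^sup>2 + (H1_norm S u)\<^sup>2)"

definition space_V :: "setting \<Rightarrow> l2 set" where
  "space_V S = {u \<in> space_H1 S.
     \<forall>e>0. \<exists>w\<in>test_fields S. H1_full_norm S (u - L2_class S w) < e}"

text \<open>The elements of \<open>V'\<close> are functionals defined on \<open>V\<close>. By Poincare's inequality
  \<open>H1_norm\<close> is a norm on \<open>V\<close> equivalent to \<open>H1_full_norm\<close>.\<close>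

definition dual_V :: "setting \<Rightarrow> (l2 \<Rightarrow> real) set" where
  "dual_V S = {g \<in> extensional (space_V S).
     (\<forall>u\<in>space_V S. \<forall>v\<in>space_V S. g (u + v) = g u + g v) \<and>
     (\<forall>c. \<forall>v\<in>space_V S. g (c *\<^sub>R v) = c * g v) \<and>
     (\<exists>C. \<forall>v\<in>space_V S. \<bar>g v\<bar> \<le> C * H1_norm S v)}"

definition dual_V_norm :: "setting \<Rightarrow> (l2 \<Rightarrow> real) \<Rightarrow> real" where
  "dual_V_norm S g = (SUP v\<in>{v \<in> space_V S. H1_norm S v \<le> 1}. \<bar>g v\<bar>)"

definition H_to_dual :: "setting \<Rightarrow> l2 \<Rightarrow> (l2 \<Rightarrow> real)" where
  "H_to_dual S h = (\<lambda>v\<in>space_V S. h \<bullet> v)"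

definition op_A :: "setting \<Rightarrow> l2 \<Rightarrow> (l2 \<Rightarrow> real)" where
  "op_A S u = (\<lambda>v\<in>space_V S. H1_inner S u v)"

definition form_b :: "setting \<Rightarrow> l2 \<Rightarrow> l2 \<Rightarrow> l2 \<Rightarrow> real" where
  "form_b S u v w = (LINT x:flow_domain S|lebesgue.
     (\<Sum>i\<in>UNIV. rep_l2 u x $ i *\<^sub>R rep_l2 (weak_partial S i v) x) \<bullet> rep_l2 w x)"

definition op_B :: "setting \<Rightarrow> l2 \<Rightarrow> l2 \<Rightarrow> (l2 \<Rightarrow> real)" where
  "op_B S u v = (\<lambda>w\<in>space_V S. form_b S u v w)"


section \<open>Vector-valued functions of time\<close>

text \<open>Here \<open>X\<close> is a space with norm \<open>N\<close>; \<open>X\<close> need not be a whole type.\<close>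

definition strongly_measurable_on ::
    "real set \<Rightarrow> 'x::minus set \<Rightarrow> ('x \<Rightarrow> real) \<Rightarrow> (real \<Rightarrow> 'x) \<Rightarrow> bool" where
  "strongly_measurable_on J X N g \<longleftrightarrow> (AE t in lebesgue_on J. g t \<in> X) \<and>
     (\<exists>s. (\<forall>n. simple_function (lebesgue_on J) (s n) \<and> s n ` J \<subseteq> X) \<and>
          (AE t in lebesgue_on J. (\<lambda>n. N (s n t - g t)) \<longlonglongrightarrow> 0))"

definition L_inf :: "real set \<Rightarrow> 'x::minus set \<Rightarrow> ('x \<Rightarrow> real) \<Rightarrow> (real \<Rightarrow> 'x) set" where
  "L_inf J X N = {g. strongly_measurable_on J X N g \<and>
     (\<exists>C. AE t in lebesgue_on J. N (g t) \<le> C)}"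

definition L_p :: "real \<Rightarrow> real set \<Rightarrow> 'x::minus set \<Rightarrow> ('x \<Rightarrow> real) \<Rightarrow> (real \<Rightarrow> 'x) set" where
  "L_p p J X N = {g. strongly_measurable_on J X N g \<and>
     (\<integral>\<^sup>+t. ennreal (N (g t) powr p) \<partial>lebesgue_on J) < \<infinity>}"

definition L_inf_loc :: "real set \<Rightarrow> 'x::minus set \<Rightarrow> ('x \<Rightarrow> real) \<Rightarrow> (real \<Rightarrow> 'x) set" where
  "L_inf_loc J X N = {g. \<forall>a b. {a..b} \<subseteq> J \<longrightarrow> g \<in> L_inf {a..b} X N}"

definition L_p_loc :: "real \<Rightarrow> real set \<Rightarrow> 'x::minus set \<Rightarrow> ('x \<Rightarrow> real) \<Rightarrow> (real \<Rightarrow> 'x) set" where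
  "L_p_loc p J X N = {g. \<forall>a b. {a..b} \<subseteq> J \<longrightarrow> g \<in> L_p p {a..b} X N}"

text \<open>The \<open>V'\<close>-valued distribution on \<open>J\<close> given by a function \<open>g\<close> with values in \<open>V'\<close>, and the
  derivative of such a distribution. A \<open>V'\<close>-valued integral is determined by its values on
  the elements of \<open>V\<close>, and evaluation at a fixed element commutes with integration.\<close>

definition dual_distr ::
    "setting \<Rightarrow> real set \<Rightarrow> (real \<Rightarrow> l2 \<Rightarrow> real) \<Rightarrow> (real \<Rightarrow> real) \<Rightarrow> (l2 \<Rightarrow> real)" where
  "dual_distr S J g \<phi> = (\<lambda>v\<in>space_V S. LINT t:J|lebesgue. \<phi> t * g t v)"

definition distr_deriv ::
    "setting \<Rightarrow> ((real \<Rightarrow> real) \<Rightarrow> (l2 \<Rightarrow> real)) \<Rightarrow> (real \<Rightarrow> real) \<Rightarrow> (l2 \<Rightarrow> real)" where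
  "distr_deriv S T \<phi> = (\<lambda>v\<in>space_V S. - T (deriv \<phi>) v)"


section \<open>Weakly continuous functions\<close>

definition weak_H :: "setting \<Rightarrow> l2 topology" where
  "weak_H S = topology_generated_by
     {{x \<in> space_H S. x \<bullet> h \<in> U} | h U. h \<in> space_H S \<and> open (U :: real set)}"

definition weakly_continuous_on :: "setting \<Rightarrow> real set \<Rightarrow> (real \<Rightarrow> l2) \<Rightarrow> bool" where
  "weakly_continuous_on S J u \<longleftrightarrow> continuous_map (top_of_set J) (weak_H S) u"

definition C_loc_weak :: "setting \<Rightarrow> real set \<Rightarrow> (real \<Rightarrow> l2) set" where
  "C_loc_weak S J = {u \<in> extensional J. weakly_continuous_on S J u}"

text \<open>Uniform weak convergence on compact subintervals.\<close>

definition C_loc_topology :: "setting \<Rightarrow> real set \<Rightarrow> (real \<Rightarrow> l2) topology" where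
  "C_loc_topology S J = topology_generated_by
     {{u \<in> C_loc_weak S J. \<forall>t\<in>{a..b}. \<bar>(u t - v t) \<bullet> h\<bar> < e} | v a b h e.
        v \<in> C_loc_weak S J \<and> {a..b} \<subseteq> J \<and> h \<in> space_H S \<and> 0 < e}"


section \<open>Weak solutions\<close>

definition closed_left_end :: "real set \<Rightarrow> real \<Rightarrow> bool" where
  "closed_left_end J t0 \<longleftrightarrow> t0 \<in> J \<and> (\<forall>t\<in>J. t0 \<le> t)"

definition weak_solution :: "setting \<Rightarrow> real \<Rightarrow> (real \<Rightarrow> l2) \<Rightarrow> real set \<Rightarrow> (real \<Rightarrow> l2) \<Rightarrow> bool" where
  "weak_solution S \<nu> f J u \<longleftrightarrow>
     u \<in> L_inf_loc J (space_H S) norm \<and>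
     u \<in> L_p_loc 2 J (space_V S) (H1_norm S) \<and>
     (\<exists>g\<in>L_p_loc (4/3) J (dual_V S) (dual_V_norm S).
        \<forall>\<phi>\<in>test_functions (interior J).
          distr_deriv S (dual_distr S J (\<lambda>t. H_to_dual S (u t))) \<phi> = dual_distr S J g \<phi>) \<and>
     weakly_continuous_on S J u \<and>
     (\<forall>\<phi>\<in>test_functions (interior J). \<forall>v\<in>space_V S.
        distr_deriv S (dual_distr S J (\<lambda>t. H_to_dual S (u t))) \<phi> v
          + \<nu> * dual_distr S J (\<lambda>t. op_A S (u t)) \<phi> v
          + dual_distr S J (\<lambda>t. op_B S (u t) (u t)) \<phi> v
        = dual_distr S J (\<lambda>t. H_to_dual S (f t)) \<phi> v) \<and>
     (AE t' in lebesgue_on J. \<forall>t\<in>J. t' < t \<longrightarrow>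
        (norm (u t))\<^sup>2 / 2 + \<nu> * (LINT s:{t'..t}|lebesgue. (H1_norm S (u s))\<^sup>2)
        \<le> (norm (u t'))\<^sup>2 / 2 + (LINT s:{t'..t}|lebesgue. f s \<bullet> u s)) \<and>
     (\<forall>t0. closed_left_end J t0 \<longrightarrow> (u \<longlongrightarrow> u t0) (at t0 within J))"

definition U_sharp :: "setting \<Rightarrow> real \<Rightarrow> (real \<Rightarrow> l2) \<Rightarrow> real set \<Rightarrow> (real \<Rightarrow> l2) set" where
  "U_sharp S \<nu> f J = {u \<in> C_loc_weak S J. weak_solution S \<nu> f (interior J) u}"


section \<open>Vishik-Fursikov measures\<close>

definition carried_by :: "'a measure \<Rightarrow> 'a set \<Rightarrow> bool" where
  "carried_by \<mu> E \<longleftrightarrow> E \<in> sets \<mu> \<and> emeasure \<mu> (space \<mu> - E) = 0"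

definition borel_prob_measure :: "'a topology \<Rightarrow> 'a measure \<Rightarrow> bool" where
  "borel_prob_measure T \<mu> \<longleftrightarrow>
     sets \<mu> = sigma_sets (topspace T) {U. openin T U} \<and> prob_space \<mu>"

text \<open>Only the restriction of \<open>\<psi>\<close> to \<open>[0,\<infinity>)\<close> matters; \<open>\<psi>'\<close> is its derivative there,
  one-sided at \<open>0\<close>.\<close>

definition energy_function :: "(real \<Rightarrow> real) \<Rightarrow> (real \<Rightarrow> real) \<Rightarrow> bool" where
  "energy_function \<psi> \<psi>' \<longleftrightarrow>
     (\<forall>r\<ge>0. 0 \<le> \<psi> r) \<and> mono_on {0..} \<psi> \<and>
     (\<forall>r\<ge>0. (\<psi> has_real_derivative \<psi>' r) (at r within {0..})) \<and>
     continuous_on {0..} \<psi>' \<and> bounded (\<psi>' ` {0..})"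

definition vishik_fursikov_measure ::
    "setting \<Rightarrow> real \<Rightarrow> (real \<Rightarrow> l2) \<Rightarrow> real set \<Rightarrow> (real \<Rightarrow> l2) measure \<Rightarrow> bool" where
  "vishik_fursikov_measure S \<nu> f J \<rho> \<longleftrightarrow>
     borel_prob_measure (C_loc_topology S J) \<rho> \<and>
     carried_by \<rho> (U_sharp S \<nu> f J) \<and>
     (\<lambda>t. \<integral>\<^sup>+u\<in>U_sharp S \<nu> f J. ennreal ((norm (u t))\<^sup>2) \<partial>\<rho>) \<in> borel_measurable (lebesgue_on J) \<and>
     (\<forall>a b. {a..b} \<subseteq> J \<longrightarrow> (\<exists>C::real. AE t in lebesgue_on {a..b}.
        (\<integral>\<^sup>+u\<in>U_sharp S \<nu> f J. ennreal ((norm (u t))\<^sup>2) \<partial>\<rho>) \<le> ennreal C)) \<and>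
     (\<forall>t0. closed_left_end J t0 \<longrightarrow> (\<forall>\<psi> \<psi>'. energy_function \<psi> \<psi>' \<longrightarrow>
        ((\<lambda>t. \<integral>\<^sup>+u\<in>U_sharp S \<nu> f J. ennreal (\<psi> ((norm (u t))\<^sup>2)) \<partial>\<rho>)
           \<longlongrightarrow> (\<integral>\<^sup>+u\<in>U_sharp S \<nu> f J. ennreal (\<psi> ((norm (u t0))\<^sup>2)) \<partial>\<rho>)) (at t0 within J) \<and>
        (\<integral>\<^sup>+u\<in>U_sharp S \<nu> f J. ennreal (\<psi> ((norm (u t0))\<^sup>2)) \<partial>\<rho>) < \<infinity>))"

text \<open>Bochner integrals are totalised by \<open>0\<close> in the library, so the existence of the
  integrals in the inequality is stated explicitly.\<close>

definition strengthened_mean_energy_inequality ::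
    "setting \<Rightarrow> real \<Rightarrow> (real \<Rightarrow> l2) \<Rightarrow> real set \<Rightarrow> (real \<Rightarrow> l2) measure \<Rightarrow>
     (real \<Rightarrow> real) \<Rightarrow> (real \<Rightarrow> real) \<Rightarrow> real \<Rightarrow> real \<Rightarrow> bool" where
  "strengthened_mean_energy_inequality S \<nu> f J \<rho> \<psi> \<psi>' t' t \<longleftrightarrow>
     (let lhs = (\<lambda>u. \<psi> ((norm (u t))\<^sup>2) / 2
            + \<nu> * (LINT s:{t'..t}|lebesgue. \<psi>' ((norm (u s))\<^sup>2) * (H1_norm S (u s))\<^sup>2));
          rhs = (\<lambda>u. \<psi> ((norm (u t'))\<^sup>2) / 2
            + (LINT s:{t'..t}|lebesgue. \<psi>' ((norm (u s))\<^sup>2) * (f s \<bullet> u s)))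
      in (AE u in \<rho>. 
            set_integrable lebesgue {t'..t} (\<lambda>s. \<psi>' ((norm (u s))\<^sup>2) * (H1_norm S (u s))\<^sup>2) \<and>
            set_integrable lebesgue {t'..t} (\<lambda>s. \<psi>' ((norm (u s))\<^sup>2) * (f s \<bullet> u s))) \<and>
         set_integrable \<rho> (U_sharp S \<nu> f J) lhs \<and>
         set_integrable \<rho> (U_sharp S \<nu> f J) rhs \<and>
         (LINT u:U_sharp S \<nu> f J|\<rho>. lhs u) \<le> (LINT u:U_sharp S \<nu> f J|\<rho>. rhs u))"

end

theory Submission
  imports Defs
begin

text \<open>
  For a single trajectory, the energy \<open>e = |u|\<^sup>2\<close> satisfies
  \<open>e(t) \<le> e(s) + 2 \<integral>\<^sub>s\<^sup>t ((f, u) - \<nu> \<parallel>u\<parallel>\<^sup>2)\<close> for almost every \<open>s\<close> and all \<open>t > s\<close>, so it is an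
  absolutely continuous function plus a function that decreases along almost every pair of times.
  Because \<open>\<psi>\<close> is nondecreasing, the downward jumps only help, and the chain rule holds as an inequality for \<open>\<psi>(e)\<close>.
  The exceptional times depend on the trajectory. Fubini's theorem exchanges the quantifiers: almost every
  \<open>t'\<close> is admissible for almost every trajectory, and this does not depend on \<open>\<psi>\<close> or \<open>t\<close>, since by weak
  lower semicontinuity of the norm it suffices to test rational \<open>t\<close>.

  Fubini's theorem needs \<open>|u(s)|\<close> and \<open>\<parallel>u(s)\<parallel>\<close> to be jointly measurable in \<open>(s, u)\<close>. Both squared norms are sums of
  suprema of weakly continuous affine functionals on \<open>H\<close>; for the gradient the functionals come from the weak
  derivative tested against \<open>C\<^sub>c\<^sup>\<infinity>(\<Omega>)\<close>, projected onto \<open>H\<close>. Hence they are lower semicontinuous.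

  At a closed left end the energy inequality of individual trajectories may fail to start, and the
  inequality is obtained as a limit in the mean, using the mean continuity of \<open>\<psi>(|u|\<^sup>2)\<close> there.
\<close>

section \<open>The Hilbert space of square integrable fields\<close>

text \<open>The overview leaves some obstacles implicit. The type \<open>l2\<close> comes with an
  inner product but without completeness, so Riesz-Fischer is proved first; orthogonal projections
  depend on it. The topology of the path space tests trajectories only against vectors of
  \<open>space_H\<close>, while a weak derivative is tested against fields that need not be
  divergence free; projecting these onto \<open>space_H\<close> does not change their action on
  trajectories. The path space has no evident countable base, so lower semicontinuity on the product
  does not by itself give measurability for the product sigma algebra. Finally, members of
  \<open>U_sharp\<close> solve the equations only on the interior of \<open>I\<close>, and their
  dissipation is known to be integrable only on compact subintervals of it. Finiteness up to the end
  points has to come out of the inequality itself. This is why dissipation is kept in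
  \<open>ennreal\<close> and passed to the limit by Fatou's lemma, while the work of the force,
  whose density is at most a multiple of \<open>1 + E\<close>, is treated by dominated
  convergence.\<close>

lemma parallelogram_midpoint:
  fixes x p q :: "'a::real_inner"
  shows "(norm (p - q))\<^sup>2 = 2 * (norm (x - p))\<^sup>2 + 2 * (norm (x - q))\<^sup>2 - 4 * (norm (x - (1/2) *\<^sub>R (p + q)))\<^sup>2"
  by (simp add: power2_norm_eq_inner algebra_simps inner_commute)

text \<open>A minimising sequence in \<open>K\<close> is Cauchy by the parallelogram identity,
  because midpoints stay in \<open>K\<close>. Two projections are taken later: of a weak derivative
  onto the closure of the vectors it can be tested with, and of a test vector onto
  \<open>space_H\<close>.\<close>

lemma closed_subspace_projection:
  fixes K :: "'a::{real_inner,banach} set"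
  assumes K: "subspace K" "closed K"
  obtains p where "p \<in> K" "\<And>y. y \<in> K \<Longrightarrow> (x - p) \<bullet> y = 0"
proof -
  define d where "d = infdist x K"
  have ne: "K \<noteq> {}" using subspace_0[OF K(1)] by auto
  have d0: "0 \<le> d" by (simp add: d_def infdist_nonneg)
  have dle: "d\<^sup>2 \<le> (norm (x - y))\<^sup>2" if "y \<in> K" for y
    using infdist_le[OF that, of x] d0 by (simp add: d_def dist_norm power_mono)
  have "\<exists>y\<in>K. (norm (x - y))\<^sup>2 < d\<^sup>2 + inverse (Suc n)" for n
  proof -
    have "Inf (dist x ` K) < sqrt (d\<^sup>2 + inverse (Suc n))"
      using d0 ne by (intro real_less_rsqrt) (auto simp: d_def infdist_def)
    then obtain y where y: "y \<in> K" "dist x y < sqrt (d\<^sup>2 + inverse (Suc n))"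
      using ne by (subst (asm) cInf_less_iff) (auto intro!: bdd_belowI[of _ 0])
    have "(dist x y)\<^sup>2 < (sqrt (d\<^sup>2 + inverse (Suc n)))\<^sup>2"
      by (rule power_strict_mono[OF y(2)]) auto
    then show ?thesis using y(1) by (auto simp: dist_norm add_nonneg_nonneg)
  qed
  then obtain p where p: "\<And>n. p n \<in> K" "\<And>n. (norm (x - p n))\<^sup>2 < d\<^sup>2 + inverse (Suc n)"
    by metis
  have diff: "(norm (p m - p n))\<^sup>2 \<le> 2 * inverse (Suc m) + 2 * inverse (Suc n)" for m n
  proof -
    have "(1/2) *\<^sub>R (p m + p n) \<in> K"
      using K(1) p(1) by (intro subspace_scale subspace_add)
    then show ?thesis
      using parallelogram_midpoint[of "p m" "p n" x] p(2)[of m] p(2)[of n] dle by fastforce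
  qed
  have "Cauchy p"
  proof (rule CauchyI)
    fix e :: real assume e: "0 < e"
    then obtain N where N: "inverse (real (Suc N)) < e\<^sup>2 / 4"
      using reals_Archimedean[of "e\<^sup>2/4"] by auto
    have "norm (p m - p n) < e" if "m \<ge> N" "n \<ge> N" for m n
    proof -
      have "inverse (real (Suc m)) \<le> inverse (real (Suc N))" "inverse (real (Suc n)) \<le> inverse (real (Suc N))"
        using that by auto
      then have "(norm (p m - p n))\<^sup>2 < e\<^sup>2" using diff[of m n] N by linarith
      then show ?thesis using e by (simp add: power2_less_imp_less)
    qed
    then show "\<exists>M. \<forall>m\<ge>M. \<forall>n\<ge>M. norm (p m - p n) < e" by blast
  qed
  then obtain q where q: "p \<longlonglongrightarrow> q" using Cauchy_convergent convergent_def by blast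
  have qK: "q \<in> K" using closed_sequentially[OF K(2)] p(1) q by auto
  have "(\<lambda>n. (norm (x - p n))\<^sup>2) \<longlonglongrightarrow> (norm (x - q))\<^sup>2" by (intro tendsto_intros q)
  moreover have "(\<lambda>n. d\<^sup>2 + inverse (real (Suc n))) \<longlonglongrightarrow> d\<^sup>2 + 0"
    by (intro tendsto_intros LIMSEQ_inverse_real_of_nat)
  ultimately have qd: "(norm (x - q))\<^sup>2 \<le> d\<^sup>2"
    using p(2) by (intro LIMSEQ_le) (auto intro!: less_imp_le exI[of _ 0])
  have "(x - q) \<bullet> y = 0" if y: "y \<in> K" for y
  proof (cases "y = 0")
    case False
    \<comment> \<open>The minimiser of the squared norm of \<open>x - q - t *\<^sub>R y\<close> over
      real \<open>t\<close>. For it the decrease is exactly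
      \<open>((x - q) \<bullet> y)^2 / (y \<bullet> y)\<close>, which minimality of \<open>q\<close>
      forces to vanish.\<close>
    define t where "t = ((x - q) \<bullet> y) / (y \<bullet> y)"
    have "q + t *\<^sub>R y \<in> K" using K(1) qK y by (intro subspace_add subspace_scale)
    then have "(norm (x - q))\<^sup>2 \<le> (norm (x - q - t *\<^sub>R y))\<^sup>2"
      using dle[of "q + t *\<^sub>R y"] qd unfolding diff_diff_eq by linarith
    also have "\<dots> = (norm (x - q))\<^sup>2 - 2 * t * ((x - q) \<bullet> y) + t * t * (y \<bullet> y)"
      unfolding power2_norm_eq_inner by (simp add: inner_diff_left inner_diff_right inner_commute algebra_simps)
    also have "\<dots> = (norm (x - q))\<^sup>2 - t * ((x - q) \<bullet> y)"
      using False by (simp add: t_def)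
    finally have "t * ((x - q) \<bullet> y) \<le> 0" by simp
    then have "((x - q) \<bullet> y)\<^sup>2 / (y \<bullet> y) \<le> 0"
      by (simp add: t_def power2_eq_square)
    then show ?thesis
      using False inner_gt_zero_iff[of y] by (auto simp: divide_le_0_iff simp del: inner_gt_zero_iff)
  qed simp
  then show ?thesis using that qK by blast
qed

section \<open>Representatives in \<open>l2\<close> and its completeness\<close>

lemma square_integrable_rep: "square_integrable (rep_l2 u)"
  using Quotient_rep_reflp[OF Quotient_l2, of u] by (simp add: L2_eq_def)

lemma rep_l2_measurable [measurable]: "rep_l2 u \<in> borel_measurable lebesgue"
  using square_integrable_rep by (simp add: square_integrable_def)

lemma rep_abs_l2: "square_integrable w \<Longrightarrow> AE x in lebesgue. rep_l2 (abs_l2 w) x = w x"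
  using Quotient_rep_abs[OF Quotient_l2, of w] by (simp add: L2_eq_def)

lemma rep_l2_add: "AE x in lebesgue. rep_l2 (u + v) x = rep_l2 u x + rep_l2 v x"
  using rep_abs_l2[OF square_integrable_add[OF square_integrable_rep[of u] square_integrable_rep[of v]]]
  by (simp add: plus_l2_def)

lemma rep_l2_scaleR: "AE x in lebesgue. rep_l2 (c *\<^sub>R u) x = c *\<^sub>R rep_l2 u x"
  using rep_abs_l2[OF square_integrable_scaleR[OF square_integrable_rep[of u]]]
  by (simp add: scaleR_l2_def)

lemma rep_l2_diff: "AE x in lebesgue. rep_l2 (u - v) x = rep_l2 u x - rep_l2 v x"
  unfolding minus_l2_def
  using rep_l2_add[of u "(-1) *\<^sub>R v"] rep_l2_scaleR[of "-1" v] by eventually_elim simp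

lemma inner_l2_rep: "u \<bullet> v = (LINT x|lebesgue. rep_l2 u x \<bullet> rep_l2 v x)"
  by (simp add: inner_l2_def)

lemma norm_l2_rep: "(norm u)\<^sup>2 = (LINT x|lebesgue. (norm (rep_l2 u x))\<^sup>2)"
  unfolding power2_norm_eq_inner by (rule inner_l2_rep)

lemma nn_integral_rep_l2: "(\<integral>\<^sup>+x. ennreal ((norm (rep_l2 u x))\<^sup>2) \<partial>lebesgue) = ennreal ((norm u)\<^sup>2)"
  unfolding norm_l2_rep using square_integrable_rep[of u]
  by (intro nn_integral_eq_integral) (auto simp: square_integrable_def)

lemma nn_integral_rep_l2_diff:
  "(\<integral>\<^sup>+x. ennreal ((norm (rep_l2 u x - rep_l2 v x))\<^sup>2) \<partial>lebesgue) = ennreal ((norm (u - v))\<^sup>2)"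
  unfolding nn_integral_rep_l2[symmetric] using rep_l2_diff[of u v]
  by (intro nn_integral_cong_AE) (auto elim!: eventually_mono)

lemma square_integrableI:
  assumes "w \<in> borel_measurable lebesgue" "(\<integral>\<^sup>+x. ennreal ((norm (w x))\<^sup>2) \<partial>lebesgue) < \<infinity>"
  shows "square_integrable w"
  using assms unfolding square_integrable_def by (auto intro!: integrableI_bounded)

text \<open>Only squares of increments can be integrated over space, whereas convergence needs
  summable increments. If \<open>a\<close> is the size of the \<open>k\<close>-th increment, then
  \<open>a \<le> 2 ^ k * a^2 + (1/2) ^ k\<close>: either \<open>a\<close> is at most
  \<open>(1/2) ^ k\<close>, or \<open>2 ^ k * a\<close> exceeds 1.\<close>

lemma Cauchy_if_weighted_sum_finite:
  fixes y :: "nat \<Rightarrow> 'a::real_normed_vector"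
  assumes "(\<Sum>k. ennreal (2 ^ k * (norm (y (Suc k) - y k))\<^sup>2)) < \<infinity>"
  shows "Cauchy y"
proof -
  define a where "a k = norm (y (Suc k) - y k)" for k
  have "summable (\<lambda>k. 2 ^ k * (a k)\<^sup>2)"
    using assms by (intro summable_suminf_not_top) (auto simp: a_def)
  moreover have "summable (\<lambda>k. (1/2::real) ^ k)" by (simp add: summable_geometric)
  ultimately have s: "summable (\<lambda>k. 2 ^ k * (a k)\<^sup>2 + (1/2) ^ k)" by (rule summable_add)
  have "a k \<le> 2 ^ k * (a k)\<^sup>2 + (1/2) ^ k" for k
  proof (cases "a k \<le> (1/2)^k")
    case False
    then have "1 \<le> 2 ^ k * a k" by (simp add: field_simps)
    then have "1 * a k \<le> 2 ^ k * a k * a k" by (intro mult_right_mono) (auto simp: a_def)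
    then show ?thesis by (simp add: power2_eq_square mult.assoc add_increasing2)
  qed (simp add: add_increasing)
  then have sa: "summable a"
    by (intro summable_comparison_test[OF _ s]) (auto simp: a_def)
  have ineq: "norm (y n - y m) \<le> (\<Sum>k=m..<n. a k)" if "m \<le> n" for m n
    using that
  proof (induction n rule: dec_induct)
    case (step n)
    have "norm (y (Suc n) - y m) \<le> norm (y (Suc n) - y n) + norm (y n - y m)"
      using norm_triangle_ineq[of "y (Suc n) - y n" "y n - y m"] by simp
    then show ?case using step by (simp add: a_def)
  qed simp
  show ?thesis
  proof (rule CauchyI')
    fix e :: real assume "0 < e"
    then obtain N where N: "\<And>m n. m \<ge> N \<Longrightarrow> norm (sum a {m..<n}) < e"
      using sa unfolding summable_Cauchy by blast
    have "dist (y m) (y n) < e" if "m \<ge> N" "n > m" for m n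
      using ineq[of m n] N[of m n] that by (auto simp: dist_norm norm_minus_commute)
    then show "\<exists>M. \<forall>m\<ge>M. \<forall>n>m. dist (y m) (y n) < e" by blast
  qed
qed

text \<open>Riesz-Fischer: along a fast subsequence the squared increments integrate to at most
  \<open>(1/4) ^ k\<close>, so their sum weighted by \<open>2 ^ k\<close> has finite integral and
  the representatives converge almost everywhere.\<close>

instance l2 :: banach
proof
  fix X :: "nat \<Rightarrow> l2" assume X: "Cauchy X"
  have q4: "((1/2) ^ k)\<^sup>2 = (1/4::real) ^ k" for k
  proof -
    have "((1/2) ^ k)\<^sup>2 = (((1::real)/2)\<^sup>2) ^ k" for k :: nat by (simp only: power_mult[symmetric] mult.commute)
    moreover have "(1/2)\<^sup>2 = (1/4::real)" by (simp add: power2_eq_square)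
    ultimately show ?thesis by metis
  qed
  have q2: "ennreal (2 ^ k) * ennreal ((1/4) ^ k) = ennreal ((1/2) ^ k)" for k
  proof -
    have "ennreal (2 ^ k) * ennreal ((1/4) ^ k) = ennreal (2 ^ k * (1/4) ^ k)"
      by (rule ennreal_mult[symmetric]) (rule zero_le_power, simp)+
    also have "(2::real) ^ k * (1/4) ^ k = (2 * (1/4)) ^ k" by (simp only: power_mult_distrib)
    finally show ?thesis by simp
  qed
  have "\<exists>M. \<forall>m\<ge>M. \<forall>n\<ge>M. norm (X m - X n) < (1/2) ^ k" for k :: nat
    by (rule CauchyD[OF X]) simp
  then obtain M where M: "\<And>k m n. m \<ge> M k \<Longrightarrow> n \<ge> M k \<Longrightarrow> norm (X m - X n) < (1/2) ^ k"
    by metis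
  \<comment> \<open>Summing makes the choice monotone: \<open>R m\<close> reaches the threshold of
    every precision level \<open>k \<le> m\<close>.\<close>
  define R where "R k = sum M {..k}" for k
  have RM: "M k \<le> R m" if "k \<le> m" for k m
  proof -
    have "M k \<le> sum M {..k}" by (rule member_le_sum) auto
    also have "\<dots> \<le> R m" unfolding R_def using that by (intro sum_mono2) auto
    finally show ?thesis .
  qed
  define y where "y k = rep_l2 (X (R k))" for k
  have [measurable]: "y k \<in> borel_measurable lebesgue" for k by (simp add: y_def)
  have diff: "(\<integral>\<^sup>+x. ennreal ((norm (y m x - y k x))\<^sup>2) \<partial>lebesgue) \<le> ennreal ((1/4) ^ k)"
    if "k \<le> m" for k m
  proof -
    have "norm (X (R m) - X (R k)) < (1/2) ^ k"
      using that by (intro M RM) auto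
    then have "(norm (X (R m) - X (R k)))\<^sup>2 \<le> ((1/2) ^ k)\<^sup>2"
      by (intro power_mono) auto
    also have "\<dots> = (1/4) ^ k"
      by (rule q4)
    finally show ?thesis
      by (simp add: y_def nn_integral_rep_l2_diff)
  qed
  have "(\<integral>\<^sup>+x. (\<Sum>k. ennreal (2 ^ k * (norm (y (Suc k) x - y k x))\<^sup>2)) \<partial>lebesgue)
      = (\<Sum>k. (\<integral>\<^sup>+x. ennreal (2 ^ k) * ennreal ((norm (y (Suc k) x - y k x))\<^sup>2) \<partial>lebesgue))"
    by (subst nn_integral_suminf) (auto simp: ennreal_mult)
  also have "\<dots> = (\<Sum>k. ennreal (2 ^ k) * (\<integral>\<^sup>+x. ennreal ((norm (y (Suc k) x - y k x))\<^sup>2) \<partial>lebesgue))"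
    by (subst nn_integral_cmult) auto
  also have "\<dots> \<le> (\<Sum>k. ennreal (2 ^ k) * ennreal ((1/4) ^ k))"
    by (intro suminf_le mult_left_mono diff) auto
  also have "\<dots> = (\<Sum>k. ennreal ((1/2) ^ k))"
    by (simp only: q2)
  also have "\<dots> = ennreal (\<Sum>k. (1/2) ^ k)"
    by (intro suminf_ennreal2 summable_geometric) auto
  also have "\<dots> < \<infinity>" by simp
  finally have "AE x in lebesgue. (\<Sum>k. ennreal (2 ^ k * (norm (y (Suc k) x - y k x))\<^sup>2)) \<noteq> \<infinity>"
    by (intro nn_integral_noteq_infinite) (auto simp: less_top)
  then have conv: "AE x in lebesgue. (\<lambda>k. y k x) \<longlonglongrightarrow> lim (\<lambda>k. y k x)"
  proof (rule AE_mp, intro AE_I2 impI)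
    fix x assume "(\<Sum>k. ennreal (2 ^ k * (norm (y (Suc k) x - y k x))\<^sup>2)) \<noteq> \<infinity>"
    then have "Cauchy (\<lambda>k. y k x)"
      by (intro Cauchy_if_weighted_sum_finite) (simp add: less_top)
    then show "(\<lambda>k. y k x) \<longlonglongrightarrow> lim (\<lambda>k. y k x)"
      by (simp add: Cauchy_convergent convergent_LIMSEQ_iff[symmetric])
  qed
  define w where "w x = lim (\<lambda>k. y k x)" for x
  have [measurable]: "w \<in> borel_measurable lebesgue"
    unfolding w_def by (rule borel_measurable_lim_metric) simp
  \<comment> \<open>Fatou's lemma passes the bound for \<open>y m - y k\<close>, uniform in
    \<open>m \<ge> k\<close>, to the pointwise limit.\<close>
  have wdiff: "(\<integral>\<^sup>+x. ennreal ((norm (w x - y k x))\<^sup>2) \<partial>lebesgue) \<le> ennreal ((1/4) ^ k)" for k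
  proof -
    have "(\<integral>\<^sup>+x. ennreal ((norm (w x - y k x))\<^sup>2) \<partial>lebesgue)
        = (\<integral>\<^sup>+x. liminf (\<lambda>m. ennreal ((norm (y m x - y k x))\<^sup>2)) \<partial>lebesgue)"
    proof (rule nn_integral_cong_AE, rule AE_mp[OF conv], intro AE_I2 impI)
      fix x assume c: "(\<lambda>k. y k x) \<longlonglongrightarrow> lim (\<lambda>k. y k x)"
      have "(\<lambda>m. ennreal ((norm (y m x - y k x))\<^sup>2)) \<longlonglongrightarrow> ennreal ((norm (w x - y k x))\<^sup>2)"
        by (intro tendsto_intros tendsto_ennrealI c[folded w_def])
      then show "ennreal ((norm (w x - y k x))\<^sup>2) = liminf (\<lambda>m. ennreal ((norm (y m x - y k x))\<^sup>2))"
        by (intro lim_imp_Liminf[symmetric]) auto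
    qed
    also have "\<dots> \<le> liminf (\<lambda>m. \<integral>\<^sup>+x. ennreal ((norm (y m x - y k x))\<^sup>2) \<partial>lebesgue)"
      by (intro nn_integral_liminf) simp
    also have "\<dots> \<le> limsup (\<lambda>m. \<integral>\<^sup>+x. ennreal ((norm (y m x - y k x))\<^sup>2) \<partial>lebesgue)"
      by (rule Liminf_le_Limsup) simp
    also have "\<dots> \<le> ennreal ((1/4) ^ k)"
      using diff[of k] by (intro Limsup_bounded eventually_sequentiallyI[of k]) auto
    finally show ?thesis .
  qed
  have "square_integrable (\<lambda>x. w x - y 0 x)"
    using wdiff[of 0] by (intro square_integrableI) (auto intro: le_less_trans)
  from square_integrable_add[OF this square_integrable_rep[of "X (R 0)"]]
  have sw: "square_integrable w" by (simp add: y_def)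
  have close: "norm (abs_l2 w - X (R k)) \<le> (1/2) ^ k" for k
  proof -
    have "ennreal ((norm (abs_l2 w - X (R k)))\<^sup>2) = (\<integral>\<^sup>+x. ennreal ((norm (w x - y k x))\<^sup>2) \<partial>lebesgue)"
      unfolding nn_integral_rep_l2_diff[symmetric] y_def using rep_abs_l2[OF sw]
      by (intro nn_integral_cong_AE) (auto elim!: eventually_mono)
    also have "\<dots> \<le> ennreal ((1/4) ^ k)" by (rule wdiff)
    finally have "(norm (abs_l2 w - X (R k)))\<^sup>2 \<le> (1/4) ^ k"
      by (subst (asm) ennreal_le_iff) auto
    also have "\<dots> = ((1/2) ^ k)\<^sup>2"
      by (rule q4[symmetric])
    finally show ?thesis by (rule power2_le_imp_le) simp
  qed
  have "X \<longlonglongrightarrow> abs_l2 w"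
  proof (rule LIMSEQ_I)
    fix e :: real assume "0 < e"
    then obtain k where k: "(1/2) ^ k < e / 2"
      using real_arch_pow_inv[of "e/2" "1/2"] by auto
    have "norm (X n - abs_l2 w) < e" if "n \<ge> M k" for n
    proof -
      have "norm (X n - X (R k)) < (1/2) ^ k" using that RM by (intro M) auto
      moreover have "norm (X n - abs_l2 w) \<le> norm (X n - X (R k)) + norm (abs_l2 w - X (R k))"
        using norm_triangle_ineq4[of "X n - X (R k)" "abs_l2 w - X (R k)"] by simp
      ultimately show ?thesis using close[of k] k by linarith
    qed
    then show "\<exists>no. \<forall>n\<ge>no. norm (X n - abs_l2 w) < e" by blast
  qed
  then show "convergent X" by (rule convergentI)
qed

section \<open>Bump functions\<close>

text \<open>The standard flat function \<open>exp (- 1 / t)\<close> with a polynomial in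
  \<open>1 / t\<close> in front. The extra factor makes the family closed under differentiation, so
  smoothness reduces to one derivative formula.\<close>

definition exp_flat :: "real poly \<Rightarrow> real \<Rightarrow> real" where
  "exp_flat p t = (if 0 < t then poly p (1 / t) * exp (- (1 / t)) else 0)"

lemma poly_times_exp_minus_tendsto_0:
  fixes p :: "real poly"
  shows "((\<lambda>y. poly p y * exp (- y)) \<longlongrightarrow> 0) at_top"
proof -
  have "((\<lambda>y. \<Sum>i\<le>degree p. coeff p i * (y ^ i / exp y)) \<longlongrightarrow> (\<Sum>i\<le>degree p. coeff p i * 0)) at_top"
    by (intro tendsto_sum tendsto_mult tendsto_const tendsto_power_div_exp_0)
  then show ?thesis
    by (simp add: poly_altdef sum_distrib_right exp_minus divide_inverse mult.assoc)
qed

lemma exp_flat_tendsto_0: "(exp_flat p \<longlongrightarrow> 0) (at_right 0)"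
proof -
  have "((\<lambda>t. poly p (inverse t) * exp (- inverse t)) \<longlongrightarrow> 0) (at_right 0)"
    by (rule filterlim_compose[OF poly_times_exp_minus_tendsto_0 filterlim_inverse_at_top_right])
  then show ?thesis
    by (rule Lim_transform_eventually)
      (auto simp: exp_flat_def eventually_at_filter divide_inverse)
qed

lemma has_derivative_exp_flat:
  "(exp_flat p has_real_derivative exp_flat ([:0, 0, 1:] * (p - pderiv p)) t) (at t)"
proof -
  consider "t < 0" | "0 < t" | "t = 0" by linarith
  then show ?thesis
  proof cases
    case 1
    have "((\<lambda>_. 0) has_real_derivative 0) (at t)" by simp
    then have "(exp_flat p has_real_derivative 0) (at t)"
      by (rule has_field_derivative_transform_within_open[of _ _ _ "{..<0}"])
        (use 1 in \<open>auto simp: exp_flat_def\<close>)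
    then show ?thesis using 1 by (simp add: exp_flat_def)
  next
    case 2
    have "((\<lambda>t. poly p (1 / t) * exp (- (1 / t))) has_real_derivative
        exp_flat ([:0, 0, 1:] * (p - pderiv p)) t) (at t)"
      using 2 by (auto intro!: derivative_eq_intros DERIV_chain2[OF poly_DERIV]
          simp: exp_flat_def field_simps power2_eq_square)
    then show ?thesis
      by (rule has_field_derivative_transform_within_open[of _ _ _ "{0<..}"])
        (use 2 in \<open>auto simp: exp_flat_def\<close>)
  next
    case 3
    \<comment> \<open>To the right of 0 the difference quotient is
      \<open>exp_flat (pCons 0 p)\<close>: division by the increment is one more power of
      \<open>1 / t\<close>.\<close>
    have "((\<lambda>h. (exp_flat p (0 + h) - exp_flat p 0) / h) \<longlongrightarrow> 0) (at_right 0)"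
      by (rule Lim_transform_eventually[OF exp_flat_tendsto_0[of "pCons 0 p"]])
        (auto simp: exp_flat_def eventually_at_filter)
    moreover have "((\<lambda>h. (exp_flat p (0 + h) - exp_flat p 0) / h) \<longlongrightarrow> 0) (at_left 0)"
      by (rule Lim_transform_eventually[OF tendsto_const])
        (auto simp: exp_flat_def eventually_at_filter)
    ultimately show ?thesis
      unfolding 3 DERIV_def by (simp add: exp_flat_def filterlim_split_at)
  qed
qed

section \<open>Calculus of \<open>C_k\<close> and the bump functions\<close>

lemma C_k_Suc_imp: "C_k (Suc k) g \<Longrightarrow> C_k k g"
proof (induction k arbitrary: g)
  case 0
  then show ?case
    by (auto intro!: continuous_at_imp_continuous_on differentiable_imp_continuous_within)
next
  case (Suc k)
  then show ?case by simp
qed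

lemma frechet_derivative_at_eq: "(g has_derivative g') (at x) \<Longrightarrow> frechet_derivative g (at x) = g'"
  by (metis frechet_derivative_at)

lemma frechet_derivative_plus:
  "g differentiable at x \<Longrightarrow> h differentiable at x \<Longrightarrow>
   frechet_derivative (\<lambda>x. g x + h x) (at x) = (\<lambda>e. frechet_derivative g (at x) e + frechet_derivative h (at x) e)"
  by (intro frechet_derivative_at_eq has_derivative_add) (auto simp: frechet_derivative_works[symmetric])

lemma frechet_derivative_scaleR:
  "g differentiable at x \<Longrightarrow>
   frechet_derivative (\<lambda>x. c *\<^sub>R g x) (at x) = (\<lambda>e. c *\<^sub>R frechet_derivative g (at x) e)"
  by (intro frechet_derivative_at_eq has_derivative_scaleR_right) (auto simp: frechet_derivative_works[symmetric])

lemma C_k_add: "C_k k g \<Longrightarrow> C_k k h \<Longrightarrow> C_k k (\<lambda>x. g x + h x)"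
proof (induction k arbitrary: g h)
  case (Suc k)
  then show ?case by (auto simp: frechet_derivative_plus)
qed (auto intro: continuous_on_add)

lemma C_k_scaleR: "C_k k g \<Longrightarrow> C_k k (\<lambda>x. c *\<^sub>R g x)"
proof (induction k arbitrary: g)
  case (Suc k)
  then show ?case by (auto simp: frechet_derivative_scaleR)
qed (auto intro: continuous_intros)

lemma C_k_mult:
  fixes g h :: "'a::euclidean_space \<Rightarrow> real"
  shows "C_k k g \<Longrightarrow> C_k k h \<Longrightarrow> C_k k (\<lambda>x. g x * h x)"
proof (induction k arbitrary: g h)
  case (Suc k)
  then have "frechet_derivative (\<lambda>x. g x * h x) (at x) =
      (\<lambda>e. g x * frechet_derivative h (at x) e + frechet_derivative g (at x) e * h x)" for x
    by (intro frechet_derivative_at_eq has_derivative_mult) (auto simp: frechet_derivative_works[symmetric])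
  moreover have "C_k k g" "C_k k h" using Suc.prems by (auto intro: C_k_Suc_imp simp del: C_k.simps)
  ultimately show ?case using Suc by (auto intro!: C_k_add)
qed (auto intro: continuous_intros)

lemma C_k_const: "C_k k (\<lambda>x. c)"
  by (induction k arbitrary: c) (auto simp: frechet_derivative_const)

lemma C_k_prod:
  fixes g :: "'i \<Rightarrow> 'a::euclidean_space \<Rightarrow> real"
  shows "(\<And>i. i \<in> A \<Longrightarrow> C_k k (g i)) \<Longrightarrow> C_k k (\<lambda>x. \<Prod>i\<in>A. g i x)"
  by (induction A rule: infinite_finite_induct) (auto intro: C_k_mult C_k_const)

text \<open>The chain rule brings out the constants \<open>a \<bullet> e\<close> and changes the
  polynomial, so the induction over \<open>k\<close> runs for all \<open>p\<close> at once.\<close>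

lemma C_k_exp_flat: "C_k k (\<lambda>x::'a::euclidean_space. exp_flat p (a \<bullet> x + b))"
proof (induction k arbitrary: p)
  case 0
  have "continuous_on UNIV (exp_flat p)"
    using has_derivative_exp_flat by (intro continuous_at_imp_continuous_on) (blast intro: DERIV_isCont)
  then show ?case
    by (auto intro!: continuous_on_compose2[of UNIV "exp_flat p"] continuous_intros)
next
  case (Suc k)
  let ?q = "[:0, 0, 1:] * (p - pderiv p)"
  have d: "((\<lambda>x. exp_flat p (a \<bullet> x + b)) has_derivative (\<lambda>e. (a \<bullet> e) *\<^sub>R exp_flat ?q (a \<bullet> x + b))) (at x)" for x
    using has_derivative_exp_flat[of p "a \<bullet> x + b", THEN has_field_derivative_imp_has_derivative]
    by (rule has_derivative_compose[rotated, THEN has_derivative_eq_rhs])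
      (auto intro!: derivative_eq_intros)
  then show ?case
    using Suc[of ?q] by (auto simp: frechet_derivative_at_eq[OF d] differentiable_def intro!: C_k_scaleR[where 'b=real, simplified])
qed

text \<open>Increasing \<open>n\<close> steepens the flanks without moving the support, so the bumps
  approach the indicator of the open box from below, with values in \<open>[0, 1]\<close>.\<close>

definition box_bump :: "'a::euclidean_space \<Rightarrow> 'a \<Rightarrow> nat \<Rightarrow> 'a \<Rightarrow> real" where
  "box_bump a b n x = (\<Prod>i\<in>Basis. exp_flat 1 (real (Suc n) * (x \<bullet> i - a \<bullet> i)) * exp_flat 1 (real (Suc n) * (b \<bullet> i - x \<bullet> i)))"

lemma smooth_box_bump: "smooth (box_bump a b n)"
  unfolding smooth_def
proof
  fix k
  have "C_k k (\<lambda>x. \<Prod>i\<in>Basis. exp_flat 1 ((real (Suc n) *\<^sub>R i) \<bullet> x + - real (Suc n) * (a \<bullet> i)) *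
     exp_flat 1 ((- real (Suc n) *\<^sub>R i) \<bullet> x + real (Suc n) * (b \<bullet> i)))"
    by (intro C_k_prod C_k_mult C_k_exp_flat)
  then show "C_k k (box_bump a b n)"
    by (simp add: box_bump_def[abs_def] algebra_simps inner_commute del: of_nat_Suc)
qed

lemma exp_flat_1: "0 \<le> exp_flat 1 t" "exp_flat 1 t \<le> 1" "exp_flat 1 t \<noteq> 0 \<longleftrightarrow> 0 < t"
  by (auto simp: exp_flat_def)

lemma box_bump_range: "0 \<le> box_bump a b n x" "box_bump a b n x \<le> 1"
  unfolding box_bump_def by (auto intro!: prod_nonneg prod_le_1 mult_nonneg_nonneg mult_le_one exp_flat_1)

lemma box_bump_nonzero: "box_bump a b n x \<noteq> 0 \<longleftrightarrow> x \<in> box a b"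
  by (auto simp: box_bump_def exp_flat_1 mem_box zero_less_mult_iff simp del: of_nat_Suc)

lemma box_bump_tendsto: "(\<lambda>n. box_bump a b n x) \<longlonglongrightarrow> indicator (box a b) x"
proof (cases "x \<in> box a b")
  case True
  have *: "(\<lambda>n. exp_flat 1 (real (Suc n) * t)) \<longlonglongrightarrow> 1" if "0 < t" for t
  proof -
    have "(\<lambda>n. exp (- (inverse (real (Suc n)) * (1 / t)))) \<longlonglongrightarrow> exp (- (0 * (1 / t)))"
      by (intro tendsto_intros LIMSEQ_inverse_real_of_nat)
    then show ?thesis using that by (simp add: exp_flat_def divide_inverse mult.commute del: of_nat_Suc)
  qed
  have "(\<lambda>n. box_bump a b n x) \<longlonglongrightarrow> (\<Prod>i\<in>(Basis::'a set). 1 * 1)"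
    unfolding box_bump_def using True by (intro tendsto_prod tendsto_mult *) (auto simp: mem_box)
  then show ?thesis using True by simp
next
  case False
  then show ?thesis using box_bump_nonzero[of a b _ x] by simp
qed

lemma box_bump_test_function: "cbox a b \<subseteq> U \<Longrightarrow> box_bump a b n \<in> test_functions U"
proof -
  assume "cbox a b \<subseteq> U"
  moreover have "closure {x. box_bump a b n x \<noteq> 0} \<subseteq> cbox a b"
    by (intro closure_minimal) (use box_subset_cbox in \<open>auto simp: box_bump_nonzero\<close>)
  moreover have "compact (closure {x. box_bump a b n x \<noteq> 0})"
    by (simp add: box_bump_nonzero bounded_box)
  ultimately show ?thesis by (auto simp: test_functions_def compact_supp_in_def smooth_box_bump)
qed

section \<open>The fundamental lemma of the calculus of variations\<close>

text \<open>The positive and negative parts of \<open>g\<close> are densities of two finite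
  measures. These agree on open boxes, an intersection-stable generator of the Borel sets, hence
  everywhere.\<close>

lemma AE_zero_if_box_integrals_zero:
  fixes g :: "'a::euclidean_space \<Rightarrow> real"
  assumes g: "integrable lborel g" and z: "\<And>a b. (LINT x|lborel. indicator (box a b) x * g x) = 0"
  shows "AE x in lborel. g x = 0"
proof -
  have [measurable]: "g \<in> borel_measurable borel" using g by auto
  have eq: "emeasure (density lborel (\<lambda>x. ennreal (g x))) X = emeasure (density lborel (\<lambda>x. ennreal (- g x))) X"
    if X: "X = box a b" for X a b
  proof -
    have [measurable]: "X \<in> sets borel" using X by simp
    define h where "h x = indicator X x * g x" for x
    have h: "integrable lborel h"
      unfolding h_def using integrable_mult_indicator[of X lborel g] g by simp
    have "0 = (LINT x|lborel. h x)" using z[of a b] X by (simp add: h_def)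
    also have "\<dots> = enn2real (\<integral>\<^sup>+x. ennreal (h x) \<partial>lborel) - enn2real (\<integral>\<^sup>+x. ennreal (- h x) \<partial>lborel)"
      by (rule real_lebesgue_integral_def[OF h])
    finally have "enn2real (\<integral>\<^sup>+x. ennreal (h x) \<partial>lborel) = enn2real (\<integral>\<^sup>+x. ennreal (- h x) \<partial>lborel)"
      by simp
    moreover have "(\<integral>\<^sup>+x. ennreal (h x) \<partial>lborel) < \<infinity>" "(\<integral>\<^sup>+x. ennreal (- h x) \<partial>lborel) < \<infinity>"
      using h by (auto simp: real_integrable_def less_top)
    ultimately have "(\<integral>\<^sup>+x. ennreal (h x) \<partial>lborel) = (\<integral>\<^sup>+x. ennreal (- h x) \<partial>lborel)"
      by (metis ennreal_enn2real infinity_ennreal_def)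
    moreover have "ennreal (h x) = ennreal (g x) * indicator X x"
      "ennreal (- h x) = ennreal (- g x) * indicator X x" for x
      by (auto simp: h_def indicator_def)
    ultimately show ?thesis by (simp add: emeasure_density)
  qed
  have fin: "(\<integral>\<^sup>+x. ennreal (g x) \<partial>lborel) \<noteq> \<infinity>" using g by (auto simp: real_integrable_def)
  have "density lborel (\<lambda>x. ennreal (g x)) = density lborel (\<lambda>x. ennreal (- g x))"
  proof (rule measure_eqI_generator_eq)
    let ?E = "range (\<lambda>(a, b). box a b::'a set)"
    show "Int_stable ?E" by (auto simp: Int_stable_def box_Int_box)
    show "?E \<subseteq> Pow UNIV" by simp
    let ?A = "\<lambda>n::nat. box (- (real n *\<^sub>R One)) (real n *\<^sub>R One) :: 'a set"
    show "range ?A \<subseteq> ?E" "(\<Union>i. ?A i) = UNIV" unfolding UN_box_eq_UNIV by auto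
    fix i
    have "emeasure (density lborel (\<lambda>x. ennreal (g x))) (?A i) \<le> (\<integral>\<^sup>+x. ennreal (g x) \<partial>lborel)"
      by (simp add: emeasure_density) (intro nn_integral_mono, auto simp: indicator_def)
    then show "emeasure (density lborel (\<lambda>x. ennreal (g x))) (?A i) \<noteq> \<infinity>" using fin by (auto simp: top_unique)
  qed (auto simp: borel_eq_box eq)
  then have "AE x in lborel. ennreal (g x) = ennreal (- g x)"
    using fin by (subst (asm) finite_density_unique) auto
  then show ?thesis
  proof eventually_elim
    case (elim x)
    then show "g x = 0"
      by (cases "0 \<le> g x") (auto simp: ennreal_neg dest: sym)
  qed
qed

lemma integrable_on_bounded_set:
  fixes r :: "real^3 \<Rightarrow> real^3"
  assumes r: "square_integrable r" and "X \<in> sets lebesgue" "emeasure lebesgue X < \<infinity>"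
  shows "integrable lebesgue (\<lambda>x. indicator X x *\<^sub>R r x)"
proof (rule Bochner_Integration.integrable_bound)
  show "integrable lebesgue (\<lambda>x. indicator X x + (norm (r x))\<^sup>2)"
    using assms by (auto simp: square_integrable_def)
  show "(\<lambda>x. indicator X x *\<^sub>R r x) \<in> borel_measurable lebesgue"
    using assms by (auto simp: square_integrable_def)
  have "norm (r x) \<le> 1 + (norm (r x))\<^sup>2" for x
    using sum_squares_bound[of "norm (r x)" 1] by (simp add: power2_eq_square) (smt (verit) norm_ge_zero)
  then show "AE x in lebesgue. norm (indicator X x *\<^sub>R r x) \<le> norm (indicator X x + (norm (r x))\<^sup>2)"
    by (auto simp: indicator_def abs_of_nonneg)
qed

text \<open>Dominated convergence along the bumps, which are test functions on \<open>U\<close>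
  because the closed box lies in \<open>U\<close>.\<close>

lemma box_integral_zero:
  fixes r :: "real^3 \<Rightarrow> real^3"
  assumes r: "square_integrable r" and U: "open U" and c: "cbox a b \<subseteq> U"
    and z: "\<And>\<phi>. \<phi> \<in> test_functions U \<Longrightarrow> (LINT x:U|lebesgue. (\<phi> x :: real) *\<^sub>R r x) = 0"
  shows "(LINT x|lebesgue. indicator (box a b) x *\<^sub>R r x) = 0"
proof -
  have [measurable]: "r \<in> borel_measurable lebesgue" using r by (simp add: square_integrable_def)
  have i: "integrable lebesgue (\<lambda>x. indicator (box a b) x *\<^sub>R r x)"
    by (intro integrable_on_bounded_set[OF r]) (auto simp: emeasure_lborel_box_finite[unfolded infinity_ennreal_def])
  have cont: "continuous_on UNIV (box_bump a b n :: real^3 \<Rightarrow> real)" for n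
    using smooth_box_bump[of a b n] unfolding smooth_def by (metis C_k.simps(1))
  then have [measurable]: "box_bump a b n \<in> borel_measurable (lebesgue :: (real^3) measure)" for n
    using cont[of n] by (intro measurable_completion) (auto intro: borel_measurable_continuous_onI)
  have "(\<lambda>n. LINT x|lebesgue. box_bump a b n x *\<^sub>R r x) \<longlonglongrightarrow> (LINT x|lebesgue. indicator (box a b) x *\<^sub>R r x)"
  proof (rule integral_dominated_convergence)
    show "integrable lebesgue (\<lambda>x. norm (indicator (box a b) x *\<^sub>R r x))" by (rule integrable_norm[OF i])
    show "AE x in lebesgue. (\<lambda>n. box_bump a b n x *\<^sub>R r x) \<longlonglongrightarrow> indicator (box a b) x *\<^sub>R r x"
      by (intro AE_I2 tendsto_scaleR box_bump_tendsto tendsto_const)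
    fix n
    have "\<bar>box_bump a b n x\<bar> \<le> indicator (box a b) x" for x :: "real^3"
      using box_bump_range[of a b n x] box_bump_nonzero[of a b n x] by (auto simp: indicator_def)
    then show "AE x in lebesgue. norm (box_bump a b n x *\<^sub>R r x) \<le> norm (indicator (box a b) x *\<^sub>R r x)"
      by (auto intro!: mult_right_mono)
    show "(\<lambda>x. indicator (box a b) x *\<^sub>R r x) \<in> borel_measurable lebesgue" by (rule borel_measurable_integrable[OF i])
  qed auto
  moreover have "(LINT x|lebesgue. box_bump a b n x *\<^sub>R r x) = 0" for n
  proof -
    have "box_bump a b n x *\<^sub>R r x = indicator U x *\<^sub>R (box_bump a b n x *\<^sub>R r x)" for x
      using box_bump_nonzero[of a b n x] c box_subset_cbox[of a b] by (auto simp: indicator_def)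
    then have "(LINT x|lebesgue. box_bump a b n x *\<^sub>R r x) = (LINT x:U|lebesgue. box_bump a b n x *\<^sub>R r x)"
      unfolding set_lebesgue_integral_def by metis
    then show ?thesis using z[OF box_bump_test_function[OF c]] by simp
  qed
  ultimately show ?thesis by (simp add: LIMSEQ_const_iff)
qed

text \<open>The argument is local and componentwise: inside a box with closure in \<open>U\<close>
  all box integrals of a component vanish, and a countable cover of \<open>U\<close> by closed boxes
  collects the null sets.\<close>

lemma fundamental_lemma:
  fixes r :: "real^3 \<Rightarrow> real^3"
  assumes r: "square_integrable r" and U: "open U"
    and z: "\<And>\<phi>. \<phi> \<in> test_functions U \<Longrightarrow> (LINT x:U|lebesgue. (\<phi> x :: real) *\<^sub>R r x) = 0"
  shows "AE x in lebesgue. x \<in> U \<longrightarrow> r x = 0"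
proof -
  have [measurable]: "r \<in> borel_measurable lebesgue" using r by (simp add: square_integrable_def)
  have box0: "AE x in lebesgue. x \<in> box a b \<longrightarrow> r x $ j = 0" if c: "cbox a b \<subseteq> U" for a b j
  proof -
    \<comment> \<open>\<open>AE_zero_if_box_integrals_zero\<close> works over \<open>lborel\<close>,
      so the Lebesgue measurable component is replaced by a Borel representative.\<close>
    obtain q where q [measurable]: "q \<in> borel_measurable borel" and rq: "AE x in lebesgue. r x $ j = q x"
    proof -
      have "(\<lambda>x. r x \<bullet> axis j 1) \<in> borel_measurable lebesgue" by measurable
      then show ?thesis
        using that completion_ex_borel_measurable_real[of "\<lambda>x. r x \<bullet> axis j 1" lborel]
        by (auto simp: AE_completion_iff inner_axis)
    qed
    have int: "integrable lebesgue (\<lambda>x. indicator (box c d) x * (indicator (box a b) x * q x)) \<and>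
      (LINT x|lebesgue. indicator (box c d) x * (indicator (box a b) x * q x)) = 0" for c d
    proof -
      \<comment> \<open>The two indicators combine to that of one box; if it is nonempty, its
        closure is a closed box inside \<open>cbox a b\<close>, hence inside
        \<open>U\<close>.\<close>
      obtain a' b' where ab: "box c d \<inter> box a b = box a' b'" by (auto simp: box_Int_box)
      have cU: "box a' b' = {} \<or> cbox a' b' \<subseteq> U"
      proof (cases "box a' b' = {}")
        case False
        then have "cbox a' b' = closure (box a' b')" by (simp add: closure_box)
        also have "\<dots> \<subseteq> cbox a b"
          using ab box_subset_cbox[of a b] by (intro closure_minimal) auto
        finally show ?thesis using c by auto
      qed simp
      have i: "integrable lebesgue (\<lambda>x. indicator (box a' b') x *\<^sub>R r x)"
        by (intro integrable_on_bounded_set[OF r]) (auto simp: emeasure_lborel_box_finite[unfolded infinity_ennreal_def])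
      have "(LINT x|lebesgue. indicator (box a' b') x *\<^sub>R r x) = 0"
        using cU box_integral_zero[OF r U _ z] by (cases "box a' b' = {}") auto
      then have 0: "(LINT x|lebesgue. (indicator (box a' b') x *\<^sub>R r x) \<bullet> axis j 1) = 0"
        using i by (subst integral_inner_left) auto
      have 1: "integrable lebesgue (\<lambda>x. (indicator (box a' b') x *\<^sub>R r x) \<bullet> axis j 1)"
        using i by (rule integrable_inner_left)
      have ae: "AE x in lebesgue. (indicator (box a' b') x *\<^sub>R r x) \<bullet> axis j 1 =
          indicator (box c d) x * (indicator (box a b) x * q x)"
        using rq by eventually_elim (auto simp: inner_axis ab[symmetric] indicator_def)
      have m: "(\<lambda>x. indicator (box c d) x * (indicator (box a b) x * q x)) \<in> borel_measurable lebesgue"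
        by (rule measurable_completion) measurable
      show ?thesis
        using 0 1 integral_cong_AE[OF _ m ae] integrable_cong_AE[OF _ m ae] by auto
    qed
    have "integrable lebesgue (\<lambda>x. indicator (box a b) x * q x)"
      using int[of a b] by (simp add: mult.assoc[symmetric] indicator_inter_arith[symmetric])
    then have "integrable lborel (\<lambda>x. indicator (box a b) x * q x)"
      by (subst (asm) integrable_completion) auto
    moreover have "(LINT x|lborel. indicator (box c d) x * (indicator (box a b) x * q x)) = 0" for c d
      using int[of c d] by (subst (asm) integral_completion) auto
    ultimately have "AE x in lborel. indicator (box a b) x * q x = 0"
      by (rule AE_zero_if_box_integrals_zero)
    then have "AE x in lebesgue. indicator (box a b) x * q x = 0" by (rule AE_completion)
    with rq show ?thesis by eventually_elim (auto simp: indicator_def)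
  qed
  have cbox0: "AE x in lebesgue. x \<in> cbox a b \<longrightarrow> r x = 0" if c: "cbox a b \<subseteq> U" for a b
  proof -
    have "AE x in lebesgue. \<forall>j\<in>UNIV. x \<in> box a b \<longrightarrow> r x $ j = 0"
      by (rule AE_finite_allI) (auto intro: box0[OF c])
    moreover have "AE x in lebesgue. x \<notin> cbox a b - box a b"
      using negligible_frontier_interval[of a b] by (intro AE_not_in) (simp add: negligible_iff_null_sets)
    ultimately show ?thesis by eventually_elim (auto simp: vec_eq_iff)
  qed
  obtain \<D> where D: "countable \<D>" "\<D> \<subseteq> Pow U" "\<And>X. X \<in> \<D> \<Longrightarrow> \<exists>a b. X = cbox a b" "\<Union>\<D> = U"
    using open_countable_Union_open_cbox[OF U] by metis
  have "AE x in lebesgue. \<forall>X\<in>\<D>. x \<in> X \<longrightarrow> r x = 0"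
  proof (rule AE_ball_countable'[OF _ D(1)])
    fix X assume X: "X \<in> \<D>"
    then obtain a b where "X = cbox a b" using D by blast
    then show "AE x in lebesgue. x \<in> X \<longrightarrow> r x = 0" using cbox0[of a b] X D(2) by auto
  qed
  then show ?thesis using D(4) by (auto elim!: eventually_mono)
qed

section \<open>Weak derivatives as suprema of affine functionals\<close>

lemma subspace_closure:
  fixes K :: "'a::real_normed_vector set"
  assumes K: "subspace K"
  shows "subspace (closure K)"
proof (rule subspaceI)
  show "0 \<in> closure K" using subspace_0[OF K] closure_subset by blast
  fix x y assume "x \<in> closure K" "y \<in> closure K"
  then obtain f g where "\<And>n. f n \<in> K" "f \<longlonglongrightarrow> x" "\<And>n. g n \<in> K" "g \<longlonglongrightarrow> y"
    unfolding closure_sequential by metis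
  then show "x + y \<in> closure K"
    unfolding closure_sequential by (intro exI[of _ "\<lambda>n. f n + g n"]) (auto intro: subspace_add[OF K] tendsto_add)
next
  fix c :: real and x assume "x \<in> closure K"
  then obtain f where "\<And>n. f n \<in> K" "f \<longlonglongrightarrow> x" unfolding closure_sequential by metis
  then show "c *\<^sub>R x \<in> closure K"
    unfolding closure_sequential
    by (intro exI[of _ "\<lambda>n. c *\<^sub>R f n"]) (auto intro: subspace_scale[OF K] tendsto_scaleR)
qed

lemma open_flow_domain: "admissible S \<Longrightarrow> open (flow_domain S)"
  by (cases S) auto

lemma bounded_flow_domain: "admissible S \<Longrightarrow> bounded (flow_domain S)"
  by (cases S) (auto simp: bounded_box)

lemma square_integrable_bounded_support:
  fixes w :: "real^3 \<Rightarrow> real^3"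
  assumes w: "continuous_on UNIV w" and X: "bounded X" "X \<in> sets lebesgue"
  shows "square_integrable (\<lambda>x. indicator X x *\<^sub>R w x)"
proof -
  have m [measurable]: "w \<in> borel_measurable lebesgue"
    using w by (intro measurable_completion) (auto intro: borel_measurable_continuous_onI)
  note [measurable] = X(2)
  have "bounded (w ` closure X)"
    using X(1) continuous_on_subset[OF w] by (intro compact_imp_bounded compact_continuous_image) auto
  then obtain C where "\<forall>y\<in>w ` closure X. norm y \<le> C" unfolding bounded_iff by blast
  then have C: "norm (w x) \<le> C" if "x \<in> closure X" for x using that by simp
  have fin: "emeasure lebesgue X < \<infinity>"
    using bounded_set_imp_lmeasurable[OF X] unfolding fmeasurable_def by blast
  have "integrable lebesgue (\<lambda>x. (norm (indicator X x *\<^sub>R w x))\<^sup>2)"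
  proof (rule Bochner_Integration.integrable_bound)
    show "integrable lebesgue (\<lambda>x. C\<^sup>2 * indicator X x)"
      by (intro integrable_mult_right integrable_real_indicator X(2) fin)
    show "AE x in lebesgue. norm ((norm (indicator X x *\<^sub>R w x))\<^sup>2) \<le> norm (C\<^sup>2 * indicator X x)"
      using C closure_subset[of X] by (auto simp: indicator_def intro!: AE_I2 power_mono)
  qed simp
  then show ?thesis by (simp add: square_integrable_def)
qed

lemma partial_deriv_support:
  assumes "x \<notin> closure {x. g x \<noteq> 0}"
  shows "partial_deriv i g x = 0"
proof -
  have "((\<lambda>_. 0) has_derivative (\<lambda>_. 0)) (at x)" by simp
  then have "(g has_derivative (\<lambda>_. 0)) (at x)"
    by (rule has_derivative_transform_within_open[of _ _ _ _ "- closure {x. g x \<noteq> 0}"])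
      (use assms closure_subset[of "{x. g x \<noteq> 0}"] in auto)
  then show ?thesis by (simp add: partial_deriv_def frechet_derivative_at_eq)
qed

lemma smooth_continuous: "smooth g \<Longrightarrow> continuous_on UNIV g"
  unfolding smooth_def by (metis C_k.simps(1))

lemma smooth_differentiable: "smooth g \<Longrightarrow> g differentiable at x"
  unfolding smooth_def by (metis C_k.simps(2))

lemma smooth_partial_deriv:
  assumes "smooth g"
  shows "continuous_on UNIV (partial_deriv i g)"
proof -
  have "C_k (Suc 0) g" using assms by (simp only: smooth_def)
  then show ?thesis
    by (auto simp: partial_deriv_def[abs_def] axis_in_Basis_iff)
qed

lemma test_functions_continuous:
  assumes \<phi>: "\<phi> \<in> test_functions U"
  shows "continuous_on UNIV \<phi>" "\<And>x. \<phi> x \<noteq> 0 \<Longrightarrow> x \<in> U"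
    "continuous_on UNIV (partial_deriv i \<phi>)" "\<And>x. partial_deriv i \<phi> x \<noteq> 0 \<Longrightarrow> x \<in> U"
proof -
  have cl: "closure {x. \<phi> x \<noteq> 0} \<subseteq> U" and sm: "smooth \<phi>"
    using \<phi> by (auto simp: test_functions_def compact_supp_in_def)
  then show "continuous_on UNIV \<phi>" "continuous_on UNIV (partial_deriv i \<phi>)"
    by (auto intro: smooth_continuous smooth_partial_deriv)
  show "x \<in> U" if "\<phi> x \<noteq> 0" for x using cl that closure_subset[of "{x. \<phi> x \<noteq> 0}"] by auto
  show "x \<in> U" if "partial_deriv i \<phi> x \<noteq> 0" for x using cl that partial_deriv_support[of x \<phi> i] by auto
qed

text \<open>Weak derivatives are defined by vector-valued integrals. Reading off component
  \<open>j\<close> as an inner product with a scalar field along the \<open>j\<close>-th axis moves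
  the question into the Hilbert space \<open>l2\<close>.\<close>

lemma inner_abs_l2_scaled_axis:
  fixes q :: "real^3 \<Rightarrow> real"
  assumes q: "continuous_on UNIV q" "\<And>x. q x \<noteq> 0 \<Longrightarrow> x \<in> U" and U: "open U" "bounded U"
  shows "v \<bullet> abs_l2 (\<lambda>x. q x *\<^sub>R axis j 1) = (LINT x:U|lebesgue. q x *\<^sub>R rep_l2 v x) $ j"
proof -
  have U' [measurable]: "U \<in> sets lebesgue" using U by simp
  have [measurable]: "q \<in> borel_measurable lebesgue"
    using q(1) by (intro measurable_completion) (auto intro: borel_measurable_continuous_onI)
  have ind: "q x *\<^sub>R y = indicator U x *\<^sub>R (q x *\<^sub>R y)" for x and y :: "real^3"
    using q(2)[of x] by (auto simp: indicator_def)
  have sq: "square_integrable (\<lambda>x. q x *\<^sub>R axis j 1)"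
    by (subst ind) (intro square_integrable_bounded_support continuous_intros q(1) U U')
  have "integrable lebesgue (\<lambda>x. q x *\<^sub>R rep_l2 v x)"
  proof (rule Bochner_Integration.integrable_bound)
    show "integrable lebesgue (\<lambda>x. (norm (q x *\<^sub>R axis j 1 :: real^3))\<^sup>2 + (norm (rep_l2 v x))\<^sup>2)"
      using sq square_integrable_rep[of v] by (intro Bochner_Integration.integrable_add) (auto simp: square_integrable_def)
    have "\<bar>a\<bar> * b \<le> (\<bar>a\<bar>)\<^sup>2 + b\<^sup>2" if "0 \<le> b" for a b :: real
    proof -
      have "2 * (\<bar>a\<bar> * b) \<le> \<bar>a\<bar>\<^sup>2 + b\<^sup>2" using sum_squares_bound[of "\<bar>a\<bar>" b] by (simp only: mult.assoc)
      moreover have "0 \<le> \<bar>a\<bar> * b" using that by simp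
      ultimately show ?thesis by linarith
    qed
    then show "AE x in lebesgue. norm (q x *\<^sub>R rep_l2 v x)
        \<le> norm ((norm (q x *\<^sub>R axis j 1 :: real^3))\<^sup>2 + (norm (rep_l2 v x))\<^sup>2)"
      by (auto simp: norm_axis_1 abs_of_nonneg)
  qed simp
  then have "(LINT x|lebesgue. (q x *\<^sub>R rep_l2 v x) \<bullet> axis j 1) = (LINT x|lebesgue. q x *\<^sub>R rep_l2 v x) \<bullet> axis j 1"
    by (intro integral_inner_left)
  also have "(LINT x|lebesgue. q x *\<^sub>R rep_l2 v x) = (LINT x:U|lebesgue. q x *\<^sub>R rep_l2 v x)"
    unfolding set_lebesgue_integral_def using ind by metis
  finally have "(LINT x|lebesgue. (q x *\<^sub>R rep_l2 v x) \<bullet> axis j 1) = (LINT x:U|lebesgue. q x *\<^sub>R rep_l2 v x) $ j"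
    by (simp add: inner_axis)
  moreover have "v \<bullet> abs_l2 (\<lambda>x. q x *\<^sub>R axis j 1) = (LINT x|lebesgue. (q x *\<^sub>R rep_l2 v x) \<bullet> axis j 1)"
    unfolding inner_l2_rep
  proof (rule integral_cong_AE)
    show "AE x in lebesgue. rep_l2 v x \<bullet> rep_l2 (abs_l2 (\<lambda>x. q x *\<^sub>R axis j 1)) x = (q x *\<^sub>R rep_l2 v x) \<bullet> axis j 1"
      using rep_abs_l2[OF sq] by eventually_elim simp
  qed auto
  ultimately show ?thesis by simp
qed

section \<open>The weak derivative and its adjoint\<close>

lemma orthogonal_to_test_functions:
  assumes U: "open U" "bounded U"
    and z: "\<And>\<phi> j. \<phi> \<in> test_functions U \<Longrightarrow> r \<bullet> abs_l2 (\<lambda>x. \<phi> x *\<^sub>R axis j 1) = 0"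
  shows "AE x in lebesgue. x \<in> U \<longrightarrow> rep_l2 r x = 0"
proof (rule fundamental_lemma[OF square_integrable_rep U(1)])
  fix \<phi> :: "real^3 \<Rightarrow> real" assume \<phi>: "\<phi> \<in> test_functions U"
  have "(LINT x:U|lebesgue. \<phi> x *\<^sub>R rep_l2 r x) $ j = 0" for j
    using inner_abs_l2_scaled_axis[OF test_functions_continuous(1,2)[OF \<phi>] U] z[OF \<phi>] by simp
  then show "(LINT x:U|lebesgue. \<phi> x *\<^sub>R rep_l2 r x) = 0" by (simp add: vec_eq_iff)
qed

text \<open>Up to sign, the graph of the adjoint of the weak derivative, seen as a relation. It
  contains the pairs that come from test functions (\<open>test_function_pair\<close>) and is a
  linear space by its very form.\<close>

definition weak_partial_pairs :: "setting \<Rightarrow> 3 \<Rightarrow> (l2 \<times> l2) set" where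
  "weak_partial_pairs S i = {(g, d). \<forall>u v. is_weak_partial S i u v \<longrightarrow> v \<bullet> g = - (u \<bullet> d)}"

lemma test_function_pair:
  assumes S: "admissible S" and \<phi>: "\<phi> \<in> test_functions (flow_domain S)"
  shows "(abs_l2 (\<lambda>x. \<phi> x *\<^sub>R axis j 1), abs_l2 (\<lambda>x. partial_deriv i \<phi> x *\<^sub>R axis j 1)) \<in> weak_partial_pairs S i"
proof -
  note U = open_flow_domain[OF S] bounded_flow_domain[OF S]
  show ?thesis
    unfolding weak_partial_pairs_def using \<phi>
    by (auto simp: inner_abs_l2_scaled_axis[OF test_functions_continuous(1,2)[OF \<phi>] U]
        inner_abs_l2_scaled_axis[OF test_functions_continuous(3,4)[OF \<phi>] U] is_weak_partial_def)
qed

text \<open>\<open>r\<close> lives outside the domain and \<open>v\<close> inside it, so they are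
  orthogonal. The hypothesis \<open>r \<bullet> v = r \<bullet> r\<close> covers both
  \<open>v = r\<close> and the residual \<open>r\<close> of an orthogonal projection of
  \<open>v\<close>.\<close>

lemma L2_domain_eq_zero:
  assumes "r \<bullet> v = r \<bullet> r" "AE x in lebesgue. x \<in> flow_domain S \<longrightarrow> rep_l2 r x = 0" "v \<in> L2_domain S"
  shows "r = 0"
proof -
  have "AE x in lebesgue. rep_l2 r x \<bullet> rep_l2 v x = 0"
    using assms(2,3) unfolding L2_domain_def mem_Collect_eq by eventually_elim auto
  then have "r \<bullet> v = 0" unfolding inner_l2_rep by (rule integral_eq_zero_AE)
  then show ?thesis using assms(1) by simp
qed

lemma weak_partial_unique:
  assumes S: "admissible S" and g: "is_weak_partial S i u g" "is_weak_partial S i u g'"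
  shows "g = g'"
proof -
  have "AE x in lebesgue. x \<in> flow_domain S \<longrightarrow> rep_l2 (g - g') x = 0"
  proof (rule orthogonal_to_test_functions[OF open_flow_domain[OF S] bounded_flow_domain[OF S]])
    fix \<phi> :: "real^3 \<Rightarrow> real" and j :: 3 assume "\<phi> \<in> test_functions (flow_domain S)"
    from test_function_pair[OF S this, of j i] g
    show "(g - g') \<bullet> abs_l2 (\<lambda>x. \<phi> x *\<^sub>R axis j 1) = 0"
      by (auto simp: weak_partial_pairs_def inner_diff_left)
  qed
  moreover have "g - g' \<in> L2_domain S"
    using g rep_l2_diff[of g g'] unfolding is_weak_partial_def L2_domain_def mem_Collect_eq
    by (auto elim!: eventually_elim2 dest: AE_conjI intro: AE_mp)
  ultimately show ?thesis
    using L2_domain_eq_zero[of "g - g'" "g - g'"] by simp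
qed

lemma is_weak_partial_weak_partial:
  assumes S: "admissible S" and u: "u \<in> space_H1 S"
  shows "is_weak_partial S i u (weak_partial S i u)"
proof -
  obtain g where g: "is_weak_partial S i u g" using u by (auto simp: space_H1_def)
  show ?thesis unfolding weak_partial_def
    by (rule theI[of _ g]) (use g weak_partial_unique[OF S] in auto)
qed

lemma subspace_fst_weak_partial_pairs: "subspace (fst ` weak_partial_pairs S i)"
proof (rule subspaceI)
  have "(0, 0) \<in> weak_partial_pairs S i" by (simp add: weak_partial_pairs_def)
  then show "0 \<in> fst ` weak_partial_pairs S i" by force
  fix x y assume "x \<in> fst ` weak_partial_pairs S i" "y \<in> fst ` weak_partial_pairs S i"
  then obtain d e where "(x, d) \<in> weak_partial_pairs S i" "(y, e) \<in> weak_partial_pairs S i" by auto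
  then have "(x + y, d + e) \<in> weak_partial_pairs S i"
    by (simp add: weak_partial_pairs_def inner_add_right)
  then show "x + y \<in> fst ` weak_partial_pairs S i" by force
next
  fix c :: real and x assume "x \<in> fst ` weak_partial_pairs S i"
  then obtain d where "(x, d) \<in> weak_partial_pairs S i" by auto
  then have "(c *\<^sub>R x, c *\<^sub>R d) \<in> weak_partial_pairs S i"
    by (simp add: weak_partial_pairs_def)
  then show "c *\<^sub>R x \<in> fst ` weak_partial_pairs S i" by force
qed

text \<open>The residual of the projection onto this closure is orthogonal to all test functions,
  hence vanishes on the domain, while \<open>v\<close> vanishes off it. So \<open>v\<close> is
  approximated by vectors \<open>g\<close> for which \<open>v \<bullet> g\<close> is a linear
  functional of \<open>u\<close>.\<close>

lemma weak_partial_in_closure: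
  assumes S: "admissible S" and v: "is_weak_partial S i u v"
  shows "v \<in> closure (fst ` weak_partial_pairs S i)"
proof -
  let ?K = "closure (fst ` weak_partial_pairs S i)"
  obtain p where p: "p \<in> ?K" "\<And>y. y \<in> ?K \<Longrightarrow> (v - p) \<bullet> y = 0"
    using closed_subspace_projection[OF subspace_closure[OF subspace_fst_weak_partial_pairs] closed_closure] by metis
  have "AE x in lebesgue. x \<in> flow_domain S \<longrightarrow> rep_l2 (v - p) x = 0"
  proof (rule orthogonal_to_test_functions[OF open_flow_domain[OF S] bounded_flow_domain[OF S]])
    fix \<phi> :: "real^3 \<Rightarrow> real" and j :: 3 assume "\<phi> \<in> test_functions (flow_domain S)"
    from test_function_pair[OF S this, of j i]
    show "(v - p) \<bullet> abs_l2 (\<lambda>x. \<phi> x *\<^sub>R axis j 1) = 0"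
      by (intro p(2) subsetD[OF closure_subset]) force
  qed
  moreover have "(v - p) \<bullet> v = (v - p) \<bullet> (v - p)"
    using p by (simp add: inner_diff_right)
  ultimately have "v - p = 0"
    using v by (intro L2_domain_eq_zero[where v = v and S = S]) (auto simp: is_weak_partial_def)
  then show ?thesis using p(1) by simp
qed

section \<open>Test fields and \<open>space_H\<close> as linear spaces\<close>

lemma divergence_free_add:
  "smooth w \<Longrightarrow> smooth z \<Longrightarrow> divergence_free w \<Longrightarrow> divergence_free z \<Longrightarrow> divergence_free (\<lambda>x. w x + z x)"
  by (simp add: divergence_free_def partial_deriv_def frechet_derivative_plus smooth_differentiable sum.distrib)

lemma divergence_free_scaleR:
  "smooth w \<Longrightarrow> divergence_free w \<Longrightarrow> divergence_free (\<lambda>x. c *\<^sub>R w x)"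
  by (simp add: divergence_free_def partial_deriv_def frechet_derivative_scaleR smooth_differentiable sum_distrib_left[symmetric])

lemma compact_supp_in_add:
  assumes "compact_supp_in w U" "compact_supp_in z U"
  shows "compact_supp_in (\<lambda>x. w x + z x) U"
proof -
  have "closure {x. w x + z x \<noteq> 0} \<subseteq> closure ({x. w x \<noteq> 0} \<union> {x. z x \<noteq> 0})"
    by (intro closure_mono) auto
  then have *: "closure {x. w x + z x \<noteq> 0} \<subseteq> closure {x. w x \<noteq> 0} \<union> closure {x. z x \<noteq> 0}" by simp
  then have "compact ((closure {x. w x \<noteq> 0} \<union> closure {x. z x \<noteq> 0}) \<inter> closure {x. w x + z x \<noteq> 0})"
    using assms by (intro compact_Int_closed compact_Un) (auto simp: compact_supp_in_def)
  with * show ?thesis using assms by (auto simp: compact_supp_in_def Int_absorb1)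
qed

lemma compact_supp_in_scaleR:
  assumes "compact_supp_in w U"
  shows "compact_supp_in (\<lambda>x. c *\<^sub>R w x) U"
proof (cases "c = 0")
  case False
  then have "{x. c *\<^sub>R w x \<noteq> 0} = {x. w x \<noteq> 0}" by auto
  then show ?thesis using assms by (simp add: compact_supp_in_def)
qed (simp add: compact_supp_in_def)

lemma test_fields_smooth: "w \<in> test_fields S \<Longrightarrow> smooth w"
  by (cases S) (auto simp: test_functions_def)

lemma square_integrable_test_field:
  "admissible S \<Longrightarrow> w \<in> test_fields S \<Longrightarrow> square_integrable (\<lambda>x. indicator (flow_domain S) x *\<^sub>R w x)"
  by (intro square_integrable_bounded_support smooth_continuous test_fields_smooth[of _ S] bounded_flow_domain)
    (auto dest: open_flow_domain)

lemma integrable_test_field: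
  assumes S: "admissible S" and w: "w \<in> test_fields S"
  shows "set_integrable lebesgue (flow_domain S) w"
proof -
  have "integrable lebesgue (\<lambda>x. indicator (flow_domain S) x *\<^sub>R (indicator (flow_domain S) x *\<^sub>R w x))"
    using bounded_set_imp_lmeasurable[OF bounded_flow_domain[OF S]] open_flow_domain[OF S]
    by (intro integrable_on_bounded_set square_integrable_test_field[OF S w])
      (auto simp: fmeasurable_def)
  moreover have "indicator (flow_domain S) x *\<^sub>R (indicator (flow_domain S) x *\<^sub>R w x)
      = indicator (flow_domain S) x *\<^sub>R w x" for x
    by (simp add: indicator_def)
  ultimately show ?thesis by (simp only: set_integrable_def)
qed

lemma test_fields_add:
  assumes S: "admissible S" and w: "w \<in> test_fields S" "z \<in> test_fields S"
  shows "(\<lambda>x. w x + z x) \<in> test_fields S"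
proof -
  have sm: "smooth (\<lambda>x. w x + z x)" 
    using test_fields_smooth[OF w(1)] test_fields_smooth[OF w(2)] by (auto simp: smooth_def intro: C_k_add)
  have df: "divergence_free (\<lambda>x. w x + z x)"
    using w test_fields_smooth[OF w(1)] test_fields_smooth[OF w(2)]
    by (intro divergence_free_add) (cases S; simp)+
  note i = integrable_test_field[OF S w(1)] integrable_test_field[OF S w(2)]
  show ?thesis
  proof (cases S)
    case (Periodic L)
    then show ?thesis using w sm df i by (simp add: set_integral_add)
  next
    case (No_Slip \<Omega>)
    then show ?thesis using w sm df by (auto simp: test_functions_def compact_supp_in_add)
  qed
qed

lemma test_fields_scaleR:
  assumes S: "admissible S" and w: "w \<in> test_fields S"
  shows "(\<lambda>x. c *\<^sub>R w x) \<in> test_fields S"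
proof -
  have sm: "smooth (\<lambda>x. c *\<^sub>R w x)" 
    using test_fields_smooth[OF w] by (auto simp: smooth_def intro: C_k_scaleR)
  have df: "divergence_free (\<lambda>x. c *\<^sub>R w x)"
    using w test_fields_smooth[OF w] by (intro divergence_free_scaleR) (cases S; simp)+
  show ?thesis
  proof (cases S)
    case (Periodic L)
    then show ?thesis using w sm df by simp
  next
    case (No_Slip \<Omega>)
    then show ?thesis using w sm df by (auto simp: test_functions_def compact_supp_in_scaleR)
  qed
qed

lemma zero_test_field: "(\<lambda>x. 0) \<in> test_fields S"
proof -
  have "smooth (\<lambda>x. 0)" "divergence_free (\<lambda>x. 0)"
    by (simp_all add: smooth_def C_k_const divergence_free_def partial_deriv_def frechet_derivative_const)
  then show ?thesis by (cases S) (auto simp: test_functions_def compact_supp_in_def)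
qed

lemma subspace_space_H:
  assumes S: "admissible S"
  shows "subspace (space_H S)"
  unfolding space_H_def
proof (intro subspace_closure subspaceI)
  have "L2_class S (\<lambda>x. 0) = 0" by (simp add: L2_class_def zero_l2_def)
  then show "0 \<in> L2_class S ` test_fields S" using zero_test_field by force
  fix x y assume "x \<in> L2_class S ` test_fields S" "y \<in> L2_class S ` test_fields S"
  then obtain w z where w: "x = L2_class S w" "w \<in> test_fields S" and z: "y = L2_class S z" "z \<in> test_fields S" by auto
  have "x + y = L2_class S (\<lambda>x. w x + z x)"
    using square_integrable_test_field[OF S w(2)] square_integrable_test_field[OF S z(2)]
    by (simp add: w z L2_class_def plus_l2.abs_eq L2_eq_def scaleR_add_right)
  then show "x + y \<in> L2_class S ` test_fields S" using test_fields_add[OF S w(2) z(2)] by auto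
next
  fix c x assume "x \<in> L2_class S ` test_fields S"
  then obtain w where w: "x = L2_class S w" "w \<in> test_fields S" by auto
  have "c *\<^sub>R x = L2_class S (\<lambda>x. c *\<^sub>R w x)"
    using square_integrable_test_field[OF S w(2)]
    by (simp add: w L2_class_def scaleR_l2.abs_eq L2_eq_def mult.commute)
  then show "c *\<^sub>R x \<in> L2_class S ` test_fields S" using test_fields_scaleR[OF S w(2)] by auto
qed

text \<open>Truncation at 0 by \<open>ennreal\<close> is harmless for squared norms, and it yields
  the positive part of a linear functional in \<open>inner_evaluation_measurable\<close>.\<close>

definition affine_sup :: "('a::real_inner \<times> real) set \<Rightarrow> 'a \<Rightarrow> ennreal" where
  "affine_sup A x = (SUP (h, c)\<in>A. ennreal (x \<bullet> h - c))"

text \<open>The gap between \<open>(norm x)^2\<close> and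
  \<open>2 * (x \<bullet> h) - (norm h)^2\<close> is \<open>(norm (x - h))^2\<close>, which vanishes
  for \<open>h = x\<close>.\<close>

lemma norm_square_affine_sup:
  assumes "subspace X" "x \<in> X"
  shows "ennreal ((norm x)\<^sup>2) = affine_sup ((\<lambda>h. (2 *\<^sub>R h, (norm h)\<^sup>2)) ` X) x"
proof (rule antisym)
  have "ennreal ((norm x)\<^sup>2) = ennreal (x \<bullet> (2 *\<^sub>R x) - (norm x)\<^sup>2)"
    by (simp add: power2_norm_eq_inner)
  also have "\<dots> \<le> affine_sup ((\<lambda>h. (2 *\<^sub>R h, (norm h)\<^sup>2)) ` X) x"
    unfolding affine_sup_def using assms(2) by (intro SUP_upper2[of "(2 *\<^sub>R x, (norm x)\<^sup>2)"]) auto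
  finally show "ennreal ((norm x)\<^sup>2) \<le> \<dots>" .
  have "2 * (x \<bullet> h) - (norm h)\<^sup>2 \<le> (norm x)\<^sup>2" for h
    using zero_le_power2[of "norm (x - h)"] unfolding power2_norm_eq_inner
    by (simp add: inner_diff_left inner_diff_right inner_commute)
  then show "affine_sup ((\<lambda>h. (2 *\<^sub>R h, (norm h)\<^sup>2)) ` X) x \<le> ennreal ((norm x)\<^sup>2)"
    unfolding affine_sup_def by (auto intro!: SUP_least ennreal_leI)
qed

text \<open>For the weak derivative \<open>v\<close>, the supremum of
  \<open>2 * (v \<bullet> g) - (norm g)^2\<close> over vectors \<open>g\<close> that come
  arbitrarily close to \<open>v\<close> is \<open>(norm v)^2\<close>. Integration by parts turns
  \<open>v \<bullet> g\<close> into \<open>- (u \<bullet> d)\<close>, which is linear in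
  \<open>u\<close>.\<close>

lemma weak_partial_affine_sup:
  assumes S: "admissible S"
  obtains A where "fst ` A \<subseteq> space_H S"
    "\<And>u. u \<in> space_H S \<Longrightarrow> u \<in> space_H1 S \<Longrightarrow> ennreal ((norm (weak_partial S i u))\<^sup>2) = affine_sup A u"
proof
  \<comment> \<open>\<open>h\<close> stands for \<open>-2\<close> times the projection of
    \<open>d\<close> onto \<open>space_H\<close>: it acts on \<open>space_H\<close> like
    \<open>-2 *\<^sub>R d\<close> but belongs to it, as the topology of the path space
    requires.\<close>
  let ?A = "{(h, c). h \<in> space_H S \<and> (\<exists>(g, d)\<in>weak_partial_pairs S i.
      (\<forall>x\<in>space_H S. x \<bullet> h = - 2 * (x \<bullet> d)) \<and> c = (norm g)\<^sup>2)}"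
  show "fst ` ?A \<subseteq> space_H S" by auto
  fix u assume uH: "u \<in> space_H S" and u1: "u \<in> space_H1 S"
  define v where "v = weak_partial S i u"
  have v: "is_weak_partial S i u v" unfolding v_def by (rule is_weak_partial_weak_partial[OF S u1])
  have exp: "2 * (v \<bullet> g) - (norm g)\<^sup>2 = (norm v)\<^sup>2 - (norm (v - g))\<^sup>2" for g
    unfolding power2_norm_eq_inner by (simp add: inner_diff_left inner_diff_right inner_commute)
  have vg: "v \<bullet> g = - (u \<bullet> d)" if "(g, d) \<in> weak_partial_pairs S i" for g d
    using that v by (auto simp: weak_partial_pairs_def)
  show "ennreal ((norm (weak_partial S i u))\<^sup>2) = affine_sup ?A u"
    unfolding v_def[symmetric]
  proof (rule antisym)
    show "affine_sup ?A u \<le> ennreal ((norm v)\<^sup>2)"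
      unfolding affine_sup_def
    proof (rule SUP_least, clarify)
      fix h g d assume "\<forall>x\<in>space_H S. x \<bullet> h = - 2 * (x \<bullet> d)" and gd: "(g, d) \<in> weak_partial_pairs S i"
      then have "u \<bullet> h - (norm g)\<^sup>2 = 2 * (v \<bullet> g) - (norm g)\<^sup>2" using uH vg[OF gd] by simp
      also have "\<dots> \<le> (norm v)\<^sup>2" unfolding exp by simp
      finally show "ennreal (u \<bullet> h - (norm g)\<^sup>2) \<le> ennreal ((norm v)\<^sup>2)" by (rule ennreal_leI)
    qed
    show "ennreal ((norm v)\<^sup>2) \<le> affine_sup ?A u"
    proof (rule ennreal_le_epsilon)
      fix e :: real assume e: "0 < e"
      \<comment> \<open>The supremum is approached rather than attained: the loss
        \<open>(norm (v - g))^2\<close> is kept below \<open>e\<close>.\<close>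
      obtain g where g: "g \<in> fst ` weak_partial_pairs S i" "dist g v < sqrt e"
        using weak_partial_in_closure[OF S v] e unfolding closure_approachable by (metis real_sqrt_gt_zero)
      then obtain d where gd: "(g, d) \<in> weak_partial_pairs S i" by auto
      obtain p where p: "p \<in> space_H S" "\<And>y. y \<in> space_H S \<Longrightarrow> (d - p) \<bullet> y = 0"
        using closed_subspace_projection[OF subspace_space_H[OF S], of d] by (auto simp: space_H_def)
      have px: "x \<bullet> p = x \<bullet> d" if "x \<in> space_H S" for x
        using p(2)[OF that] by (simp add: inner_diff_left inner_commute[of x])
      have p2: "- (2 *\<^sub>R p) \<in> space_H S"
        using p(1) subspace_scale[OF subspace_space_H[OF S], of p "-2"] by simp
      define a where "a = 2 * (v \<bullet> g) - (norm g)\<^sup>2"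
      have "(- (2 *\<^sub>R p), (norm g)\<^sup>2) \<in> ?A"
        using gd p2 px by (auto intro!: bexI[of _ "(g, d)"])
      then have "ennreal (u \<bullet> - (2 *\<^sub>R p) - (norm g)\<^sup>2) \<le> affine_sup ?A u"
        unfolding affine_sup_def by (intro SUP_upper2[of "(- (2 *\<^sub>R p), (norm g)\<^sup>2)"]) auto
      moreover have "u \<bullet> - (2 *\<^sub>R p) - (norm g)\<^sup>2 = a"
        using vg[OF gd] px[OF uH] by (simp add: a_def)
      ultimately have le: "ennreal a \<le> affine_sup ?A u" by simp
      have "(norm (v - g))\<^sup>2 < (sqrt e)\<^sup>2"
        using g(2) by (intro power_strict_mono) (auto simp: dist_norm norm_minus_commute)
      then have "(norm v)\<^sup>2 \<le> a + e" using exp[of g] e by (simp add: a_def)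
      then have "ennreal ((norm v)\<^sup>2) \<le> ennreal (a + e)" by (rule ennreal_leI)
      also have "\<dots> \<le> ennreal a + ennreal e"
        using e by (subst ennreal_plus_if) (auto intro: ennreal_leI)
      also have "\<dots> \<le> affine_sup ?A u + ennreal e" using le by (rule add_right_mono)
      finally show "ennreal ((norm v)\<^sup>2) \<le> affine_sup ?A u + ennreal e" .
    qed
  qed
qed

section \<open>Measurability of the evaluation functionals\<close>

lemma weak_continuous_in_H:
  assumes "u \<in> C_loc_weak S J" "t \<in> J"
  shows "u t \<in> space_H S"
proof -
  have "u t \<in> topspace (weak_H S)"
    using assms continuous_map_image_subset_topspace[of "top_of_set J" "weak_H S" u]
    by (auto simp: C_loc_weak_def weakly_continuous_on_def)
  then show ?thesis by (auto simp: weak_H_def)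
qed

lemma weak_continuous_inner:
  assumes u: "u \<in> C_loc_weak S J" and h: "h \<in> space_H S"
  shows "continuous_on J (\<lambda>t. u t \<bullet> h)"
proof -
  have "continuous_map (weak_H S) euclideanreal (\<lambda>x. x \<bullet> h)"
    unfolding continuous_map_def
  proof (intro conjI allI impI)
    fix U :: "real set" assume "openin euclideanreal U"
    then have "openin (weak_H S) {x \<in> space_H S. x \<bullet> h \<in> U}"
      unfolding weak_H_def using h by (intro topology_generated_by_Basis) auto
    moreover have "topspace (weak_H S) = space_H S"
      unfolding weak_H_def using h by auto
    ultimately show "openin (weak_H S) {x \<in> topspace (weak_H S). x \<bullet> h \<in> U}" by simp
  qed simp
  from continuous_map_compose[OF _ this, of "top_of_set J" u] u show ?thesis
    by (simp add: C_loc_weak_def weakly_continuous_on_def o_def)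
qed

text \<open>Basic open sets of \<open>C_loc_topology\<close> control a trajectory on compact
  subintervals only. At an end point that belongs to \<open>I\<close> the neighbourhood is
  one-sided, so the two sides are treated separately.\<close>

lemma interval_compact_neighbourhood:
  fixes s :: real
  assumes I: "is_interval I" and s: "s \<in> I"
  obtains a b d where "0 < d" "{a..b} \<subseteq> I" "{s - d<..<s + d} \<inter> I \<subseteq> {a..b}"
proof -
  have "\<exists>a d1. a \<in> I \<and> a \<le> s \<and> 0 < d1 \<and> (\<forall>x\<in>I. s - d1 < x \<longrightarrow> a \<le> x)"
  proof (cases "\<exists>x\<in>I. x < s")
    case True
    then obtain x where "x \<in> I" "x < s" by auto
    then show ?thesis by (intro exI[of _ x] exI[of _ "s - x"]) auto
  next
    case False
    then show ?thesis using s by (intro exI[of _ s] exI[of _ 1]) (auto simp: not_less)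
  qed
  then obtain a d1 where a: "a \<in> I" "a \<le> s" "0 < d1" "\<And>x. x \<in> I \<Longrightarrow> s - d1 < x \<Longrightarrow> a \<le> x" by blast
  have "\<exists>b d2. b \<in> I \<and> s \<le> b \<and> 0 < d2 \<and> (\<forall>x\<in>I. x < s + d2 \<longrightarrow> x \<le> b)"
  proof (cases "\<exists>x\<in>I. s < x")
    case True
    then obtain x where "x \<in> I" "s < x" by auto
    then show ?thesis by (intro exI[of _ x] exI[of _ "x - s"]) auto
  next
    case False
    then show ?thesis using s by (intro exI[of _ s] exI[of _ 1]) (auto simp: not_less)
  qed
  then obtain b d2 where b: "b \<in> I" "s \<le> b" "0 < d2" "\<And>x. x \<in> I \<Longrightarrow> x < s + d2 \<Longrightarrow> x \<le> b" by blast
  have "{a..b} \<subseteq> I" using I a(1) b(1) unfolding is_interval_1 by (meson atLeastAtMost_iff subsetI)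
  moreover have "{s - min d1 d2<..<s + min d1 d2} \<inter> I \<subseteq> {a..b}"
    using a(4) b(4) by auto
  ultimately show ?thesis by (intro that[of "min d1 d2" a b]) (use a(3) b(3) in auto)
qed

text \<open>Of three points of an interval the middle one is interior, so at most two are left
  over.\<close>

lemma finite_interval_minus_interior:
  fixes I :: "real set"
  assumes I: "is_interval I"
  shows "finite (I - interior I)"
proof (rule ccontr)
  assume "infinite (I - interior I)"
  then obtain T where T: "finite T" "card T = 3" "T \<subseteq> I - interior I"
    using infinite_arbitrarily_large by blast
  then have ne: "T \<noteq> {}" by auto
  have "card {Min T, Max T} \<le> 2" by (simp add: card_insert_if)
  then have "\<not> T \<subseteq> {Min T, Max T}" using T card_mono[of "{Min T, Max T}" T] by auto
  then obtain y where y: "y \<in> T" "y \<noteq> Min T" "y \<noteq> Max T" by auto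
  then have lt: "Min T < y" "y < Max T" using T(1) by (auto simp: order_less_le)
  have "Min T \<in> I" "Max T \<in> I" using Min_in[OF T(1) ne] Max_in[OF T(1) ne] T(3) by auto
  then have "{Min T<..<Max T} \<subseteq> I"
    using I unfolding is_interval_1 by (meson greaterThanLessThan_iff less_imp_le subsetI)
  then have "y \<in> interior I" using lt by (intro interiorI[of "{Min T<..<Max T}"]) auto
  then show False using y T(3) by auto
qed

section \<open>Borel sets of the path space and joint measurability\<close>

lemma space_borel_prob_measure:
  assumes "borel_prob_measure T \<rho>"
  shows "space \<rho> = topspace T"
proof -
  have sub: "{U. openin T U} \<subseteq> Pow (topspace T)" by (auto dest: openin_subset)
  then have "sets \<rho> = sets (sigma (topspace T) {U. openin T U})"
    using assms by (simp add: borel_prob_measure_def)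
  from sets_eq_imp_space_eq[OF this] show ?thesis using sub by (simp add: space_measure_of)
qed

lemma openin_borel_prob_measure:
  "borel_prob_measure T \<rho> \<Longrightarrow> openin T U \<Longrightarrow> U \<in> sets \<rho>"
  by (auto simp: borel_prob_measure_def)

lemma topspace_C_loc: "topspace (C_loc_topology S J) \<subseteq> C_loc_weak S J"
  by (auto simp: C_loc_topology_def)

text \<open>The function is lower semicontinuous on the product. Its superlevel sets are countable unions
  of open rectangles because one factor, the time interval, is second countable.\<close>

lemma affine_sup_evaluation_measurable:
  assumes I: "is_interval I" and \<rho>: "borel_prob_measure (C_loc_topology S I) \<rho>"
    and A: "fst ` A \<subseteq> space_H S"
  shows "(\<lambda>(s, u). indicator I s * affine_sup A (u s)) \<in> borel_measurable (lebesgue \<Otimes>\<^sub>M \<rho>)"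
proof (rule borel_measurableI_greater)
  fix y :: ennreal
  let ?T = "C_loc_topology S I"
  define W where "W = {(s, u). s \<in> I \<and> u \<in> space \<rho> \<and> y < affine_sup A (u s)}"
  \<comment> \<open>The largest open set of trajectories whose product with the rational time window
    stays in \<open>W\<close>. As a union of open sets it is Borel, however large the union is, so
    countability is asked of the time windows alone.\<close>
  define Op where "Op p q = \<Union>{U. openin ?T U \<and> ({real_of_rat p<..<real_of_rat q} \<inter> I) \<times> U \<subseteq> W}" for p q
  have "I \<in> sets borel" using I by (rule real_interval_borel_measurable)
  have "Op p q \<in> sets \<rho>" for p q
    unfolding Op_def by (intro openin_borel_prob_measure[OF \<rho>] openin_Union) auto
  then have "({real_of_rat p<..<real_of_rat q} \<inter> I) \<times> Op p q \<in> sets (lebesgue \<Otimes>\<^sub>M \<rho>)" for p q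
    using \<open>I \<in> sets borel\<close> by (intro pair_measureI) auto
  then have "(\<Union>(p, q)\<in>UNIV. ({real_of_rat p<..<real_of_rat q} \<inter> I) \<times> Op p q) \<in> sets (lebesgue \<Otimes>\<^sub>M \<rho>)"
    by (intro sets.countable_UN') auto
  also have "(\<Union>(p, q)\<in>UNIV. ({real_of_rat p<..<real_of_rat q} \<inter> I) \<times> Op p q) = W"
  proof (intro antisym subsetI)
    fix z assume "z \<in> W"
    then obtain s u where z: "z = (s, u)" and s: "s \<in> I" and u: "u \<in> space \<rho>" and y: "y < affine_sup A (u s)"
      by (auto simp: W_def)
    have uC: "u \<in> C_loc_weak S I" using u topspace_C_loc space_borel_prob_measure[OF \<rho>] by auto
    obtain h c where hc: "(h, c) \<in> A" "y < ennreal (u s \<bullet> h - c)"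
      using y by (auto simp: affine_sup_def less_SUP_iff)
    then have h: "h \<in> space_H S" using A by force
    obtain y' where y': "y = ennreal y'" "0 \<le> y'"
      using hc(2) by (cases y) auto
    \<comment> \<open>A third of the margin: one third is lost when the time moves, one when the
      trajectory moves, and the last keeps the inequality strict.\<close>
    define e where "e = (u s \<bullet> h - c - y') / 3"
    have e: "0 < e" using hc(2) y' by (simp add: e_def ennreal_less_iff)
    obtain a b d where d: "0 < d" "{a..b} \<subseteq> I" "{s - d<..<s + d} \<inter> I \<subseteq> {a..b}"
      using interval_compact_neighbourhood[OF I s] by metis
    obtain d' where d': "0 < d'" "\<And>r. r \<in> I \<Longrightarrow> \<bar>r - s\<bar> < d' \<Longrightarrow> \<bar>u r \<bullet> h - u s \<bullet> h\<bar> < e"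
      using weak_continuous_inner[OF uC h] s e unfolding continuous_on_iff dist_real_def by metis
    obtain p q where p: "s - min d d' < real_of_rat p" "real_of_rat p < s"
      and q: "s < real_of_rat q" "real_of_rat q < s + min d d'"
      using of_rat_dense[of "s - min d d'" s] of_rat_dense[of s "s + min d d'"] d(1) d'(1) by auto
    define U where "U = {w \<in> C_loc_weak S I. \<forall>t\<in>{a..b}. \<bar>(w t - u t) \<bullet> h\<bar> < e}"
    have "openin ?T U"
      unfolding C_loc_topology_def U_def using uC d(2) h e
      by (intro topology_generated_by_Basis) blast
    moreover have "({real_of_rat p<..<real_of_rat q} \<inter> I) \<times> U \<subseteq> W"
    proof clarify
      fix r w assume r: "r \<in> {real_of_rat p<..<real_of_rat q}" "r \<in> I" and w: "w \<in> U"
      have "s - d < r" "r < s + d" using r p q min.cobounded1[of d d'] by auto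
      then have "r \<in> {a..b}" using r d(3) by auto
      then have "\<bar>(w r - u r) \<bullet> h\<bar> < e" using w by (simp add: U_def)
      moreover have "\<bar>u r \<bullet> h - u s \<bullet> h\<bar> < e" using r p q by (intro d'(2)) auto
      moreover have "3 * e = u s \<bullet> h - c - y'" by (simp add: e_def)
      ultimately have "y' < w r \<bullet> h - c" using e unfolding abs_less_iff inner_diff_left by linarith
      then have "y < ennreal (w r \<bullet> h - c)" using y' by (simp add: ennreal_less_iff)
      also have "\<dots> \<le> affine_sup A (w r)" unfolding affine_sup_def using hc(1) by (intro SUP_upper2) auto
      finally have "y < affine_sup A (w r)" .
      moreover have "w \<in> space \<rho>"
        using w openin_subset[OF \<open>openin ?T U\<close>] space_borel_prob_measure[OF \<rho>] by auto
      ultimately show "(r, w) \<in> W" using r by (auto simp: W_def)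
    qed
    moreover have "u \<in> U" using uC e by (auto simp: U_def)
    ultimately have "u \<in> Op p q" unfolding Op_def by blast
    then show "z \<in> (\<Union>(p, q)\<in>UNIV. ({real_of_rat p<..<real_of_rat q} \<inter> I) \<times> Op p q)"
      using p q s z by auto
  qed (auto simp: Op_def)
  finally have "W \<in> sets (lebesgue \<Otimes>\<^sub>M \<rho>)" .
  also have "W = {x \<in> space (lebesgue \<Otimes>\<^sub>M \<rho>). y < (case x of (s, u) \<Rightarrow> indicator I s * affine_sup A (u s))}"
    by (auto simp: W_def space_pair_measure split: split_indicator split_indicator_asm)
  finally show "{x \<in> space (lebesgue \<Otimes>\<^sub>M \<rho>). y < (case x of (s, u) \<Rightarrow> indicator I s * affine_sup A (u s))}
      \<in> sets (lebesgue \<Otimes>\<^sub>M \<rho>)" .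
qed

text \<open>A signed functional is the difference of its positive and negative parts, and these are
  \<open>affine_sup\<close> of singletons with \<open>h\<close> and \<open>- h\<close>.\<close>

lemma inner_evaluation_measurable:
  assumes I: "is_interval I" and \<rho>: "borel_prob_measure (C_loc_topology S I) \<rho>"
    and h: "h \<in> space_H S" "admissible S"
  shows "(\<lambda>(s, u). indicator I s * (u s \<bullet> h)) \<in> borel_measurable (lebesgue \<Otimes>\<^sub>M \<rho>)"
proof -
  have mh: "- h \<in> space_H S" using subspace_neg[OF subspace_space_H[OF h(2)] h(1)] .
  have eq: "indicator I s * (u s \<bullet> h) = enn2real (indicator I s * affine_sup {(h, 0)} (u s))
      - enn2real (indicator I s * affine_sup {(- h, 0)} (u s))" for s and u :: "real \<Rightarrow> l2"
    by (cases "0 \<le> u s \<bullet> h") (auto simp: affine_sup_def ennreal_neg indicator_def)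
  have "(\<lambda>x. enn2real (case x of (s, u) \<Rightarrow> indicator I s * affine_sup {(h, 0)} (u s))
      - enn2real (case x of (s, u) \<Rightarrow> indicator I s * affine_sup {(- h, 0)} (u s)))
      \<in> borel_measurable (lebesgue \<Otimes>\<^sub>M \<rho>)"
    using h mh by (intro borel_measurable_diff measurable_compose[OF affine_sup_evaluation_measurable[OF I \<rho>]]) auto
  then show ?thesis
    by (rule measurable_cong[THEN iffD1, rotated]) (auto simp: eq)
qed

section \<open>A bounded representative of the force\<close>

lemma AE_lebesgue_on_null_set:
  assumes "I \<in> sets lebesgue" "AE s in lebesgue_on I. P s"
  obtains N where "N \<in> null_sets lebesgue" "\<And>s. s \<in> I \<Longrightarrow> s \<notin> N \<Longrightarrow> P s"
proof -
  have "AE s in lebesgue. s \<in> I \<longrightarrow> P s"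
    using assms by (simp add: AE_restrict_space_iff)
  then obtain N where "{s \<in> space lebesgue. \<not> (s \<in> I \<longrightarrow> P s)} \<subseteq> N" "emeasure lebesgue N = 0" "N \<in> sets lebesgue"
    by (rule AE_E)
  then have "N \<in> null_sets lebesgue" unfolding null_sets_def by blast
  then show ?thesis using that[of N] \<open>_ \<subseteq> N\<close> by auto
qed

text \<open>\<open>inner_evaluation_measurable\<close> needs a fixed vector, but \<open>f\<close>
  moves with time. A simple approximation takes finitely many values in \<open>space_H\<close>, each
  handled separately, and the pairing passes to the limit. Setting the representative to 0 on the
  exceptional set makes convergence and bound hold at every time.\<close>

lemma L_inf_representative:
  assumes I: "is_interval I" and \<rho>: "borel_prob_measure (C_loc_topology S I) \<rho>"
    and S: "admissible S" and f: "f \<in> L_inf I (space_H S) norm"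
  obtains f0 C N where "N \<in> null_sets lebesgue" "\<And>s. s \<in> I \<Longrightarrow> s \<notin> N \<Longrightarrow> f s = f0 s"
    "\<And>s. norm (f0 s) \<le> C"
    "(\<lambda>(s, u). indicator I s * (f0 s \<bullet> u s)) \<in> borel_measurable (lebesgue \<Otimes>\<^sub>M \<rho>)"
proof -
  have Ib: "I \<in> sets borel" using I by (rule real_interval_borel_measurable)
  then have Il [measurable]: "I \<in> sets lebesgue" by simp
  obtain C where C: "AE t in lebesgue_on I. norm (f t) \<le> C"
    using f by (auto simp: L_inf_def)
  have "\<exists>g. (\<forall>n. simple_function (lebesgue_on I) (g n) \<and> g n ` I \<subseteq> space_H S) \<and>
      (AE t in lebesgue_on I. (\<lambda>n. norm (g n t - f t)) \<longlonglongrightarrow> 0)"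
    using f by (simp add: L_inf_def strongly_measurable_on_def)
  then obtain g where g: "\<And>n. simple_function (lebesgue_on I) (g n)" "\<And>n. g n ` I \<subseteq> space_H S"
    and lim: "AE t in lebesgue_on I. (\<lambda>n. norm (g n t - f t)) \<longlonglongrightarrow> 0"
    by blast
  have "AE t in lebesgue_on I. (\<lambda>n. norm (g n t - f t)) \<longlonglongrightarrow> 0 \<and> norm (f t) \<le> C"
    using lim C by eventually_elim auto
  then obtain N where N: "N \<in> null_sets lebesgue"
      "\<And>s. s \<in> I \<Longrightarrow> s \<notin> N \<Longrightarrow> (\<lambda>n. norm (g n s - f s)) \<longlonglongrightarrow> 0 \<and> norm (f s) \<le> C"
    by (rule AE_lebesgue_on_null_set[OF Il _ that])
  have Nm [measurable]: "N \<in> sets lebesgue" using N(1) by auto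
  then have Nc: "- N \<in> sets lebesgue" using sets.compl_sets[of N lebesgue] by (simp add: Compl_eq_Diff_UNIV)
  define f0 where "f0 s = (if s \<in> I \<and> s \<notin> N then f s else 0)" for s
  have gm: "(\<lambda>(s, u). indicator I s * (indicator (- N) s * (g n s \<bullet> u s))) \<in> borel_measurable (lebesgue \<Otimes>\<^sub>M \<rho>)" for n
  proof -
    have fin: "finite (g n ` I)" using simple_functionD(1)[OF g(1)[of n]] by simp
    have X [measurable]: "g n -` {h} \<inter> I \<in> sets lebesgue" for h
    proof -
      have "g n -` {h} \<inter> I \<in> sets (lebesgue_on I)" using simple_functionD(2)[OF g(1)[of n], of "{h}"] by simp
      then show ?thesis by (simp add: sets_restrict_space_iff)
    qed
    note Nc [measurable]
    have "(\<lambda>x. \<Sum>h\<in>g n ` I. indicator (- N) (fst x) * indicator (g n -` {h} \<inter> I) (fst x) *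
        (case x of (s, u) \<Rightarrow> indicator I s * (u s \<bullet> h))) \<in> borel_measurable (lebesgue \<Otimes>\<^sub>M \<rho>)"
      using g(2)[of n] Nc X
      by (intro borel_measurable_sum borel_measurable_times inner_evaluation_measurable[OF I \<rho> _ S]
          measurable_compose[OF measurable_fst] borel_measurable_indicator) auto
    moreover have "(\<Sum>h\<in>g n ` I. indicator (- N) s * indicator (g n -` {h} \<inter> I) s * (indicator I s * (u s \<bullet> h)))
        = indicator I s * (indicator (- N) s * (g n s \<bullet> u s))" for s and u :: "real \<Rightarrow> l2"
    proof (cases "s \<in> I")
      case True
      have "(\<Sum>h\<in>g n ` I. indicator (- N) s * indicator (g n -` {h} \<inter> I) s * (indicator I s * (u s \<bullet> h)))
          = (\<Sum>h\<in>g n ` I. if h = g n s then indicator (- N) s * (u s \<bullet> h) else 0)"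
        using True by (intro sum.cong) (auto simp: indicator_def)
      then show ?thesis using True fin by (simp add: inner_commute)
    qed (auto simp: indicator_def)
    ultimately show ?thesis
      by (auto simp: case_prod_beta' cong: measurable_cong)
  qed
  have "(\<lambda>(s, u). indicator I s * (f0 s \<bullet> u s)) \<in> borel_measurable (lebesgue \<Otimes>\<^sub>M \<rho>)"
  proof (rule borel_measurable_LIMSEQ_real[OF _ gm])
    fix x :: "real \<times> (real \<Rightarrow> l2)"
    obtain s u where x: "x = (s, u)" by force
    have "(\<lambda>n. indicator I s * (indicator (- N) s * (g n s \<bullet> u s))) \<longlonglongrightarrow> indicator I s * (f0 s \<bullet> u s)"
    proof (cases "s \<in> I \<and> s \<notin> N")
      case True
      then have "(\<lambda>n. g n s) \<longlonglongrightarrow> f s" using N(2)[of s] by (simp add: LIM_zero_iff tendsto_norm_zero_iff)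
      then show ?thesis using True by (auto simp: f0_def intro!: tendsto_intros)
    qed (auto simp: f0_def)
    then show "(\<lambda>n. case x of (s, u) \<Rightarrow> indicator I s * (indicator (- N) s * (g n s \<bullet> u s)))
        \<longlonglongrightarrow> (case x of (s, u) \<Rightarrow> indicator I s * (f0 s \<bullet> u s))" by (simp add: x)
  qed
  \<comment> \<open>The bound must also hold where \<open>f0\<close> is 0, and \<open>C\<close>
    comes without a sign.\<close>
  moreover have "norm (f0 s) \<le> max 0 C" for s using N(2)[of s] by (auto simp: f0_def le_max_iff_disj)
  ultimately show ?thesis using that[of N f0 "max 0 C"] N(1) by (auto simp: f0_def)
qed

section \<open>The chain rule for the energy inequality\<close>

lemma energy_function_deriv_nonneg:
  assumes e: "energy_function \<psi> \<psi>'" and r: "0 \<le> r"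
  shows "0 \<le> \<psi>' r"
proof (rule tendsto_lowerbound)
  show "((\<lambda>y. (\<psi> y - \<psi> r) / (y - r)) \<longlongrightarrow> \<psi>' r) (at r within {0..})"
    using e r by (simp add: energy_function_def has_field_derivative_iff)
  have "0 \<le> (\<psi> y - \<psi> r) / (y - r)" if "0 \<le> y" "y \<noteq> r" for y
  proof (cases "y < r")
    case True
    then have "\<psi> y \<le> \<psi> r" using e that by (auto simp: energy_function_def dest!: mono_onD[where r = y and s = r])
    then show ?thesis using True by (simp add: divide_nonpos_neg)
  next
    case False
    then have "\<psi> r \<le> \<psi> y" using e that r by (auto simp: energy_function_def dest!: mono_onD[where r = r and s = y])
    then show ?thesis using False by simp
  qed
  then show "\<forall>\<^sub>F y in at r within {0..}. 0 \<le> (\<psi> y - \<psi> r) / (y - r)"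
    by (auto simp: eventually_at_filter)
  have "at_right r \<le> at r within {0..}" using r by (intro at_le) auto
  then show "at r within {0..} \<noteq> bot" using trivial_limit_at_right_real[of r] by (metis le_bot)
qed

lemma energy_function_deriv_bound:
  assumes "energy_function \<psi> \<psi>'"
  obtains M where "0 \<le> M" "\<And>r. 0 \<le> r \<Longrightarrow> \<psi>' r \<le> M"
proof -
  obtain M where "\<And>r. 0 \<le> r \<Longrightarrow> norm (\<psi>' r) \<le> M"
    using assms by (auto simp: energy_function_def bounded_iff)
  then show ?thesis using that[of "max 0 M"] by (auto simp: abs_le_iff le_max_iff_disj)
qed

lemma energy_function_mean_value:
  assumes e: "energy_function \<psi> \<psi>'" and xy: "0 \<le> x" "0 \<le> y"
  obtains \<xi> where "\<xi> \<in> closed_segment x y" "\<psi> y - \<psi> x = \<psi>' \<xi> * (y - x)"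
proof -
  have *: "\<exists>\<xi>. x \<le> \<xi> \<and> \<xi> \<le> y \<and> \<psi> y - \<psi> x = \<psi>' \<xi> * (y - x)" if "x < y" "0 \<le> x" for x y
  proof -
    have "continuous_on {0..} \<psi>"
      using e by (intro DERIV_continuous_on[of _ _ \<psi>']) (auto simp: energy_function_def)
    then have "continuous_on {x..y} \<psi>" by (rule continuous_on_subset) (use that in auto)
    moreover have "(\<psi> has_real_derivative \<psi>' z) (at z)" if "x < z" "z < y" for z
    proof -
      have "at z within {0..} = at z" using that \<open>0 \<le> x\<close> by (intro at_within_interior) (simp add: interior_real_atLeast)
      moreover have "(\<psi> has_real_derivative \<psi>' z) (at z within {0..})"
        using e that \<open>0 \<le> x\<close> by (simp add: energy_function_def)
      ultimately show ?thesis by simp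
    qed
    ultimately obtain l z where z: "x < z" "z < y" "(\<psi> has_real_derivative l) (at z)" "\<psi> y - \<psi> x = (y - x) * l"
      and d: "\<And>z. x < z \<Longrightarrow> z < y \<Longrightarrow> (\<psi> has_real_derivative \<psi>' z) (at z)"
      using MVT[OF \<open>x < y\<close>, of \<psi>] by (metis real_differentiable_def)
    then have "l = \<psi>' z" using DERIV_unique by blast
    then show ?thesis using z by (auto intro!: exI[of _ z])
  qed
  consider "x < y" | "y < x" | "x = y" by linarith
  then show ?thesis
  proof cases
    case 1 then show ?thesis using *[OF 1 xy(1)] that by (auto simp: closed_segment_eq_real_ivl)
  next
    case 2
    then obtain \<xi> where "y \<le> \<xi>" "\<xi> \<le> x" "\<psi> x - \<psi> y = \<psi>' \<xi> * (x - y)" using *[OF 2 xy(2)] by auto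
    then show ?thesis using 2 that[of \<xi>] by (auto simp: closed_segment_eq_real_ivl algebra_simps)
  next
    case 3 then show ?thesis using that[of x] by auto
  qed
qed

text \<open>Beyond the distance \<open>d\<close> of uniform continuity, the oscillation of
  \<open>\<psi>'\<close> is at most its bound \<open>M\<close>, hence at most
  \<open>M / d * \<bar>x - y\<bar>\<close>. The linear term is there because the energy may jump:
  its values on a short time interval need not be close, but their differences can be
  summed.\<close>

lemma energy_function_deriv_modulus:
  assumes e: "energy_function \<psi> \<psi>'" and "0 < \<epsilon>"
  obtains K where "0 \<le> K" "\<And>x y. x \<in> {0..R} \<Longrightarrow> y \<in> {0..R} \<Longrightarrow> \<bar>\<psi>' x - \<psi>' y\<bar> \<le> \<epsilon> + K * \<bar>x - y\<bar>"
proof -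
  obtain M where M: "0 \<le> M" "\<And>r. 0 \<le> r \<Longrightarrow> \<psi>' r \<le> M" using energy_function_deriv_bound[OF e] by metis
  have "continuous_on {0..} \<psi>'" using e by (simp add: energy_function_def)
  then have "continuous_on {0..R} \<psi>'" by (rule continuous_on_subset) auto
  then have "uniformly_continuous_on {0..R} \<psi>'" by (rule compact_uniformly_continuous) simp
  then obtain d where d: "0 < d" "\<And>x y. x \<in> {0..R} \<Longrightarrow> y \<in> {0..R} \<Longrightarrow> dist y x < d \<Longrightarrow> dist (\<psi>' y) (\<psi>' x) < \<epsilon>"
    unfolding uniformly_continuous_on_def using \<open>0 < \<epsilon>\<close> by metis
  have "\<bar>\<psi>' x - \<psi>' y\<bar> \<le> \<epsilon> + M / d * \<bar>x - y\<bar>" if "x \<in> {0..R}" "y \<in> {0..R}" for x y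
  proof (cases "\<bar>x - y\<bar> < d")
    case True
    then have "\<bar>\<psi>' x - \<psi>' y\<bar> < \<epsilon>" using d(2)[OF that(2,1)] by (simp add: dist_real_def)
    moreover have "0 \<le> M / d * \<bar>x - y\<bar>" using M d by simp
    ultimately show ?thesis by linarith
  next
    case False
    then have "M / d * d \<le> M / d * \<bar>x - y\<bar>" using M d by (intro mult_left_mono) auto
    moreover have "\<bar>\<psi>' x - \<psi>' y\<bar> \<le> M"
      using M(2)[of x] M(2)[of y] energy_function_deriv_nonneg[OF e, of x] energy_function_deriv_nonneg[OF e, of y] that by auto
    ultimately show ?thesis using d(1) \<open>0 < \<epsilon>\<close> by simp
  qed
  then show ?thesis using that[of "M / d"] M d by auto
qed

lemma set_integral_combine:
  fixes g :: "real \<Rightarrow> real"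
  assumes g: "set_integrable lebesgue {a..b} g" and c: "a \<le> c" "c \<le> b"
  shows "(LINT s:{a..b}|lebesgue. g s) = (LINT s:{a..c}|lebesgue. g s) + (LINT s:{c..b}|lebesgue. g s)"
proof -
  have "set_integrable lebesgue {a..c} g" "set_integrable lebesgue {c..b} g"
    using c by (auto intro: set_integrable_subset[OF g])
  then show ?thesis
    using g c by (simp add: set_lebesgue_integral_eq_integral Henstock_Kurzweil_Integration.integral_combine)
qed

text \<open>The error is quadratic in the variation \<open>V\<close> of the absolutely continuous part and the decrease
  \<open>\<mu> = e s + \<Phi> - e t\<close> of the monotone part, up to \<open>2 * \<epsilon> * V\<close>. Since \<open>V\<close> and \<open>\<mu>\<close> are additive in the interval, the errors
  over many short intervals add up to something small.\<close>

lemma chain_rule_local: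
  fixes \<phi> e :: "real \<Rightarrow> real" and s t :: real
  assumes psi: "energy_function \<psi> \<psi>'"
    and st: "s \<le> t" and \<phi>: "set_integrable lebesgue {s..t} \<phi>"
    and pint: "set_integrable lebesgue {s..t} (\<lambda>r. \<psi>' (e r) * \<phi> r)"
    and e0: "\<And>r. r \<in> {s..t} \<Longrightarrow> 0 \<le> e r"
    and N: "N \<in> null_sets lebesgue" "s \<notin> N"
    and ineq: "\<And>r r'. r \<in> {s..t} - N \<Longrightarrow> r' \<in> {r..t} \<Longrightarrow> e r' \<le> e r + (LINT r:{r..r'}|lebesgue. \<phi> r)"
    and R: "e s + (LINT r:{s..t}|lebesgue. \<bar>\<phi> r\<bar>) \<le> R"
    and K: "0 \<le> K" "0 < \<epsilon>" "\<And>x y. x \<in> {0..R} \<Longrightarrow> y \<in> {0..R} \<Longrightarrow> \<bar>\<psi>' x - \<psi>' y\<bar> \<le> \<epsilon> + K * \<bar>x - y\<bar>"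
  defines "V \<equiv> LINT r:{s..t}|lebesgue. \<bar>\<phi> r\<bar>" and "\<Phi> \<equiv> LINT r:{s..t}|lebesgue. \<phi> r"
  shows "\<psi> (e t) - \<psi> (e s) - (LINT r:{s..t}|lebesgue. \<psi>' (e r) * \<phi> r)
    \<le> 2 * \<epsilon> * V + K * V * (3 * V + (e s + \<Phi> - e t))"
proof -
  have abs\<phi>: "set_integrable lebesgue {s..t} (\<lambda>r. \<bar>\<phi> r\<bar>)" by (rule set_integrable_abs[OF \<phi>])
  have sub: "\<bar>LINT x:{r..r'}|lebesgue. \<phi> x\<bar> \<le> V" if "s \<le> r" "r' \<le> t" for r r'
  proof -
    have i: "set_integrable lebesgue {r..r'} \<phi>" using that by (intro set_integrable_subset[OF \<phi>]) auto
    have "\<bar>LINT x:{r..r'}|lebesgue. \<phi> x\<bar> \<le> (LINT x:{r..r'}|lebesgue. \<bar>\<phi> x\<bar>)"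
      using set_integral_norm_bound[OF i] by simp
    also have "\<dots> \<le> V"
      unfolding V_def set_lebesgue_integral_def
    proof (rule integral_mono)
      show "integrable lebesgue (\<lambda>x. indicator {r..r'} x *\<^sub>R \<bar>\<phi> x\<bar>)"
        using set_integrable_abs[OF i] by (simp add: set_integrable_def)
      show "integrable lebesgue (\<lambda>x. indicator {s..t} x *\<^sub>R \<bar>\<phi> x\<bar>)"
        using abs\<phi> by (simp add: set_integrable_def)
      show "indicator {r..r'} x *\<^sub>R \<bar>\<phi> x\<bar> \<le> indicator {s..t} x *\<^sub>R \<bar>\<phi> x\<bar>" for x
        using that by (auto simp: indicator_def)
    qed
    finally show ?thesis .
  qed
  have \<Phi>V: "\<bar>\<Phi>\<bar> \<le> V" unfolding \<Phi>_def using sub[of s t] by simp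
  have V0: "0 \<le> V" using \<Phi>V by linarith
  define \<mu> where "\<mu> = e s + \<Phi> - e t"
  have tt: "e t \<le> e s + \<Phi>" using ineq[of s t] N st by (auto simp: \<Phi>_def)
  then have \<mu>0: "0 \<le> \<mu>" by (simp add: \<mu>_def)
  have es: "0 \<le> e s" "0 \<le> e t" using e0 st by auto
  \<comment> \<open>Monotonicity of \<open>\<psi>\<close> discards downward jumps:
    \<open>e t\<close> is replaced by the larger \<open>e s + \<Phi>\<close>, which differs from
    \<open>e s\<close> by at most \<open>V\<close>.\<close>
  have A: "\<psi> (e t) - \<psi> (e s) \<le> \<psi>' (e s) * \<Phi> + (\<epsilon> + K * V) * V"
  proof -
    have "0 \<le> e s + \<Phi>" using tt es by linarith
    then obtain \<xi> where \<xi>: "\<xi> \<in> closed_segment (e s) (e s + \<Phi>)" "\<psi> (e s + \<Phi>) - \<psi> (e s) = \<psi>' \<xi> * \<Phi>"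
      using energy_function_mean_value[OF psi es(1), of "e s + \<Phi>"] by auto
    have \<xi>s: "\<bar>\<xi> - e s\<bar> \<le> \<bar>\<Phi>\<bar>" "0 \<le> \<xi>"
      using \<xi>(1) es(1) \<open>0 \<le> e s + \<Phi>\<close> by (auto simp: closed_segment_eq_real_ivl split: if_splits)
    have "\<psi> (e t) \<le> \<psi> (e s + \<Phi>)"
      using psi tt es \<open>0 \<le> e s + \<Phi>\<close> by (auto simp: energy_function_def dest!: mono_onD[where r = "e t" and s = "e s + \<Phi>"])
    then have "\<psi> (e t) - \<psi> (e s) \<le> \<psi>' (e s) * \<Phi> + (\<psi>' \<xi> - \<psi>' (e s)) * \<Phi>"
      using \<xi>(2) by (simp add: algebra_simps)
    also have "(\<psi>' \<xi> - \<psi>' (e s)) * \<Phi> \<le> \<bar>\<psi>' \<xi> - \<psi>' (e s)\<bar> * \<bar>\<Phi>\<bar>"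
      by (metis abs_ge_self abs_mult)
    also have "\<dots> \<le> (\<epsilon> + K * V) * V"
    proof (intro mult_mono)
      have "\<bar>\<psi>' \<xi> - \<psi>' (e s)\<bar> \<le> \<epsilon> + K * \<bar>\<xi> - e s\<bar>"
        using \<xi>s R \<Phi>V es V0 by (intro K(3)) (auto simp: V_def)
      also have "\<dots> \<le> \<epsilon> + K * V" using \<xi>s \<Phi>V K(1) by (intro add_left_mono mult_left_mono) auto
      finally show "\<bar>\<psi>' \<xi> - \<psi>' (e s)\<bar> \<le> \<epsilon> + K * V" .
    qed (use \<Phi>V K V0 in auto)
    finally show ?thesis by simp
  qed
  \<comment> \<open>Freezing the derivative at \<open>e s\<close> costs its oscillation along the
    interval. The decrease \<open>\<mu>\<close> enters here, since \<open>e\<close> may have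
    jumped.\<close>
  have B: "\<psi>' (e s) * \<Phi> - (LINT r:{s..t}|lebesgue. \<psi>' (e r) * \<phi> r) \<le> (\<epsilon> + K * (2 * V + \<mu>)) * V"
  proof -
    have "\<psi>' (e s) * \<Phi> - (LINT r:{s..t}|lebesgue. \<psi>' (e r) * \<phi> r)
        = (LINT r:{s..t}|lebesgue. \<psi>' (e s) * \<phi> r - \<psi>' (e r) * \<phi> r)"
      unfolding \<Phi>_def using \<phi> pint by (subst set_integral_diff) auto
    also have "\<dots> \<le> (LINT r:{s..t}|lebesgue. (\<epsilon> + K * (2 * V + \<mu>)) * \<bar>\<phi> r\<bar>)"
    proof (rule set_integral_mono_AE)
      show "set_integrable lebesgue {s..t} (\<lambda>r. \<psi>' (e s) * \<phi> r - \<psi>' (e r) * \<phi> r)"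
        using \<phi> pint by (intro set_integral_diff) auto
      show "set_integrable lebesgue {s..t} (\<lambda>r. (\<epsilon> + K * (2 * V + \<mu>)) * \<bar>\<phi> r\<bar>)"
        using abs\<phi> by simp
      show "AE r\<in>{s..t} in lebesgue. \<psi>' (e s) * \<phi> r - \<psi>' (e r) * \<phi> r \<le> (\<epsilon> + K * (2 * V + \<mu>)) * \<bar>\<phi> r\<bar>"
      proof (rule AE_mp[OF AE_not_in[OF N(1)]], intro AE_I2 impI)
        fix r assume r: "r \<notin> N" "r \<in> {s..t}"
        \<comment> \<open>Started at \<open>s\<close>, the inequality bounds \<open>e r\<close> from
          above; started at \<open>r\<close> and ended at \<open>t\<close>, it bounds
          \<open>e r\<close> from below. The second use is available for \<open>r\<close> outside
          \<open>N\<close>, that is, for almost every \<open>r\<close>.\<close>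
        have "e r \<le> e s + V" using ineq[of s r] sub[of s r] N r by auto
        moreover have "e t \<le> e r + V" using ineq[of r t] sub[of r t] r by auto
        ultimately have d: "\<bar>e s - e r\<bar> \<le> 2 * V + \<mu>" using \<Phi>V V0 \<mu>0 by (auto simp: \<mu>_def abs_le_iff)
        have "\<bar>\<psi>' (e s) - \<psi>' (e r)\<bar> \<le> \<epsilon> + K * \<bar>e s - e r\<bar>"
          using \<open>e r \<le> e s + V\<close> e0[OF r(2)] es R V0 by (intro K(3)) (auto simp: V_def)
        also have "\<dots> \<le> \<epsilon> + K * (2 * V + \<mu>)" using d K(1) by (intro add_left_mono mult_left_mono) auto
        finally have "\<bar>\<psi>' (e s) - \<psi>' (e r)\<bar> * \<bar>\<phi> r\<bar> \<le> (\<epsilon> + K * (2 * V + \<mu>)) * \<bar>\<phi> r\<bar>"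
          by (rule mult_right_mono) simp
        moreover have "\<psi>' (e s) * \<phi> r - \<psi>' (e r) * \<phi> r \<le> \<bar>\<psi>' (e s) - \<psi>' (e r)\<bar> * \<bar>\<phi> r\<bar>"
          by (metis abs_ge_self abs_mult left_diff_distrib)
        ultimately show "\<psi>' (e s) * \<phi> r - \<psi>' (e r) * \<phi> r \<le> (\<epsilon> + K * (2 * V + \<mu>)) * \<bar>\<phi> r\<bar>" by linarith
      qed
    qed
    also have "\<dots> = (\<epsilon> + K * (2 * V + \<mu>)) * V" by (simp add: V_def)
    finally show ?thesis .
  qed
  have "(\<epsilon> + K * V) * V + (\<epsilon> + K * (2 * V + \<mu>)) * V = 2 * \<epsilon> * V + K * V * (3 * V + \<mu>)"
    by (simp add: algebra_simps)
  then show ?thesis using A B unfolding \<mu>_def by linarith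
qed

section \<open>From short intervals to the whole interval\<close>

lemma nonnull_open_interval:
  fixes a b :: real
  assumes "a < b" "N \<in> null_sets lebesgue"
  obtains c where "a < c" "c < b" "c \<notin> N"
proof -
  have "\<not> negligible {a<..<b}" using assms(1) open_not_negligible[of "{a<..<b}"] by auto
  then have "\<not> {a<..<b} \<subseteq> N" using assms(2) negligible_subset by (auto simp: negligible_iff_null_sets)
  then obtain c where "c \<in> {a<..<b}" "c \<notin> N" by blast
  then show ?thesis using that by auto
qed

text \<open>Short intervals make \<open>V\<close> at most \<open>\<eta>\<close>, but not
  \<open>\<mu>\<close>, which contains the jumps. One factor \<open>V\<close> of the local error is
  therefore replaced by \<open>\<eta>\<close>; the remaining bound
  \<open>2 * \<epsilon> * V + K * \<eta> * (3 * V + \<mu>)\<close> is additive over adjacent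
  intervals, and its totals over \<open>{a..b}\<close> are fixed numbers.\<close>

lemma energy_chain_rule:
  fixes \<phi> e :: "real \<Rightarrow> real" and a b :: real
  assumes psi: "energy_function \<psi> \<psi>'"
    and ab: "a \<le> b" and \<phi>: "set_integrable lebesgue {a..b} \<phi>"
    and pint: "set_integrable lebesgue {a..b} (\<lambda>r. \<psi>' (e r) * \<phi> r)"
    and e0: "\<And>r. r \<in> {a..b} \<Longrightarrow> 0 \<le> e r"
    and N: "N \<in> null_sets lebesgue" "a \<notin> N"
    and ineq: "\<And>r r'. r \<in> {a..b} - N \<Longrightarrow> r' \<in> {r..b} \<Longrightarrow> e r' \<le> e r + (LINT r:{r..r'}|lebesgue. \<phi> r)"
  shows "\<psi> (e b) \<le> \<psi> (e a) + (LINT r:{a..b}|lebesgue. \<psi>' (e r) * \<phi> r)"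
proof -
  define V where "V s t = (LINT r:{s..t}|lebesgue. \<bar>\<phi> r\<bar>)" for s t
  define \<Phi> where "\<Phi> s t = (LINT r:{s..t}|lebesgue. \<phi> r)" for s t
  define P where "P s t = (LINT r:{s..t}|lebesgue. \<psi>' (e r) * \<phi> r)" for s t
  define D where "D s t = \<psi> (e t) - \<psi> (e s) - P s t" for s t
  define \<mu> where "\<mu> s t = e s + \<Phi> s t - e t" for s t
  have abs\<phi>: "set_integrable lebesgue {a..b} (\<lambda>r. \<bar>\<phi> r\<bar>)" by (rule set_integrable_abs[OF \<phi>])
  note subint = set_integrable_subset[OF \<phi>] set_integrable_subset[OF abs\<phi>] set_integrable_subset[OF pint]
  have add: "V s t = V s c + V c t" "\<Phi> s t = \<Phi> s c + \<Phi> c t" "P s t = P s c + P c t"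
    if "a \<le> s" "s \<le> c" "c \<le> t" "t \<le> b" for s c t
  proof -
    have "{s..t} \<subseteq> {a..b}" using that by auto
    then have "set_integrable lebesgue {s..t} (\<lambda>r. \<bar>\<phi> r\<bar>)" "set_integrable lebesgue {s..t} \<phi>"
      "set_integrable lebesgue {s..t} (\<lambda>r. \<psi>' (e r) * \<phi> r)"
      by (auto intro: subint)
    from this[THEN set_integral_combine, OF \<open>s \<le> c\<close> \<open>c \<le> t\<close>]
    show "V s t = V s c + V c t" "\<Phi> s t = \<Phi> s c + \<Phi> c t" "P s t = P s c + P c t"
      unfolding V_def \<Phi>_def P_def .
  qed
  have V0: "0 \<le> V s t" for s t
    unfolding V_def set_lebesgue_integral_def by (intro Bochner_Integration.integral_nonneg) auto
  have \<Phi>V: "\<Phi> s t \<le> V s t" if "a \<le> s" "t \<le> b" for s t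
    unfolding V_def \<Phi>_def using that by (intro set_integral_mono subint) auto
  have Vmono: "V s t \<le> V a b" if "a \<le> s" "s \<le> t" "t \<le> b" for s t
    using add(1)[of a s b] add(1)[of s t b] V0[of a s] V0[of t b] that by linarith
  \<comment> \<open>One \<open>V a b\<close> bounds the rise of \<open>e\<close> since time
    \<open>a\<close>, the other the variation on the current subinterval.\<close>
  define R where "R = e a + V a b + V a b"
  have eR: "e s + V s t \<le> R" if "a \<le> s" "s \<le> t" "t \<le> b" for s t
    using ineq[of a s] N that ab \<Phi>V[of a s] Vmono[of a s] Vmono[of s t] by (auto simp: R_def \<Phi>_def)
  have \<mu>0: "0 \<le> \<mu> s t" if "s \<in> {a..b} - N" "t \<in> {s..b}" for s t
    using ineq[OF that] by (simp add: \<mu>_def \<Phi>_def)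
  have main: "D a b \<le> 2 * \<epsilon> * V a b + K * \<eta> * (3 * V a b + \<mu> a b)"
    if K: "0 \<le> K" "0 < \<epsilon>" "\<And>x y. x \<in> {0..R} \<Longrightarrow> y \<in> {0..R} \<Longrightarrow> \<bar>\<psi>' x - \<psi>' y\<bar> \<le> \<epsilon> + K * \<bar>x - y\<bar>"
      and \<eta>: "0 < \<eta>" for K \<epsilon> \<eta>
  proof -
    have "uniformly_continuous_on {a..b} (\<lambda>t. V a t)"
    proof (rule compact_uniformly_continuous)
      have "(\<lambda>r. \<bar>\<phi> r\<bar>) integrable_on {a..b}" using abs\<phi> by (rule set_lebesgue_integral_eq_integral(1))
      then have "continuous_on {a..b} (\<lambda>t. integral {a..t} (\<lambda>r. \<bar>\<phi> r\<bar>))"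
        by (rule indefinite_integral_continuous_1)
      then show "continuous_on {a..b} (\<lambda>t. V a t)"
      proof (rule continuous_on_eq)
        fix t assume "t \<in> {a..b}"
        then show "integral {a..t} (\<lambda>r. \<bar>\<phi> r\<bar>) = V a t"
          unfolding V_def by (intro set_lebesgue_integral_eq_integral(2)[symmetric] subint) auto
      qed
    qed simp
    then obtain d where d: "0 < d" "\<And>x y. x \<in> {a..b} \<Longrightarrow> y \<in> {a..b} \<Longrightarrow> dist y x < d \<Longrightarrow> dist (V a y) (V a x) < \<eta>"
      unfolding uniformly_continuous_on_def using \<eta> by metis
    have small: "V s t \<le> \<eta>" if "a \<le> s" "s \<le> t" "t \<le> b" "t < s + d" for s t
      using d(2)[of s t] add(1)[of a s t] that by (auto simp: dist_real_def)
    have local: "D s t \<le> 2 * \<epsilon> * V s t + K * \<eta> * (3 * V s t + \<mu> s t)"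
      if "s \<in> {a..b} - N" "s \<le> t" "t \<le> b" "t < s + d" for s t
    proof -
      have "D s t \<le> 2 * \<epsilon> * V s t + K * V s t * (3 * V s t + \<mu> s t)"
        unfolding D_def P_def V_def \<mu>_def \<Phi>_def
      proof (rule chain_rule_local[OF psi _ _ _ _ N(1) _ _ _ K])
        show "e s + (LINT r:{s..t}|lebesgue. \<bar>\<phi> r\<bar>) \<le> R" using eR[of s t] that by (simp add: V_def)
      qed (use that in \<open>auto intro!: e0 ineq subint\<close>)
      also have "K * V s t * (3 * V s t + \<mu> s t) \<le> K * \<eta> * (3 * V s t + \<mu> s t)"
        using small[of s t] \<mu>0[of s t] V0[of s t] K(1) that by (intro mult_right_mono mult_left_mono) auto
      finally show ?thesis by simp
    qed
    \<comment> \<open>Induction with the right end \<open>b\<close> fixed. \<open>n\<close> counts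
      half steps, because the next point must avoid \<open>N\<close> and is therefore chosen in the
      window between \<open>s + d / 2\<close> and \<open>s + d\<close>.\<close>
    have "D s b \<le> 2 * \<epsilon> * V s b + K * \<eta> * (3 * V s b + \<mu> s b)"
      if "s \<in> {a..b} - N" "b - s \<le> real n * (d / 2)" for n s
      using that
    proof (induction n arbitrary: s)
      case 0
      then show ?case using local[of s b] d(1) by auto
    next
      case (Suc n)
      show ?case
      proof (cases "b < s + d")
        case True
        then show ?thesis using local[of s b] Suc.prems by auto
      next
        case False
        obtain c where c: "s + d / 2 < c" "c < s + d" "c \<notin> N"
          using nonnull_open_interval[OF _ N(1), of "s + d/2" "s + d"] d(1) by auto
        have cb: "s \<le> c" "c \<le> b" "a \<le> s" using c False d(1) Suc.prems by auto
        have "D c b \<le> 2 * \<epsilon> * V c b + K * \<eta> * (3 * V c b + \<mu> c b)"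
          using c cb Suc.prems(2) by (intro Suc.IH) (auto simp: algebra_simps)
        moreover have "D s c \<le> 2 * \<epsilon> * V s c + K * \<eta> * (3 * V s c + \<mu> s c)"
          using c cb Suc.prems by (intro local) auto
        moreover have "D s b = D s c + D c b" "V s b = V s c + V c b" "\<mu> s b = \<mu> s c + \<mu> c b"
          using add[of s c b] cb by (auto simp: D_def \<mu>_def)
        ultimately show ?thesis by (simp add: algebra_simps)
      qed
    qed
    moreover obtain n where "b - a < real n * (d / 2)"
      using ex_less_of_nat_mult[of "d/2" "b - a"] d(1) by auto
    then have "b - a \<le> real n * (d / 2)" by simp
    ultimately show ?thesis using N ab by auto
  qed
  have "D a b \<le> 0"
  proof (rule field_le_epsilon)
    fix x :: real assume x: "0 < x"
    have half: "2 * (x / (4 * W)) * W = x / 2" and half': "x / (2 * W) * W = x / 2" if "0 < W" for W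
      using that by simp_all
    \<comment> \<open>\<open>\<epsilon>\<close> is fixed before \<open>\<eta>\<close>:
      \<open>K\<close> depends on \<open>\<epsilon>\<close>, and \<open>\<eta>\<close> has to absorb
      it. Each of the two errors gets \<open>x / 2\<close>, and the summands 1 keep the denominators
      positive.\<close>
    define \<epsilon> where "\<epsilon> = x / (4 * (V a b + 1))"
    have \<epsilon>: "0 < \<epsilon>" using x V0[of a b] by (simp add: \<epsilon>_def)
    obtain K where K: "0 \<le> K" "\<And>x y. x \<in> {0..R} \<Longrightarrow> y \<in> {0..R} \<Longrightarrow> \<bar>\<psi>' x - \<psi>' y\<bar> \<le> \<epsilon> + K * \<bar>x - y\<bar>"
      using energy_function_deriv_modulus[OF psi \<epsilon>] by metis
    define Q where "Q = K * (3 * V a b + \<mu> a b)"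
    have Q: "0 \<le> Q" using K(1) V0[of a b] \<mu>0[of a b] ab N by (simp add: Q_def)
    define \<eta> where "\<eta> = x / (2 * (Q + 1))"
    have \<eta>: "0 < \<eta>" using x Q by (simp add: \<eta>_def)
    have "D a b \<le> 2 * \<epsilon> * V a b + \<eta> * Q"
      using main[OF K(1) \<epsilon> K(2) \<eta>] by (simp add: Q_def mult_ac)
    also have "2 * \<epsilon> * V a b \<le> 2 * \<epsilon> * (V a b + 1)" using \<epsilon> by (intro mult_left_mono) auto
    also have "\<dots> = x / 2" unfolding \<epsilon>_def using half[of "V a b + 1"] V0[of a b] by simp
    also have "\<eta> * Q \<le> \<eta> * (Q + 1)" using \<eta> by (intro mult_left_mono) auto
    also have "\<dots> = x / 2" unfolding \<eta>_def using half'[of "Q + 1"] Q by simp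
    finally show "D a b \<le> 0 + x" by simp
  qed
  then show ?thesis by (simp add: D_def P_def)
qed

section \<open>Almost every time is good for almost every trajectory\<close>

lemma sigma_finite_lebesgue: "sigma_finite_measure (lebesgue :: real measure)"
proof
  show "\<exists>A. countable A \<and> A \<subseteq> sets (lebesgue :: real measure) \<and> \<Union>A = space lebesgue \<and> (\<forall>a\<in>A. emeasure lebesgue a \<noteq> \<infinity>)"
  proof (intro exI conjI ballI)
    show "countable (range (\<lambda>n::nat. {- real n..real n}))" by simp
    show "\<Union> (range (\<lambda>n::nat. {- real n..real n})) = space (lebesgue :: real measure)"
    proof -
      have "\<exists>n. x \<in> {- real n..real n}" for x
        using real_arch_simple[of "\<bar>x\<bar>"] by (simp add: abs_le_iff minus_le_iff conj_commute)
      then show ?thesis by auto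
    qed
  qed auto
qed

text \<open>Projections of the product are measurable into \<open>lebesgue\<close>, whereas
  comparing times uses the Borel sets.\<close>

lemma measurable_lebesgue_imp_borel [measurable (raw)]:
  fixes h :: "'a \<Rightarrow> real"
  assumes "h \<in> M \<rightarrow>\<^sub>M lebesgue"
  shows "h \<in> borel_measurable M"
  using measurable_compose[OF assms id_borel_measurable_lebesgue] by simp

lemma H1_norm_square: "(H1_norm S u)\<^sup>2 = (\<Sum>i\<in>UNIV. (norm (weak_partial S i u))\<^sup>2)"
  unfolding H1_norm_def H1_inner_def
  by (simp add: power2_norm_eq_inner sum_nonneg)

lemma H1_norm_nonneg: "0 \<le> H1_norm S u"
  unfolding H1_norm_def H1_inner_def by (simp add: sum_nonneg)

text \<open>This rests on completeness of \<open>lebesgue\<close>. It serves for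
  \<open>H1_norm S (u s)\<close>, whose square is compared with a measurable function of
  \<open>s\<close> only almost everywhere.\<close>

lemma borel_measurable_lebesgue_cong_AE:
  fixes h h' :: "'a::euclidean_space \<Rightarrow> 'b::topological_space"
  assumes ae: "AE x in lebesgue. h x = h' x" and h': "h' \<in> borel_measurable lebesgue"
  shows "h \<in> borel_measurable lebesgue"
proof (rule measurableI)
  fix X :: "'b set" assume "X \<in> sets borel"
  then have "h' -` X \<inter> space lebesgue \<in> sets lebesgue" by (rule measurable_sets[OF h'])
  then show "h -` X \<inter> space lebesgue \<in> sets lebesgue"
    by (rule completion.in_sets_AE[rotated]) (use ae in \<open>auto elim!: eventually_mono\<close>)
qed simp

lemma integral_cong_AE_lebesgue:
  fixes h h' :: "'a::euclidean_space \<Rightarrow> 'b::{banach, second_countable_topology}"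
  assumes "AE x in lebesgue. h x = h' x" "h' \<in> borel_measurable lebesgue"
  shows "integral\<^sup>L lebesgue h = integral\<^sup>L lebesgue h'"
  by (rule integral_cong_AE) (use assms borel_measurable_lebesgue_cong_AE[OF assms] in auto)

text \<open>\<open>G\<close> extends the square of \<open>H1_norm\<close>, which is meaningless outside \<open>space_H1\<close>, to a measurable function
  on all of \<open>H\<close>; \<open>f0\<close> is a bounded representative of \<open>f\<close>.\<close>

locale energy_setup =
  fixes S :: setting and \<nu> :: real and f :: "real \<Rightarrow> l2" and I :: "real set"
    and \<rho> :: "(real \<Rightarrow> l2) measure" and f0 :: "real \<Rightarrow> l2" and C :: real and N0 :: "real set"
    and G :: "l2 \<Rightarrow> ennreal"
  assumes nu: "0 < \<nu>" and S: "admissible S" and I: "is_interval I"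
    and vf: "vishik_fursikov_measure S \<nu> f I \<rho>"
    and N0: "N0 \<in> null_sets lebesgue" and f_eq: "\<And>s. s \<in> I \<Longrightarrow> s \<notin> N0 \<Longrightarrow> f s = f0 s"
    and f0_bound: "\<And>s. norm (f0 s) \<le> C"
    and G: "\<And>u. u \<in> space_H S \<Longrightarrow> u \<in> space_H1 S \<Longrightarrow> G u = ennreal ((H1_norm S u)\<^sup>2)"
    and g_measurable: "(\<lambda>(s, u). indicator I s * G (u s)) \<in> borel_measurable (lebesgue \<Otimes>\<^sub>M \<rho>)"
    and k_measurable: "(\<lambda>(s, u). indicator I s * (f0 s \<bullet> u s)) \<in> borel_measurable (lebesgue \<Otimes>\<^sub>M \<rho>)"
    and E_measurable: "(\<lambda>(s, u). indicator I s * (norm (u s))\<^sup>2) \<in> borel_measurable (lebesgue \<Otimes>\<^sub>M \<rho>)"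
begin

text \<open>Extension by 0 off \<open>I\<close> turns evaluation into functions on the whole
  product, to which Fubini's theorem applies. \<open>g\<close> stays in \<open>ennreal\<close>,
  since nothing bounds \<open>G\<close> outside \<open>space_H1\<close>.\<close>

definition E :: "real \<Rightarrow> (real \<Rightarrow> l2) \<Rightarrow> real" where "E s u = indicator I s * (norm (u s))\<^sup>2"
definition k :: "real \<Rightarrow> (real \<Rightarrow> l2) \<Rightarrow> real" where "k s u = indicator I s * (f0 s \<bullet> u s)"
definition g :: "real \<Rightarrow> (real \<Rightarrow> l2) \<Rightarrow> ennreal" where "g s u = indicator I s * G (u s)"

lemma E_measurable' [measurable (raw)]:
  assumes "p \<in> M \<rightarrow>\<^sub>M lebesgue" "q \<in> M \<rightarrow>\<^sub>M \<rho>"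
  shows "(\<lambda>x. E (p x) (q x)) \<in> borel_measurable M"
  using measurable_compose[OF measurable_Pair[OF assms] E_measurable] by (simp add: E_def)

lemma k_measurable' [measurable (raw)]:
  assumes "p \<in> M \<rightarrow>\<^sub>M lebesgue" "q \<in> M \<rightarrow>\<^sub>M \<rho>"
  shows "(\<lambda>x. k (p x) (q x)) \<in> borel_measurable M"
  using measurable_compose[OF measurable_Pair[OF assms] k_measurable] by (simp add: k_def)

lemma g_measurable' [measurable (raw)]:
  assumes "p \<in> M \<rightarrow>\<^sub>M lebesgue" "q \<in> M \<rightarrow>\<^sub>M \<rho>"
  shows "(\<lambda>x. g (p x) (q x)) \<in> borel_measurable M"
  using measurable_compose[OF measurable_Pair[OF assms] g_measurable] by (simp add: g_def)

lemma E_nonneg [simp]: "0 \<le> E s u" by (simp add: E_def)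

lemma E_eq: "s \<in> I \<Longrightarrow> E s u = (norm (u s))\<^sup>2" by (simp add: E_def)
lemma k_eq: "s \<in> I \<Longrightarrow> k s u = f0 s \<bullet> u s" by (simp add: k_def)

lemma borel_prob: "borel_prob_measure (C_loc_topology S I) \<rho>"
  using vf by (simp add: vishik_fursikov_measure_def)

sublocale prob_space \<rho> using borel_prob by (simp add: borel_prob_measure_def)
sublocale lebesgue: sigma_finite_measure "lebesgue :: real measure" by (rule sigma_finite_lebesgue)
sublocale P: pair_sigma_finite "lebesgue :: real measure" \<rho> ..
sublocale P': pair_sigma_finite \<rho> "lebesgue :: real measure" ..

abbreviation "U \<equiv> U_sharp S \<nu> f I"

lemma U_sets [measurable]: "U \<in> sets \<rho>"
  using vf by (simp add: vishik_fursikov_measure_def carried_by_def)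

lemma AE_U: "AE u in \<rho>. u \<in> U"
  using vf by (intro AE_I[of _ _ "space \<rho> - U"]) (auto simp: vishik_fursikov_measure_def carried_by_def)

lemma U_space: "u \<in> U \<Longrightarrow> u \<in> space \<rho>" using sets.sets_into_space[OF U_sets] by auto
lemma U_C_loc: "u \<in> U \<Longrightarrow> u \<in> C_loc_weak S I" by (simp add: U_sharp_def)

lemma nn_integral_U: "(\<integral>\<^sup>+u\<in>U. h u \<partial>\<rho>) = (\<integral>\<^sup>+u. h u \<partial>\<rho>)"
  using AE_U by (intro nn_integral_cong_AE) (auto elim!: eventually_mono)

lemma nn_integral_U_energy:
  assumes "t \<in> I"
  shows "(\<integral>\<^sup>+u\<in>U. ennreal (\<psi> ((norm (u t))\<^sup>2)) \<partial>\<rho>) = (\<integral>\<^sup>+u. ennreal (\<psi> (E t u)) \<partial>\<rho>)"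
  using assms by (simp add: nn_integral_U E_eq)

lemma interval_subset: "a \<in> I \<Longrightarrow> b \<in> I \<Longrightarrow> {a..b} \<subseteq> I"
  using I unfolding is_interval_1 by (meson atLeastAtMost_iff subsetI)

lemma interior_interval_subset: "a \<in> interior I \<Longrightarrow> b \<in> interior I \<Longrightarrow> {a..b} \<subseteq> interior I"
proof -
  have "is_interval (interior I)" using I by (simp add: is_interval_convex_1 convex_interior)
  then show "a \<in> interior I \<Longrightarrow> b \<in> interior I \<Longrightarrow> {a..b} \<subseteq> interior I"
    unfolding is_interval_1 by (meson atLeastAtMost_iff subsetI)
qed

lemma null_interior: "I - interior I \<in> null_sets lebesgue"
  using finite_interval_minus_interior[OF I] by (simp add: negligible_finite flip: negligible_iff_null_sets)

section \<open>Moments of the energy and dissipation along one trajectory\<close>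

lemma moment_finite:
  assumes ab: "{a..b} \<subseteq> I"
  shows "(\<integral>\<^sup>+u. (\<integral>\<^sup>+s. indicator {a..b} s * ennreal (E s u) \<partial>lebesgue) \<partial>\<rho>) < \<infinity>"
proof -
  obtain c where c: "AE t in lebesgue_on {a..b}. (\<integral>\<^sup>+u\<in>U. ennreal ((norm (u t))\<^sup>2) \<partial>\<rho>) \<le> ennreal c"
    using vf ab unfolding vishik_fursikov_measure_def by blast
  have "(\<integral>\<^sup>+u. (\<integral>\<^sup>+s. indicator {a..b} s * ennreal (E s u) \<partial>lebesgue) \<partial>\<rho>)
      = (\<integral>\<^sup>+s. (\<integral>\<^sup>+u. indicator {a..b} s * ennreal (E s u) \<partial>\<rho>) \<partial>lebesgue)"
    by (rule P.Fubini') measurable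
  also have "\<dots> = (\<integral>\<^sup>+s. indicator {a..b} s * (\<integral>\<^sup>+u. ennreal (E s u) \<partial>\<rho>) \<partial>lebesgue)"
    by (intro nn_integral_cong) (simp add: nn_integral_cmult)
  also have "\<dots> \<le> (\<integral>\<^sup>+s. ennreal c * indicator {a..b} s \<partial>lebesgue)"
  proof (rule nn_integral_mono_AE)
    have "AE t in lebesgue. t \<in> {a..b} \<longrightarrow> (\<integral>\<^sup>+u\<in>U. ennreal ((norm (u t))\<^sup>2) \<partial>\<rho>) \<le> ennreal c"
      using c by (subst (asm) AE_restrict_space_iff) auto
    then show "AE s in lebesgue. indicator {a..b} s * (\<integral>\<^sup>+u. ennreal (E s u) \<partial>\<rho>) \<le> ennreal c * indicator {a..b} s"
    proof eventually_elim
      case (elim s)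
      then show ?case using ab nn_integral_U_energy[of s "\<lambda>x. x"] by (auto simp: indicator_def)
    qed
  qed
  also have "\<dots> < \<infinity>"
    by (simp add: nn_integral_cmult_indicator ennreal_mult_less_top emeasure_lborel_Icc_eq)
  finally show ?thesis .
qed

lemma moment_AE_finite:
  assumes ab: "{a..b} \<subseteq> I"
  shows "AE u in \<rho>. (\<integral>\<^sup>+s. indicator {a..b} s * ennreal (E s u) \<partial>lebesgue) < \<infinity>"
proof -
  have "(\<integral>\<^sup>+u. (\<integral>\<^sup>+s. indicator {a..b} s * ennreal (E s u) \<partial>lebesgue) \<partial>\<rho>) \<noteq> \<infinity>"
    using moment_finite[OF ab] by simp
  from nn_integral_noteq_infinite[OF _ this] show ?thesis by (simp add: less_top)
qed

text \<open>Members of \<open>U\<close> are weak solutions on the open interior, so the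
  integrability of the dissipation comes on compact subintervals of the interior and not up to an
  end point of \<open>I\<close>.\<close>

lemma path_H1:
  assumes u: "u \<in> U" and ab: "{a..b} \<subseteq> interior I"
  shows "AE s in lebesgue. s \<in> {a..b} \<longrightarrow> g s u = ennreal ((H1_norm S (u s))\<^sup>2)"
    and "(\<integral>\<^sup>+s. indicator {a..b} s * g s u \<partial>lebesgue) < \<infinity>"
proof -
  have abI: "{a..b} \<subseteq> I" using ab interior_subset by blast
  have L: "u \<in> L_p 2 {a..b} (space_V S) (H1_norm S)"
    using u ab by (auto simp: U_sharp_def weak_solution_def L_p_loc_def)
  then have "AE s in lebesgue_on {a..b}. u s \<in> space_V S"
    by (simp add: L_p_def strongly_measurable_on_def)
  then have "AE s in lebesgue. s \<in> {a..b} \<longrightarrow> u s \<in> space_V S"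
    by (subst (asm) AE_restrict_space_iff) auto
  then show ae: "AE s in lebesgue. s \<in> {a..b} \<longrightarrow> g s u = ennreal ((H1_norm S (u s))\<^sup>2)"
  proof eventually_elim
    case (elim s)
    show ?case
    proof
      assume s: "s \<in> {a..b}"
      then have "u s \<in> space_H1 S" "u s \<in> space_H S" "s \<in> I"
        using elim abI weak_continuous_in_H[OF U_C_loc[OF u]] by (auto simp: space_V_def)
      then show "g s u = ennreal ((H1_norm S (u s))\<^sup>2)" by (simp add: g_def G)
    qed
  qed
  have "(\<integral>\<^sup>+s. indicator {a..b} s * g s u \<partial>lebesgue)
      = (\<integral>\<^sup>+s. ennreal (H1_norm S (u s) powr 2) * indicator {a..b} s \<partial>lebesgue)"
  proof (rule nn_integral_cong_AE, rule AE_mp[OF ae], intro AE_I2 impI)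
    fix s assume "s \<in> {a..b} \<longrightarrow> g s u = ennreal ((H1_norm S (u s))\<^sup>2)"
    moreover have "H1_norm S (u s) powr 2 = (H1_norm S (u s))\<^sup>2"
      using H1_norm_nonneg[of S "u s"] by (cases "H1_norm S (u s) = 0") auto
    ultimately show "indicator {a..b} s * g s u = ennreal (H1_norm S (u s) powr 2) * indicator {a..b} s"
      by (auto simp: indicator_def)
  qed
  also have "\<dots> = (\<integral>\<^sup>+s. ennreal (H1_norm S (u s) powr 2) \<partial>lebesgue_on {a..b})"
    by (subst nn_integral_restrict_space) auto
  also have "\<dots> < \<infinity>" using L by (simp add: L_p_def)
  finally show "(\<integral>\<^sup>+s. indicator {a..b} s * g s u \<partial>lebesgue) < \<infinity>" .
qed

text \<open>Countably many compact intervals exhaust the interior, and what remains of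
  \<open>I\<close> is a null set.\<close>

lemma path_g_eq:
  assumes u: "u \<in> U"
  shows "AE s in lebesgue. s \<in> I \<longrightarrow> g s u = ennreal ((H1_norm S (u s))\<^sup>2)"
proof -
  obtain \<D> where D: "countable \<D>" "\<D> \<subseteq> Pow (interior I)" "\<And>X. X \<in> \<D> \<Longrightarrow> \<exists>a b. X = cbox a b" "\<Union>\<D> = interior I"
    using open_countable_Union_open_cbox[OF open_interior[of I]] by metis
  have "AE s in lebesgue. \<forall>X\<in>\<D>. s \<in> X \<longrightarrow> g s u = ennreal ((H1_norm S (u s))\<^sup>2)"
  proof (rule AE_ball_countable'[OF _ D(1)])
    fix X assume X: "X \<in> \<D>"
    then obtain a b where "X = {a..b}" using D(3)[OF X] by (auto simp: cbox_interval)
    then show "AE s in lebesgue. s \<in> X \<longrightarrow> g s u = ennreal ((H1_norm S (u s))\<^sup>2)"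
      using path_H1(1)[OF u, of a b] X D(2) by auto
  qed
  with AE_not_in[OF null_interior] show ?thesis
    by eventually_elim (use D(4) in blast)
qed

text \<open>Writing the energy inequality with \<open>E\<close>, \<open>k\<close> and
  \<open>g\<close> makes the pairs \<open>(s, u)\<close> that satisfy it a measurable set. A Bochner
  integral that does not exist counts as 0, so the dissipation term has its meaning only where
  integrability is proved, as in \<open>path_energy_extend\<close>.\<close>

definition energy_step :: "(real \<Rightarrow> l2) \<Rightarrow> real \<Rightarrow> real \<Rightarrow> bool" where
  "energy_step u s t \<longleftrightarrow>
    E t u / 2 + \<nu> * (LINT r|lebesgue. indicator {s..t} r * enn2real (g r u))
    \<le> E s u / 2 + (LINT r|lebesgue. indicator {s..t} r * k r u)"

lemma path_energy:
  assumes u: "u \<in> U"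
  shows "AE s in lebesgue. s \<in> interior I \<longrightarrow> (\<forall>t\<in>interior I. s < t \<longrightarrow> energy_step u s t)"
proof -
  have "AE s in lebesgue_on (interior I). \<forall>t\<in>interior I. s < t \<longrightarrow>
        (norm (u t))\<^sup>2 / 2 + \<nu> * (LINT s:{s..t}|lebesgue. (H1_norm S (u s))\<^sup>2)
        \<le> (norm (u s))\<^sup>2 / 2 + (LINT s:{s..t}|lebesgue. f s \<bullet> u s)"
    using u by (simp add: U_sharp_def weak_solution_def)
  then have "AE s in lebesgue. s \<in> interior I \<longrightarrow> (\<forall>t\<in>interior I. s < t \<longrightarrow>
        (norm (u t))\<^sup>2 / 2 + \<nu> * (LINT s:{s..t}|lebesgue. (H1_norm S (u s))\<^sup>2)
        \<le> (norm (u s))\<^sup>2 / 2 + (LINT s:{s..t}|lebesgue. f s \<bullet> u s))"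
    by (subst (asm) AE_restrict_space_iff) auto
  then show ?thesis
  proof eventually_elim
    case (elim s)
    show ?case
    proof (intro impI ballI)
      assume s: "s \<in> interior I" fix t assume t: "t \<in> interior I" "s < t"
      have st: "{s..t} \<subseteq> I" using interior_interval_subset[OF s t(1)] interior_subset by blast
      have sI: "s \<in> I" "t \<in> I" using st t(2) by auto
      have "(LINT r:{s..t}|lebesgue. (H1_norm S (u r))\<^sup>2) = (LINT r|lebesgue. indicator {s..t} r * enn2real (g r u))"
        unfolding set_lebesgue_integral_def
      proof (rule integral_cong_AE_lebesgue)
        show "AE r in lebesgue. indicator {s..t} r *\<^sub>R (H1_norm S (u r))\<^sup>2 = indicator {s..t} r * enn2real (g r u)"
          using path_g_eq[OF u] by eventually_elim (use st in \<open>auto simp: indicator_def\<close>)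
        show "(\<lambda>r. indicator {s..t} r * enn2real (g r u)) \<in> borel_measurable lebesgue"
          using U_space[OF u] by measurable
      qed
      moreover have "(LINT r:{s..t}|lebesgue. f r \<bullet> u r) = (LINT r|lebesgue. indicator {s..t} r * k r u)"
        unfolding set_lebesgue_integral_def
      proof (rule integral_cong_AE_lebesgue)
        show "AE r in lebesgue. indicator {s..t} r *\<^sub>R (f r \<bullet> u r) = indicator {s..t} r * k r u"
          using AE_not_in[OF N0] by eventually_elim (use st f_eq in \<open>auto simp: indicator_def k_eq\<close>)
        show "(\<lambda>r. indicator {s..t} r * k r u) \<in> borel_measurable lebesgue"
          using U_space[OF u] by measurable
      qed
      moreover have "(norm (u t))\<^sup>2 / 2 + \<nu> * (LINT r:{s..t}|lebesgue. (H1_norm S (u r))\<^sup>2)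
          \<le> (norm (u s))\<^sup>2 / 2 + (LINT r:{s..t}|lebesgue. f r \<bullet> u r)"
        using elim s t by blast
      ultimately show "energy_step u s t"
        unfolding energy_step_def E_eq[OF sI(1)] E_eq[OF sI(2)] by (simp only:)
    qed
  qed
qed

text \<open>Finite mean energy at \<open>s\<close> makes \<open>\<psi> (E s u)\<close> integrable
  for every energy function, since these grow at most linearly. A countable set of end times
  \<open>q\<close> is what allows the exchange of quantifiers.\<close>

definition good_time :: "real \<Rightarrow> bool" where
  "good_time s \<longleftrightarrow> s \<in> interior I \<and> (\<integral>\<^sup>+u. ennreal (E s u) \<partial>\<rho>) < \<infinity> \<and>
    (AE u in \<rho>. \<forall>q\<in>\<rat>. q \<in> interior I \<longrightarrow> s < q \<longrightarrow> energy_step u s q)"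

text \<open>Exchanging two almost-everywhere quantifiers by Fubini's theorem requires the set to be
  measurable in the product, not just its sections.\<close>

lemma energy_step_measurable:
  "{x \<in> space (lebesgue \<Otimes>\<^sub>M \<rho>). fst x \<in> interior I \<longrightarrow> fst x < q \<longrightarrow> energy_step (snd x) (fst x) q} \<in> sets (lebesgue \<Otimes>\<^sub>M \<rho>)"
proof -
  \<comment> \<open>An interval with a variable end point is written as two comparisons, which are
    jointly measurable in the end point and \<open>r\<close>.\<close>
  have eq: "indicator {s..t} r * (c::real) = (if s \<le> r \<and> r \<le> t then c else 0)" for s t r :: real and c
    by (auto simp: indicator_def)
  let ?L = "lebesgue :: real measure"
  have [measurable]: "fst \<in> borel_measurable (?L \<Otimes>\<^sub>M \<rho>)"
    "(\<lambda>z. fst (fst z)) \<in> borel_measurable ((?L \<Otimes>\<^sub>M \<rho>) \<Otimes>\<^sub>M ?L)"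
    "snd \<in> borel_measurable ((?L \<Otimes>\<^sub>M \<rho>) \<Otimes>\<^sub>M ?L)"
    by - (rule measurable_lebesgue_imp_borel,
        rule measurable_fst measurable_snd measurable_compose[OF measurable_fst measurable_fst])+
  have [measurable]: "(\<lambda>x. LINT r|lebesgue. (if fst x \<le> r \<and> r \<le> q then enn2real (g r (snd x)) else 0))
      \<in> borel_measurable (lebesgue \<Otimes>\<^sub>M \<rho>)"
    "(\<lambda>x. LINT r|lebesgue. (if fst x \<le> r \<and> r \<le> q then k r (snd x) else 0))
      \<in> borel_measurable (lebesgue \<Otimes>\<^sub>M \<rho>)"
    by - (rule lebesgue.borel_measurable_lebesgue_integral, simp only: case_prod_beta', measurable)+
  have [measurable]: "interior I \<in> sets borel" by simp
  have "Measurable.pred (lebesgue \<Otimes>\<^sub>M \<rho>) (\<lambda>x. fst x \<in> interior I)"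
    by (rule pred_sets2[of _ borel]) auto
  moreover have "Measurable.pred (lebesgue \<Otimes>\<^sub>M \<rho>) (\<lambda>x. fst x < q)"
    by (rule borel_measurable_pred_less) auto
  moreover have "Measurable.pred (lebesgue \<Otimes>\<^sub>M \<rho>) (\<lambda>x. energy_step (snd x) (fst x) q)"
    unfolding energy_step_def eq by measurable
  ultimately show ?thesis by (simp add: pred_def[symmetric])
qed

lemma AE_good_time_1:
  "AE s in lebesgue. s \<in> interior I \<longrightarrow> (\<integral>\<^sup>+u. ennreal (E s u) \<partial>\<rho>) < \<infinity>"
proof -
  obtain \<D> where D: "countable \<D>" "\<D> \<subseteq> Pow (interior I)" "\<And>X. X \<in> \<D> \<Longrightarrow> \<exists>a b. X = cbox a b" "\<Union>\<D> = interior I"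
    using open_countable_Union_open_cbox[OF open_interior[of I]] by metis
  have "AE s in lebesgue. \<forall>X\<in>\<D>. s \<in> X \<longrightarrow> (\<integral>\<^sup>+u. ennreal (E s u) \<partial>\<rho>) < \<infinity>"
  proof (rule AE_ball_countable'[OF _ D(1)])
    fix X assume X: "X \<in> \<D>"
    then obtain a b where ab: "X = {a..b}" using D(3)[OF X] by (auto simp: cbox_interval)
    have abI: "{a..b} \<subseteq> I" using X D(2) ab interior_subset by blast
    have "\<exists>c. AE t in lebesgue_on {a..b}. (\<integral>\<^sup>+u\<in>U. ennreal ((norm (u t))\<^sup>2) \<partial>\<rho>) \<le> ennreal c"
      using vf abI unfolding vishik_fursikov_measure_def by blast
    then obtain c where "AE t in lebesgue. t \<in> {a..b} \<longrightarrow> (\<integral>\<^sup>+u\<in>U. ennreal ((norm (u t))\<^sup>2) \<partial>\<rho>) \<le> ennreal c"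
      by (subst (asm) AE_restrict_space_iff) auto
    then show "AE s in lebesgue. s \<in> X \<longrightarrow> (\<integral>\<^sup>+u. ennreal (E s u) \<partial>\<rho>) < \<infinity>"
    proof eventually_elim
      case (elim s)
      show ?case
      proof
        assume "s \<in> X"
        then have "(\<integral>\<^sup>+u. ennreal (E s u) \<partial>\<rho>) \<le> ennreal c"
          using elim nn_integral_U_energy[of s "\<lambda>x. x"] abI ab by auto
        then show "(\<integral>\<^sup>+u. ennreal (E s u) \<partial>\<rho>) < \<infinity>" by (auto intro: le_less_trans)
      qed
    qed
  qed
  then show ?thesis by eventually_elim (use D(4) in blast)
qed

text \<open>The exchange is made for one \<open>q\<close> at a time. Countability of the rationals
  is then used twice, outside and inside the quantifier over \<open>u\<close>.\<close>

lemma AE_good_time_2: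
  "AE s in lebesgue. s \<in> interior I \<longrightarrow> (AE u in \<rho>. \<forall>q\<in>\<rat>. q \<in> interior I \<longrightarrow> s < q \<longrightarrow> energy_step u s q)"
proof -
  have "AE s in lebesgue. AE u in \<rho>. s \<in> interior I \<longrightarrow> s < q \<longrightarrow> energy_step u s q" if q: "q \<in> interior I" for q
  proof (subst P.AE_commute[OF energy_step_measurable])
    show "AE u in \<rho>. AE s in lebesgue. s \<in> interior I \<longrightarrow> s < q \<longrightarrow> energy_step u s q"
      using AE_U
    proof eventually_elim
      case (elim u)
      show ?case using path_energy[OF elim] by eventually_elim (use q in auto)
    qed
  qed
  then have "AE s in lebesgue. \<forall>q\<in>\<rat> \<inter> interior I. AE u in \<rho>. s \<in> interior I \<longrightarrow> s < q \<longrightarrow> energy_step u s q"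
    by (intro AE_ball_countable') (auto intro: countable_rat countable_Int1)
  then show ?thesis
  proof eventually_elim
    case (elim s)
    then have "AE u in \<rho>. \<forall>q\<in>\<rat> \<inter> interior I. s \<in> interior I \<longrightarrow> s < q \<longrightarrow> energy_step u s q"
      by (intro AE_ball_countable') (auto intro: countable_rat countable_Int1)
    then show ?case by (auto elim!: eventually_mono)
  qed
qed

lemma null_good_time: "I - {s. good_time s} \<in> null_sets lebesgue"
proof -
  have "AE s in lebesgue. s \<notin> I - {s. good_time s}"
    using AE_not_in[OF null_interior] AE_good_time_1 AE_good_time_2
    by eventually_elim (auto simp: good_time_def)
  then show ?thesis
    by (subst completion.null_sets_iff_AE) auto
qed
end

section \<open>The inequality along a trajectory\<close>

context energy_setup
begin

lemma C_nonneg: "0 \<le> C" using f0_bound[of 0] norm_ge_zero order_trans by blast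

text \<open>The power of the force is controlled by the energy, not by the gradient, so the moment
  bound of the measure gives its integrability.\<close>

lemma k_bound: "\<bar>k s u\<bar> \<le> C * (1 + E s u)"
proof (cases "s \<in> I")
  case True
  have "\<bar>k s u\<bar> \<le> norm (f0 s) * norm (u s)" using True by (simp add: k_eq Cauchy_Schwarz_ineq2)
  also have "\<dots> \<le> C * norm (u s)" by (intro mult_right_mono f0_bound) simp
  also have "norm (u s) \<le> 1 + (norm (u s))\<^sup>2"
    using zero_le_power2[of "norm (u s) - 1"] by (simp add: power2_diff) (smt (verit) norm_ge_zero)
  then have "C * norm (u s) \<le> C * (1 + (norm (u s))\<^sup>2)" by (intro mult_left_mono C_nonneg)
  finally show ?thesis using True by (simp add: E_eq)
qed (simp add: k_def C_nonneg)

lemma section_measurable: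
  assumes "u \<in> space \<rho>"
  shows "(\<lambda>s. E s u) \<in> borel_measurable lebesgue" "(\<lambda>s. k s u) \<in> borel_measurable lebesgue"
    "(\<lambda>s. g s u) \<in> borel_measurable lebesgue"
  using assms by measurable

lemma energy_integrable:
  assumes u: "u \<in> space \<rho>" and fin: "(\<integral>\<^sup>+s. indicator {a..b} s * ennreal (E s u) \<partial>lebesgue) < \<infinity>"
  shows "integrable lebesgue (\<lambda>s. indicator {a..b} s * (1 + E s u))"
proof -
  note [measurable] = section_measurable[OF u]
  have "integrable lebesgue (\<lambda>s. indicator {a..b} s * E s u)"
  proof (rule integrableI_bounded)
    have "(\<integral>\<^sup>+s. ennreal (norm (indicator {a..b} s * E s u)) \<partial>lebesgue)
        = (\<integral>\<^sup>+s. indicator {a..b} s * ennreal (E s u) \<partial>lebesgue)"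
      by (intro nn_integral_cong) (auto simp: indicator_def)
    then show "(\<integral>\<^sup>+s. ennreal (norm (indicator {a..b} s * E s u)) \<partial>lebesgue) < \<infinity>" using fin by simp
  qed measurable
  moreover have "integrable lebesgue (indicator {a..b} :: real \<Rightarrow> real)"
    by (intro integrable_real_indicator) (auto simp: emeasure_lborel_Icc_eq)
  ultimately have "integrable lebesgue (\<lambda>s. indicator {a..b} s + indicator {a..b} s * E s u)"
    by (rule Bochner_Integration.integrable_add[rotated])
  then show ?thesis by (simp add: distrib_left)
qed

lemma k_integrable:
  assumes u: "u \<in> space \<rho>" and fin: "(\<integral>\<^sup>+s. indicator {a..b} s * ennreal (E s u) \<partial>lebesgue) < \<infinity>"
  shows "integrable lebesgue (\<lambda>s. indicator {a..b} s * k s u)"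
proof (rule Bochner_Integration.integrable_bound)
  note [measurable] = section_measurable[OF u]
  show "integrable lebesgue (\<lambda>s. C * (indicator {a..b} s * (1 + E s u)))"
    by (intro integrable_mult_right energy_integrable assms)
  show "(\<lambda>s. indicator {a..b} s * k s u) \<in> borel_measurable lebesgue" by measurable
  show "AE s in lebesgue. norm (indicator {a..b} s * k s u) \<le> norm (C * (indicator {a..b} s * (1 + E s u)))"
    using k_bound[of _ u] C_nonneg by (intro AE_I2) (auto simp: indicator_def abs_mult)
qed

lemma g_integrable:
  assumes u: "u \<in> U" and I: "{a..b} \<subseteq> I" and fin: "(\<integral>\<^sup>+s. indicator {a..b} s * g s u \<partial>lebesgue) < \<infinity>"
  shows "integrable lebesgue (\<lambda>s. indicator {a..b} s * enn2real (g s u))"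
    and "ennreal (LINT s|lebesgue. indicator {a..b} s * enn2real (g s u)) = (\<integral>\<^sup>+s. indicator {a..b} s * g s u \<partial>lebesgue)"
proof -
  note [measurable] = section_measurable[OF U_space[OF u]]
  have eq: "(\<integral>\<^sup>+s. ennreal (indicator {a..b} s * enn2real (g s u)) \<partial>lebesgue) = (\<integral>\<^sup>+s. indicator {a..b} s * g s u \<partial>lebesgue)"
    using path_g_eq[OF u] I by (intro nn_integral_cong_AE) (auto elim!: eventually_mono simp: indicator_def subset_iff)
  show int: "integrable lebesgue (\<lambda>s. indicator {a..b} s * enn2real (g s u))"
    using fin eq by (intro integrableI_bounded) auto
  show "ennreal (LINT s|lebesgue. indicator {a..b} s * enn2real (g s u)) = (\<integral>\<^sup>+s. indicator {a..b} s * g s u \<partial>lebesgue)"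
    using nn_integral_eq_integral[OF int] eq by simp
qed

lemma nn_integral_interval_mono:
  "{a..b} \<subseteq> {c..d} \<Longrightarrow> (\<integral>\<^sup>+s. indicator {a..b} s * h s \<partial>lebesgue) \<le> (\<integral>\<^sup>+s. indicator {c..d} s * h s \<partial>lebesgue)"
  by (intro nn_integral_mono mult_right_mono) (auto simp: indicator_def)

text \<open>Rational times \<open>q n\<close> tend to \<open>t\<close> from below; \<open>t\<close>
  may be the right end point of \<open>I\<close>. Since \<open>E (q n) u\<close> is nonnegative, the
  inequalities themselves bound the dissipation up to \<open>q n\<close> uniformly, and Fatou's
  lemma makes it finite up to \<open>t\<close>. Then the integrals converge by domination.\<close>

lemma path_energy_extend:
  assumes u: "u \<in> U" and r: "r \<in> interior I" and t: "t \<in> I" "r < t"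
    and steps: "\<forall>q\<in>\<rat>. q \<in> interior I \<longrightarrow> r < q \<longrightarrow> energy_step u r q"
    and mom: "(\<integral>\<^sup>+s. indicator {r..t} s * ennreal (E s u) \<partial>lebesgue) < \<infinity>"
  shows "(\<integral>\<^sup>+s. indicator {r..t} s * g s u \<partial>lebesgue) < \<infinity>" and "energy_step u r t"
proof -
  have us: "u \<in> space \<rho>" by (rule U_space[OF u])
  note [measurable] = section_measurable[OF us]
  have rI: "r \<in> I" using r interior_subset by blast
  have rt: "{r..t} \<subseteq> I" by (rule interval_subset[OF rI t(1)])
  have int: "q \<in> interior I" if "r < q" "q < t" for q
    using that rt by (intro interiorI[of "{r<..<t}"]) auto
  have "\<exists>q\<in>\<rat>. max r (t - inverse (real (Suc n))) < q \<and> q < t" for n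
    using t(2) by (intro Rats_dense_in_real) auto
  then obtain q where q: "\<And>n. q n \<in> \<rat>" "\<And>n. r < q n" "\<And>n. t - inverse (real (Suc n)) < q n" "\<And>n. q n < t"
    by (metis max_less_iff_conj)
  have "(\<lambda>n. t - inverse (real (Suc n))) \<longlonglongrightarrow> t - 0" by (intro tendsto_intros LIMSEQ_inverse_real_of_nat)
  then have qlim: "q \<longlonglongrightarrow> t"
    using q by (intro real_tendsto_sandwich[of "\<lambda>n. t - inverse (real (Suc n))" q _ "\<lambda>_. t"]) (auto intro!: always_eventually less_imp_le)
  have step: "energy_step u r (q n)" for n using steps q int by blast
  have kint: "integrable lebesgue (\<lambda>s. indicator {r..t} s * k s u)" by (rule k_integrable[OF us mom])
  have sub: "{r..q n} \<subseteq> {r..t}" for n using q(4)[of n] by auto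
  have knint: "integrable lebesgue (\<lambda>s. indicator {r..q n} s * k s u)" for n
    by (rule k_integrable[OF us le_less_trans[OF nn_integral_interval_mono[OF sub] mom]])
  \<comment> \<open>What \<open>energy_step\<close> leaves for the dissipation when the final energy
    is dropped and the work is estimated by its absolute value over the whole interval.\<close>
  define B where "B = (E r u / 2 + (LINT s|lebesgue. \<bar>indicator {r..t} s * k s u\<bar>)) / \<nu>"
  have \<nu>B: "\<nu> * B = E r u / 2 + (LINT s|lebesgue. \<bar>indicator {r..t} s * k s u\<bar>)"
    using nu by (simp add: B_def)
  have qI: "{r..q n} \<subseteq> interior I" for n
    using interior_interval_subset[OF r int[OF q(2) q(4)]] .
  have qI': "{r..q n} \<subseteq> I" for n using qI interior_subset by blast
  have gB: "(\<integral>\<^sup>+s. indicator {r..q n} s * g s u \<partial>lebesgue) \<le> ennreal B" for n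
  proof -
    note gn = g_integrable[OF u qI' path_H1(2)[OF u qI]]
    have "(LINT s|lebesgue. indicator {r..q n} s * k s u) \<le> (LINT s|lebesgue. \<bar>indicator {r..t} s * k s u\<bar>)"
      using sub[of n] by (intro integral_mono knint integrable_abs kint) (auto simp: indicator_def)
    then have "\<nu> * (LINT s|lebesgue. indicator {r..q n} s * enn2real (g s u)) \<le> \<nu> * B"
      using step[of n] E_nonneg[of "q n" u] \<nu>B unfolding energy_step_def by linarith
    then have "(LINT s|lebesgue. indicator {r..q n} s * enn2real (g s u)) \<le> B"
      using nu by (simp add: mult_le_cancel_left_pos)
    then have "ennreal (LINT s|lebesgue. indicator {r..q n} s * enn2real (g s u)) \<le> ennreal B" by (rule ennreal_leI)
    then show ?thesis by (simp only: gn(2))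
  qed
  have evq: "\<forall>\<^sub>F n in sequentially. s \<le> q n" if "s < t" for s
    using order_tendstoD(1)[OF qlim that] by (auto elim!: eventually_mono)
  have ind_lim: "(\<lambda>n. indicator {r..q n} s :: real) \<longlonglongrightarrow> indicator {r..t} s" if "s \<noteq> t" for s
  proof (rule tendsto_eventually)
    show "\<forall>\<^sub>F n in sequentially. indicator {r..q n} s = (indicator {r..t} s :: real)"
    proof (cases "s < t")
      case True
      from evq[OF True] show ?thesis by eventually_elim (use True in \<open>auto simp: indicator_def\<close>)
    next
      case False
      then have "indicator {r..q n} s = (indicator {r..t} s :: real)" for n
        using that q(4)[of n] by (auto simp: indicator_def)
      then show ?thesis by simp
    qed
  qed
  have net: "AE s in lebesgue. s \<noteq> t" by (rule AE_completion) (rule AE_lborel_singleton)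
  have "(\<integral>\<^sup>+s. indicator {r..t} s * g s u \<partial>lebesgue)
      \<le> (\<integral>\<^sup>+s. liminf (\<lambda>n. indicator {r..q n} s * g s u) \<partial>lebesgue)"
  proof (rule nn_integral_mono_AE, rule AE_mp[OF net], intro AE_I2 impI)
    fix s assume s: "s \<noteq> t"
    show "indicator {r..t} s * g s u \<le> liminf (\<lambda>n. indicator {r..q n} s * g s u)"
    proof (rule Liminf_bounded)
      show "\<forall>\<^sub>F n in sequentially. indicator {r..t} s * g s u \<le> indicator {r..q n} s * g s u"
      proof (cases "s < t")
        case True
        from evq[OF True] show ?thesis by eventually_elim (auto simp: indicator_def)
      next
        case False
        then show ?thesis using s by (auto simp: indicator_def)
      qed
    qed
  qed
  also have "\<dots> \<le> liminf (\<lambda>n. \<integral>\<^sup>+s. indicator {r..q n} s * g s u \<partial>lebesgue)"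
    by (rule nn_integral_liminf) measurable
  also have "\<dots> \<le> limsup (\<lambda>n. \<integral>\<^sup>+s. indicator {r..q n} s * g s u \<partial>lebesgue)"
    by (rule Liminf_le_Limsup) simp
  also have "\<dots> \<le> ennreal B"
    by (rule Limsup_bounded) (simp add: gB)
  also have "\<dots> < \<infinity>" by simp
  finally show fin: "(\<integral>\<^sup>+s. indicator {r..t} s * g s u \<partial>lebesgue) < \<infinity>" .
  have gint: "integrable lebesgue (\<lambda>s. indicator {r..t} s * enn2real (g s u))"
    by (rule g_integrable(1)[OF u rt fin])
  have glim: "(\<lambda>n. LINT s|lebesgue. indicator {r..q n} s * enn2real (g s u))
      \<longlonglongrightarrow> (LINT s|lebesgue. indicator {r..t} s * enn2real (g s u))"
  proof (rule integral_dominated_convergence[OF _ _ gint])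
    show "AE s in lebesgue. (\<lambda>n. indicator {r..q n} s * enn2real (g s u)) \<longlonglongrightarrow> indicator {r..t} s * enn2real (g s u)"
      using net by eventually_elim (intro tendsto_mult tendsto_const ind_lim)
    show "AE s in lebesgue. norm (indicator {r..q n} s * enn2real (g s u)) \<le> indicator {r..t} s * enn2real (g s u)" for n
      using sub[of n] by (intro AE_I2) (auto simp: indicator_def)
  qed measurable
  have klim: "(\<lambda>n. LINT s|lebesgue. indicator {r..q n} s * k s u)
      \<longlonglongrightarrow> (LINT s|lebesgue. indicator {r..t} s * k s u)"
  proof (rule integral_dominated_convergence[OF _ _ integrable_abs[OF kint]])
    show "AE s in lebesgue. (\<lambda>n. indicator {r..q n} s * k s u) \<longlonglongrightarrow> indicator {r..t} s * k s u"
      using net by eventually_elim (intro tendsto_mult tendsto_const ind_lim)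
    show "AE s in lebesgue. norm (indicator {r..q n} s * k s u) \<le> \<bar>indicator {r..t} s * k s u\<bar>" for n
      using sub[of n] by (intro AE_I2) (auto simp: indicator_def)
  qed measurable
  have h: "u t \<in> space_H S" by (rule weak_continuous_in_H[OF U_C_loc[OF u] t(1)])
  have "continuous_on I (\<lambda>s. u s \<bullet> u t)" by (rule weak_continuous_inner[OF U_C_loc[OF u] h])
  then have ulim: "(\<lambda>n. u (q n) \<bullet> u t) \<longlonglongrightarrow> u t \<bullet> u t"
    by (rule continuous_on_tendsto_compose[OF _ qlim t(1)]) (use q rt in \<open>auto intro!: always_eventually simp: subset_iff less_imp_le\<close>)
  \<comment> \<open>Weak lower semicontinuity by hand: expanding
    \<open>(norm (u (q n) - u t))^2 \<ge> 0\<close> gives a lower bound that is affine in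
    \<open>u (q n)\<close> and so converges.\<close>
  have low: "2 * (u (q n) \<bullet> u t) - (norm (u t))\<^sup>2 \<le> E (q n) u" for n
  proof -
    have "q n \<in> I" using q(2,4)[of n] rt by auto
    then show ?thesis using zero_le_power2[of "norm (u (q n) - u t)"]
      unfolding E_eq[OF \<open>q n \<in> I\<close>] power2_norm_eq_inner
      by (simp add: inner_diff_left inner_diff_right inner_commute)
  qed
  have "(2 * (u t \<bullet> u t) - (norm (u t))\<^sup>2) / 2 + \<nu> * (LINT s|lebesgue. indicator {r..t} s * enn2real (g s u))
      \<le> E r u / 2 + (LINT s|lebesgue. indicator {r..t} s * k s u)"
  proof (rule LIMSEQ_le)
    show "(\<lambda>n. (2 * (u (q n) \<bullet> u t) - (norm (u t))\<^sup>2) / 2 + \<nu> * (LINT s|lebesgue. indicator {r..q n} s * enn2real (g s u)))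
      \<longlonglongrightarrow> (2 * (u t \<bullet> u t) - (norm (u t))\<^sup>2) / 2 + \<nu> * (LINT s|lebesgue. indicator {r..t} s * enn2real (g s u))"
      by (intro tendsto_intros ulim glim) auto
    show "(\<lambda>n. E r u / 2 + (LINT s|lebesgue. indicator {r..q n} s * k s u))
      \<longlonglongrightarrow> E r u / 2 + (LINT s|lebesgue. indicator {r..t} s * k s u)"
      by (intro tendsto_intros klim)
    have "(2 * (u (q n) \<bullet> u t) - (norm (u t))\<^sup>2) / 2 + \<nu> * (LINT s|lebesgue. indicator {r..q n} s * enn2real (g s u))
        \<le> E r u / 2 + (LINT s|lebesgue. indicator {r..q n} s * k s u)" for n
      by (rule order_trans[OF add_right_mono[OF divide_right_mono[OF low]] step[unfolded energy_step_def]]) simp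
    then show "\<exists>N. \<forall>n\<ge>N. (2 * (u (q n) \<bullet> u t) - (norm (u t))\<^sup>2) / 2 + \<nu> * (LINT s|lebesgue. indicator {r..q n} s * enn2real (g s u))
        \<le> E r u / 2 + (LINT s|lebesgue. indicator {r..q n} s * k s u)" by blast
  qed
  then show "energy_step u r t"
    by (simp add: energy_step_def E_eq[OF t(1)] power2_norm_eq_inner)
qed

lemma energy_function_measurable:
  assumes psi: "energy_function \<psi> \<psi>'" and p: "p \<in> M \<rightarrow>\<^sub>M lebesgue" "q \<in> M \<rightarrow>\<^sub>M \<rho>"
  shows "(\<lambda>x. \<psi> (E (p x) (q x))) \<in> borel_measurable M" "(\<lambda>x. \<psi>' (E (p x) (q x))) \<in> borel_measurable M"
proof -
  have *: "(\<lambda>x. h (E (p x) (q x))) \<in> borel_measurable M" if h: "continuous_on {0..} h" for h :: "real \<Rightarrow> real"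
  proof -
    \<comment> \<open>Continuity of \<open>h\<close> is given on nonnegative arguments only; as
      \<open>E\<close> is nonnegative, clamping its value changes nothing.\<close>
    have "continuous_on UNIV (\<lambda>r. h (max 0 r))"
      by (rule continuous_on_compose2[OF h]) (auto intro!: continuous_intros)
    then have "(\<lambda>r. h (max 0 r)) \<in> borel_measurable borel" by (rule borel_measurable_continuous_onI)
    from measurable_compose[OF E_measurable'[OF p] this] show ?thesis by simp
  qed
  have "continuous_on {0..} \<psi>"
    using psi by (intro DERIV_continuous_on[of _ _ \<psi>']) (auto simp: energy_function_def)
  then show "(\<lambda>x. \<psi> (E (p x) (q x))) \<in> borel_measurable M" by (rule *)
  show "(\<lambda>x. \<psi>' (E (p x) (q x))) \<in> borel_measurable M"
    using psi by (intro *) (simp add: energy_function_def)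
qed

lemma deriv_mult_integrable:
  assumes psi: "energy_function \<psi> \<psi>'" and u: "u \<in> space \<rho>" and h: "integrable lebesgue (\<lambda>s. indicator X s * h s)"
  shows "integrable lebesgue (\<lambda>s. indicator X s * (\<psi>' (E s u) * h s :: real))"
proof -
  obtain M where M: "0 \<le> M" "\<And>r. 0 \<le> r \<Longrightarrow> \<psi>' r \<le> M" using energy_function_deriv_bound[OF psi] by metis
  have [measurable]: "(\<lambda>s. \<psi>' (E s u)) \<in> borel_measurable lebesgue"
    using u by (intro energy_function_measurable[OF psi]) auto
  have [measurable]: "(\<lambda>s. indicator X s * h s) \<in> borel_measurable lebesgue" using h by (rule borel_measurable_integrable)
  have "integrable lebesgue (\<lambda>s. \<psi>' (E s u) * (indicator X s * h s))"
  proof (rule Bochner_Integration.integrable_bound)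
    show "integrable lebesgue (\<lambda>s. M * (indicator X s * h s))" using h by simp
    show "AE s in lebesgue. norm (\<psi>' (E s u) * (indicator X s * h s)) \<le> norm (M * (indicator X s * h s))"
    proof (intro AE_I2)
      fix s
      have "norm (\<psi>' (E s u)) \<le> norm M"
        using M(1) M(2)[OF E_nonneg] energy_function_deriv_nonneg[OF psi E_nonneg] by simp
      then show "norm (\<psi>' (E s u) * (indicator X s * h s)) \<le> norm (M * (indicator X s * h s))"
        unfolding norm_mult[of "\<psi>' (E s u)"] norm_mult[of M] by (rule mult_right_mono) simp
    qed
  qed measurable
  then show ?thesis by (simp add: mult.left_commute)
qed

text \<open>After \<open>r\<close>, the energy inequality starts outside a null set that belongs to
  this trajectory; at \<open>r\<close> itself it comes from \<open>steps\<close>, the form in which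
  a good time provides it. \<open>path_energy_extend\<close> upgrades both to all later end times,
  as \<open>energy_chain_rule\<close> demands.\<close>

lemma path_chain:
  assumes psi: "energy_function \<psi> \<psi>'"
    and u: "u \<in> U" and r: "r \<in> interior I" and t: "t \<in> I" "r < t"
    and steps: "\<forall>q\<in>\<rat>. q \<in> interior I \<longrightarrow> r < q \<longrightarrow> energy_step u r q"
    and mom: "(\<integral>\<^sup>+s. indicator {r..t} s * ennreal (E s u) \<partial>lebesgue) < \<infinity>"
  shows "integrable lebesgue (\<lambda>s. indicator {r..t} s * (\<psi>' (E s u) * enn2real (g s u)))"
    and "integrable lebesgue (\<lambda>s. indicator {r..t} s * (\<psi>' (E s u) * k s u))"
    and "\<psi> (E t u) / 2 + \<nu> * (LINT s|lebesgue. indicator {r..t} s * (\<psi>' (E s u) * enn2real (g s u)))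
      \<le> \<psi> (E r u) / 2 + (LINT s|lebesgue. indicator {r..t} s * (\<psi>' (E s u) * k s u))"
proof -
  have us: "u \<in> space \<rho>" by (rule U_space[OF u])
  have rI: "r \<in> I" using r interior_subset by blast
  have rt: "{r..t} \<subseteq> I" by (rule interval_subset[OF rI t(1)])
  have gi: "integrable lebesgue (\<lambda>s. indicator {r..t} s * enn2real (g s u))"
    by (rule g_integrable(1)[OF u rt path_energy_extend(1)[OF u r t steps mom]])
  have ki: "integrable lebesgue (\<lambda>s. indicator {r..t} s * k s u)" by (rule k_integrable[OF us mom])
  show G': "integrable lebesgue (\<lambda>s. indicator {r..t} s * (\<psi>' (E s u) * enn2real (g s u)))"
    by (rule deriv_mult_integrable[OF psi us gi])
  show K': "integrable lebesgue (\<lambda>s. indicator {r..t} s * (\<psi>' (E s u) * k s u))"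
    by (rule deriv_mult_integrable[OF psi us ki])
  define \<phi> where "\<phi> s = 2 * (k s u - \<nu> * enn2real (g s u))" for s
  have ki': "set_integrable lebesgue {r..t} (\<lambda>s. k s u)" and gi': "set_integrable lebesgue {r..t} (\<lambda>s. enn2real (g s u))"
    using ki gi by (simp_all add: set_integrable_def)
  have \<phi>int: "set_integrable lebesgue {r..t} \<phi>"
    unfolding \<phi>_def using ki' gi' by (intro set_integrable_mult_right set_integral_diff) auto
  have \<phi>val: "(LINT s:{a..b}|lebesgue. \<phi> s) = 2 * ((LINT s|lebesgue. indicator {a..b} s * k s u)
      - \<nu> * (LINT s|lebesgue. indicator {a..b} s * enn2real (g s u)))" if "{a..b} \<subseteq> {r..t}" for a b
  proof -
    have "set_integrable lebesgue {a..b} (\<lambda>s. k s u)" "set_integrable lebesgue {a..b} (\<lambda>s. enn2real (g s u))"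
      using that by (auto intro: set_integrable_subset[OF ki'] set_integrable_subset[OF gi'])
    then have "(LINT s:{a..b}|lebesgue. \<phi> s) = 2 * ((LINT s:{a..b}|lebesgue. k s u) - \<nu> * (LINT s:{a..b}|lebesgue. enn2real (g s u)))"
      unfolding \<phi>_def by (simp add: set_integral_diff)
    then show ?thesis by (simp add: set_lebesgue_integral_def)
  qed
  have "AE s in lebesgue. s \<in> interior I \<longrightarrow> (\<forall>t\<in>interior I. s < t \<longrightarrow> energy_step u s t)" by (rule path_energy[OF u])
  then obtain N where N: "{s \<in> space lebesgue. \<not> (s \<in> interior I \<longrightarrow> (\<forall>t\<in>interior I. s < t \<longrightarrow> energy_step u s t))} \<subseteq> N"
      "emeasure lebesgue N = 0" "N \<in> sets lebesgue" by (rule AE_E)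
  have N_null: "N \<in> null_sets lebesgue" using N(2,3) unfolding null_sets_def by blast
  \<comment> \<open>\<open>r\<close> is taken out of the null set: \<open>energy_chain_rule\<close>
    needs its left end outside, and \<open>steps\<close> supplies the inequality there.\<close>
  have "negligible ((N \<union> {t}) - {r})"
    using N_null by (intro negligible_diff negligible_Un) (auto simp: negligible_iff_null_sets)
  then have N': "(N \<union> {t}) - {r} \<in> null_sets lebesgue" by (simp add: negligible_iff_null_sets)
  have "\<psi> (E t u) \<le> \<psi> (E r u) + (LINT s:{r..t}|lebesgue. \<psi>' (E s u) * \<phi> s)"
  proof (rule energy_chain_rule[OF psi _ \<phi>int _ _ N'])
    show "r \<le> t" using t by simp
    have "integrable lebesgue (\<lambda>s. indicator {r..t} s * (\<psi>' (E s u) * \<phi> s))"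
      using \<phi>int by (intro deriv_mult_integrable[OF psi us]) (simp add: set_integrable_def)
    then show "set_integrable lebesgue {r..t} (\<lambda>s. \<psi>' (E s u) * \<phi> s)" by (simp add: set_integrable_def)
    show "0 \<le> E s u" for s by simp
    show "r \<notin> N \<union> {t} - {r}" by simp
    fix a b assume a: "a \<in> {r..t} - (N \<union> {t} - {r})" and b: "b \<in> {a..t}"
    show "E b u \<le> E a u + (LINT s:{a..b}|lebesgue. \<phi> s)"
    proof (cases "a = b")
      case True
      have "(LINT s:{b..b}|lebesgue. \<phi> s) = 0"
        unfolding set_lebesgue_integral_def
        by (rule integral_eq_zero_AE, rule AE_mp[OF AE_completion[OF AE_lborel_singleton[of b]]])
          (auto intro!: AE_I2 simp: indicator_def)
      then show ?thesis using True by simp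
    next
      case False
      then have ab: "a < b" using b by simp
      have bI: "b \<in> I" using a b rt by auto
      have aint: "a \<in> interior I"
      proof (cases "a = r")
        case False
        then have "a \<in> {r<..<t}" using a ab b by auto
        then show ?thesis using rt by (intro interiorI[of "{r<..<t}"]) auto
      qed (use r in simp)
      have st: "\<forall>q\<in>\<rat>. q \<in> interior I \<longrightarrow> a < q \<longrightarrow> energy_step u a q"
      proof (cases "a = r")
        case False
        then have "a \<notin> N" using a by auto
        then show ?thesis using N(1) aint by auto
      qed (use steps in simp)
      have sub: "{a..b} \<subseteq> {r..t}" using a b by auto
      have "(\<integral>\<^sup>+s. indicator {a..b} s * ennreal (E s u) \<partial>lebesgue) < \<infinity>"
        by (rule le_less_trans[OF nn_integral_interval_mono[OF sub] mom])
      from path_energy_extend(2)[OF u aint bI ab st this] \<phi>val[OF sub]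
      show ?thesis by (simp add: energy_step_def)
    qed
  qed
  also have "(LINT s:{r..t}|lebesgue. \<psi>' (E s u) * \<phi> s) =
      2 * (LINT s|lebesgue. indicator {r..t} s * (\<psi>' (E s u) * k s u)) -
      2 * (\<nu> * (LINT s|lebesgue. indicator {r..t} s * (\<psi>' (E s u) * enn2real (g s u))))"
  proof -
    have "indicator {r..t} s *\<^sub>R (\<psi>' (E s u) * \<phi> s) = 2 * (indicator {r..t} s * (\<psi>' (E s u) * k s u))
        - 2 * (\<nu> * (indicator {r..t} s * (\<psi>' (E s u) * enn2real (g s u))))" for s
      by (simp add: \<phi>_def algebra_simps)
    then show ?thesis using G' K' by (simp add: set_lebesgue_integral_def)
  qed
  finally show "\<psi> (E t u) / 2 + \<nu> * (LINT s|lebesgue. indicator {r..t} s * (\<psi>' (E s u) * enn2real (g s u)))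
      \<le> \<psi> (E r u) / 2 + (LINT s|lebesgue. indicator {r..t} s * (\<psi>' (E s u) * k s u))" by simp
qed
end

section \<open>The inequality in the mean\<close>

lemma integrable_cong_AE_lebesgue:
  fixes h h' :: "'a::euclidean_space \<Rightarrow> 'b::{banach, second_countable_topology}"
  assumes ae: "AE x in lebesgue. h x = h' x" and h': "integrable lebesgue h'"
  shows "integrable lebesgue h"
  using integrable_cong_AE[OF borel_measurable_lebesgue_cong_AE[OF ae] _ ae] h' by auto

context energy_setup
begin

text \<open>Kept in \<open>ennreal\<close>, because its finiteness is a consequence of the
  inequality. The sign-changing \<open>work\<close> is a Bochner integral and is bounded in
  advance.\<close>

definition dissipation :: "(real \<Rightarrow> real) \<Rightarrow> real \<Rightarrow> real \<Rightarrow> ennreal" where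
  "dissipation \<psi>' a t = (\<integral>\<^sup>+u. (\<integral>\<^sup>+s. indicator {a..t} s * (ennreal (\<psi>' (E s u)) * g s u) \<partial>lebesgue) \<partial>\<rho>)"

definition work :: "(real \<Rightarrow> real) \<Rightarrow> real \<Rightarrow> real \<Rightarrow> real" where
  "work \<psi>' a t = (LINT u|\<rho>. LINT s|lebesgue. indicator {a..t} s * (\<psi>' (E s u) * k s u))"

text \<open>Nonnegativity of the right-hand side is recorded because \<open>ennreal\<close> maps
  negative numbers to 0, which would weaken the bound.\<close>

definition mean_ineq :: "(real \<Rightarrow> real) \<Rightarrow> (real \<Rightarrow> real) \<Rightarrow> real \<Rightarrow> real \<Rightarrow> bool" where
  "mean_ineq \<psi> \<psi>' a t \<longleftrightarrow> integrable \<rho> (\<lambda>u. \<psi> (E a u)) \<and>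
    0 \<le> (LINT u|\<rho>. \<psi> (E a u) / 2) + work \<psi>' a t \<and>
    (\<integral>\<^sup>+u. ennreal (\<psi> (E t u) / 2) \<partial>\<rho>) + ennreal \<nu> * dissipation \<psi>' a t
      \<le> ennreal ((LINT u|\<rho>. \<psi> (E a u) / 2) + work \<psi>' a t)"

abbreviation "power_at \<psi>' z \<equiv> \<psi>' (E (snd z) (fst z)) * k (snd z) (fst z)"
abbreviation "dissipation_at \<psi>' z \<equiv> ennreal (\<psi>' (E (snd z) (fst z))) * g (snd z) (fst z)"

lemma psi_nonneg: "energy_function \<psi> \<psi>' \<Longrightarrow> 0 \<le> \<psi> (E s u)"
  by (simp add: energy_function_def)

text \<open>The density is at most \<open>M * C * (1 + E)\<close>, where \<open>M\<close> bounds
  \<open>\<psi>'\<close>, and \<open>moment_finite\<close> integrates this over compact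
  subintervals.\<close>

lemma work_integrable:
  assumes psi: "energy_function \<psi> \<psi>'" and ab: "{a..b} \<subseteq> I"
  shows "integrable (\<rho> \<Otimes>\<^sub>M lebesgue) (\<lambda>z. indicator {a..b} (snd z) * power_at \<psi>' z)"
proof (rule integrableI_bounded)
  obtain M where M: "0 \<le> M" "\<And>r. 0 \<le> r \<Longrightarrow> \<psi>' r \<le> M" using energy_function_deriv_bound[OF psi] by metis
  note [measurable] = energy_function_measurable[OF psi]
  show "(\<lambda>z. indicator {a..b} (snd z) * power_at \<psi>' z) \<in> borel_measurable (\<rho> \<Otimes>\<^sub>M lebesgue)"
    by measurable
  have b: "norm (\<psi>' (E s u) * k s u) \<le> (M * C) * (1 + E s u)" for s u
  proof -
    have "norm (\<psi>' (E s u) * k s u) = \<bar>\<psi>' (E s u)\<bar> * \<bar>k s u\<bar>" by (simp add: abs_mult)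
    also have "\<dots> \<le> M * (C * (1 + E s u))"
      using M energy_function_deriv_nonneg[OF psi E_nonneg] by (intro mult_mono k_bound) auto
    finally show ?thesis by (simp add: mult.assoc)
  qed
  have MC: "0 \<le> M * C" using M(1) C_nonneg by simp
  have e: "ennreal ((M * C) * (1 + E s u)) = ennreal (M * C) * (1 + ennreal (E s u))" for s u
    using MC by (simp add: ennreal_mult)
  have "(\<integral>\<^sup>+z. ennreal (norm (indicator {a..b} (snd z) * power_at \<psi>' z)) \<partial>(\<rho> \<Otimes>\<^sub>M lebesgue))
      \<le> (\<integral>\<^sup>+z. ennreal (M * C) * (indicator {a..b} (snd z) + indicator {a..b} (snd z) * ennreal (E (snd z) (fst z))) \<partial>(\<rho> \<Otimes>\<^sub>M lebesgue))"
  proof (rule nn_integral_mono)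
    fix z :: "(real \<Rightarrow> l2) \<times> real"
    show "ennreal (norm (indicator {a..b} (snd z) * power_at \<psi>' z))
      \<le> ennreal (M * C) * (indicator {a..b} (snd z) + indicator {a..b} (snd z) * ennreal (E (snd z) (fst z)))"
      using ennreal_leI[OF b[of "snd z" "fst z"]] unfolding e by (cases "snd z \<in> {a..b}") auto
  qed
  also have "\<dots> = ennreal (M * C) * (\<integral>\<^sup>+z. indicator {a..b} (snd z) + indicator {a..b} (snd z) * ennreal (E (snd z) (fst z)) \<partial>(\<rho> \<Otimes>\<^sub>M lebesgue))"
    by (rule nn_integral_cmult) measurable
  also have "(\<integral>\<^sup>+z. indicator {a..b} (snd z) + indicator {a..b} (snd z) * ennreal (E (snd z) (fst z)) \<partial>(\<rho> \<Otimes>\<^sub>M lebesgue))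
      = (\<integral>\<^sup>+u. \<integral>\<^sup>+s. indicator {a..b} s + indicator {a..b} s * ennreal (E s u) \<partial>lebesgue \<partial>\<rho>)"
  proof -
    have "(\<lambda>z. indicator {a..b} (snd z) + indicator {a..b} (snd z) * ennreal (E (snd z) (fst z)))
        \<in> borel_measurable (\<rho> \<Otimes>\<^sub>M lebesgue)" by measurable
    from lebesgue.nn_integral_fst[OF this] show ?thesis by simp
  qed
  also have "\<dots> = (\<integral>\<^sup>+u. (emeasure lebesgue {a..b} + (\<integral>\<^sup>+s. indicator {a..b} s * ennreal (E s u) \<partial>lebesgue)) \<partial>\<rho>)"
    by (intro nn_integral_cong, subst nn_integral_add) (auto intro!: measurable_compose[OF section_measurable(1)])
  also have "\<dots> = emeasure lebesgue {a..b} + (\<integral>\<^sup>+u. (\<integral>\<^sup>+s. indicator {a..b} s * ennreal (E s u) \<partial>lebesgue) \<partial>\<rho>)"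
    by (subst nn_integral_add) (auto simp: emeasure_space_1)
  also have "ennreal (M * C) * \<dots> < \<infinity>"
    using moment_finite[OF ab] by (simp add: ennreal_mult_less_top emeasure_lborel_Icc_eq)
  finally show "(\<integral>\<^sup>+z. ennreal (norm (indicator {a..b} (snd z) * power_at \<psi>' z)) \<partial>(\<rho> \<Otimes>\<^sub>M lebesgue)) < \<infinity>" .
qed

lemma work_product:
  assumes "energy_function \<psi> \<psi>'" "{a..b} \<subseteq> I"
  shows "work \<psi>' a b = (LINT z|(\<rho> \<Otimes>\<^sub>M lebesgue). indicator {a..b} (snd z) * power_at \<psi>' z)"
    and "integrable \<rho> (\<lambda>u. LINT s|lebesgue. indicator {a..b} s * (\<psi>' (E s u) * k s u))"
    and "AE u in \<rho>. integrable lebesgue (\<lambda>s. indicator {a..b} s * (\<psi>' (E s u) * k s u))"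
  using P'.integral_fst'[OF work_integrable[OF assms]] P'.integrable_fst'[OF work_integrable[OF assms]]
    P'.AE_integrable_fst'[OF work_integrable[OF assms]] by (simp_all add: work_def)

lemma dissipation_product:
  assumes psi: "energy_function \<psi> \<psi>'"
  shows "dissipation \<psi>' a b = (\<integral>\<^sup>+z. indicator {a..b} (snd z) * dissipation_at \<psi>' z \<partial>(\<rho> \<Otimes>\<^sub>M lebesgue))"
proof -
  note [measurable] = energy_function_measurable[OF psi]
  have "(\<lambda>z. indicator {a..b} (snd z) * dissipation_at \<psi>' z)
      \<in> borel_measurable (\<rho> \<Otimes>\<^sub>M lebesgue)" by measurable
  from lebesgue.nn_integral_fst[OF this] show ?thesis by (simp add: dissipation_def)
qed

lemma inner_dissipation_measurable:
  assumes psi: "energy_function \<psi> \<psi>'"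
  shows "(\<lambda>u. \<integral>\<^sup>+s. indicator {a..b} s * (ennreal (\<psi>' (E s u)) * g s u) \<partial>lebesgue) \<in> borel_measurable \<rho>"
proof -
  note [measurable] = energy_function_measurable[OF psi]
  show ?thesis by measurable
qed

lemma nn_integral_energy_sum:
  assumes psi: "energy_function \<psi> \<psi>'"
  shows "(\<integral>\<^sup>+u. (ennreal (\<psi> (E t u) / 2) + ennreal \<nu> * (\<integral>\<^sup>+s. indicator {a..b} s * (ennreal (\<psi>' (E s u)) * g s u) \<partial>lebesgue)) \<partial>\<rho>)
    = (\<integral>\<^sup>+u. ennreal (\<psi> (E t u) / 2) \<partial>\<rho>) + ennreal \<nu> * dissipation \<psi>' a b"
proof -
  note [measurable] = energy_function_measurable[OF psi] inner_dissipation_measurable[OF psi]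
  show ?thesis by (simp add: nn_integral_add nn_integral_cmult dissipation_def)
qed

text \<open>Along a trajectory in \<open>U\<close> the value \<open>g s u\<close> is finite for
  almost every time in \<open>I\<close>, so \<open>enn2real\<close> loses nothing.\<close>

lemma inner_dissipation_eq:
  assumes psi: "energy_function \<psi> \<psi>'" and u: "u \<in> U" and ab: "{a..b} \<subseteq> I"
  shows "(\<integral>\<^sup>+s. indicator {a..b} s * (ennreal (\<psi>' (E s u)) * g s u) \<partial>lebesgue)
    = (\<integral>\<^sup>+s. ennreal (indicator {a..b} s * (\<psi>' (E s u) * enn2real (g s u))) \<partial>lebesgue)"
  using path_g_eq[OF u]
proof (intro nn_integral_cong_AE, eventually_elim)
  fix s assume "s \<in> I \<longrightarrow> g s u = ennreal ((H1_norm S (u s))\<^sup>2)"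
  then show "indicator {a..b} s * (ennreal (\<psi>' (E s u)) * g s u) = ennreal (indicator {a..b} s * (\<psi>' (E s u) * enn2real (g s u)))"
    using ab energy_function_deriv_nonneg[OF psi E_nonneg, of s u] by (cases "s \<in> {a..b}") (auto simp: ennreal_mult subset_iff)
qed

text \<open>The mean value theorem from 0 gives linear growth:
  \<open>\<psi> r \<le> \<psi> 0 + M * r\<close>.\<close>

lemma integrable_psi:
  assumes psi: "energy_function \<psi> \<psi>'" and fin: "(\<integral>\<^sup>+u. ennreal (E s u) \<partial>\<rho>) < \<infinity>"
  shows "integrable \<rho> (\<lambda>u. \<psi> (E s u))"
proof -
  obtain M where M: "0 \<le> M" "\<And>r. 0 \<le> r \<Longrightarrow> \<psi>' r \<le> M" using energy_function_deriv_bound[OF psi] by metis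
  have [measurable]: "(\<lambda>u. E s u) \<in> borel_measurable \<rho>" by measurable
  have [measurable]: "(\<lambda>u. \<psi> (E s u)) \<in> borel_measurable \<rho>"
    by (intro energy_function_measurable[OF psi]) auto
  have "integrable \<rho> (\<lambda>u. E s u)" using fin by (intro integrableI_bounded) auto
  then have "integrable \<rho> (\<lambda>u. \<psi> 0 + M * E s u)" by simp
  then show ?thesis
  proof (rule Bochner_Integration.integrable_bound)
    show "AE u in \<rho>. norm (\<psi> (E s u)) \<le> norm (\<psi> 0 + M * E s u)"
    proof (intro AE_I2)
      fix u
      obtain \<xi> where \<xi>: "\<xi> \<in> closed_segment 0 (E s u)" "\<psi> (E s u) - \<psi> 0 = \<psi>' \<xi> * (E s u - 0)"
        using energy_function_mean_value[OF psi order_refl E_nonneg] by metis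
      have "\<psi>' \<xi> * E s u \<le> M * E s u" using \<xi>(1) M(2)[of \<xi>] by (intro mult_right_mono) (auto simp: closed_segment_eq_real_ivl)
      then have "\<psi> (E s u) \<le> \<psi> 0 + M * E s u" using \<xi>(2) by simp
      then show "norm (\<psi> (E s u)) \<le> norm (\<psi> 0 + M * E s u)" using psi_nonneg[OF psi, of s u] by simp
    qed
  qed measurable
qed

text \<open>The inequality of \<open>path_chain\<close> is integrated over \<open>u\<close>. Its
  left side is nonnegative, so the right side \<open>X\<close> is nonnegative almost surely and its
  integral in \<open>ennreal\<close> agrees with the Bochner integral.\<close>

lemma good_time_mean_ineq:
  assumes psi: "energy_function \<psi> \<psi>'" and a: "good_time a" and t: "t \<in> I" "a < t"
  shows "mean_ineq \<psi> \<psi>' a t"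
proof -
  have aint: "a \<in> interior I" using a by (simp add: good_time_def)
  then have aI: "a \<in> I" using interior_subset by blast
  have at: "{a..t} \<subseteq> I" by (rule interval_subset[OF aI t(1)])
  have int: "integrable \<rho> (\<lambda>u. \<psi> (E a u))" using a by (intro integrable_psi[OF psi]) (simp add: good_time_def)
  define X where "X u = \<psi> (E a u) / 2 + (LINT s|lebesgue. indicator {a..t} s * (\<psi>' (E s u) * k s u))" for u
  have X: "integrable \<rho> X" unfolding X_def using int work_product(2)[OF psi at] by simp
  have Xv: "(LINT u|\<rho>. X u) = (LINT u|\<rho>. \<psi> (E a u) / 2) + work \<psi>' a t"
    unfolding X_def work_def using int work_product(2)[OF psi at] by (subst Bochner_Integration.integral_add) auto
  have steps: "AE u in \<rho>. \<forall>q\<in>\<rat>. q \<in> interior I \<longrightarrow> a < q \<longrightarrow> energy_step u a q"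
    using a by (simp add: good_time_def)
  have main: "AE u in \<rho>. 0 \<le> X u \<and> ennreal (\<psi> (E t u) / 2)
      + ennreal \<nu> * (\<integral>\<^sup>+s. indicator {a..t} s * (ennreal (\<psi>' (E s u)) * g s u) \<partial>lebesgue) \<le> ennreal (X u)"
    using AE_U steps moment_AE_finite[OF at]
  proof eventually_elim
    case (elim u)
    note pc = path_chain[OF psi elim(1) aint t elim(2,3)]
    define y where "y = (LINT s|lebesgue. indicator {a..t} s * (\<psi>' (E s u) * enn2real (g s u)))"
    have y0: "0 \<le> y" unfolding y_def
      using energy_function_deriv_nonneg[OF psi E_nonneg] by (intro Bochner_Integration.integral_nonneg) simp
    have "(\<integral>\<^sup>+s. indicator {a..t} s * (ennreal (\<psi>' (E s u)) * g s u) \<partial>lebesgue) = ennreal y"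
      unfolding inner_dissipation_eq[OF psi elim(1) at] y_def
      using pc(1) energy_function_deriv_nonneg[OF psi E_nonneg] by (intro nn_integral_eq_integral) auto
    then have "ennreal (\<psi> (E t u) / 2)
      + ennreal \<nu> * (\<integral>\<^sup>+s. indicator {a..t} s * (ennreal (\<psi>' (E s u)) * g s u) \<partial>lebesgue) = ennreal (\<psi> (E t u) / 2 + \<nu> * y)"
      using nu y0 psi_nonneg[OF psi, of t u] by (simp add: ennreal_mult ennreal_plus)
    moreover have "\<psi> (E t u) / 2 + \<nu> * y \<le> X u" using pc(3) by (simp add: y_def X_def)
    moreover have "0 \<le> \<psi> (E t u) / 2 + \<nu> * y" using nu y0 psi_nonneg[OF psi, of t u] by simp
    ultimately show ?case by (auto intro: ennreal_leI)
  qed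
  have X0: "AE u in \<rho>. 0 \<le> X u" using main by eventually_elim simp
  have "(\<integral>\<^sup>+u. ennreal (\<psi> (E t u) / 2) \<partial>\<rho>) + ennreal \<nu> * dissipation \<psi>' a t \<le> (\<integral>\<^sup>+u. ennreal (X u) \<partial>\<rho>)"
    unfolding nn_integral_energy_sum[OF psi, symmetric]
    by (rule nn_integral_mono_AE) (use main in eventually_elim, simp)
  also have "\<dots> = ennreal (LINT u|\<rho>. X u)" by (rule nn_integral_eq_integral[OF X X0])
  finally show ?thesis
    using int integral_nonneg_AE[OF X0] by (simp add: mean_ineq_def Xv)
qed

text \<open>Both time integrals run over a single point, a null set; the arguments along
  trajectories cover \<open>a < t\<close>.\<close>

lemma mean_ineq_refl:
  assumes psi: "energy_function \<psi> \<psi>'" and int: "integrable \<rho> (\<lambda>u. \<psi> (E t u))"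
  shows "mean_ineq \<psi> \<psi>' t t"
proof -
  have ae: "AE s in lebesgue. s \<noteq> t" by (rule AE_completion) (rule AE_lborel_singleton)
  have "(\<integral>\<^sup>+s. indicator {t..t} s * (ennreal (\<psi>' (E s u)) * g s u) \<partial>lebesgue) = (\<integral>\<^sup>+s. 0 \<partial>(lebesgue :: real measure))" for u
    by (rule nn_integral_cong_AE) (use ae in \<open>auto elim!: eventually_mono\<close>)
  then have d: "dissipation \<psi>' t t = 0" by (simp add: dissipation_def)
  have "(LINT s|lebesgue. indicator {t..t} s * (\<psi>' (E s u) * k s u)) = 0" for u
    by (rule integral_eq_zero_AE) (use ae in \<open>auto elim!: eventually_mono\<close>)
  then have w: "work \<psi>' t t = 0" by (simp add: work_def)
  have "integrable \<rho> (\<lambda>u. \<psi> (E t u) / 2)" using int by simp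
  from nn_integral_eq_integral[OF this] have "(\<integral>\<^sup>+u. ennreal (\<psi> (E t u) / 2) \<partial>\<rho>) = ennreal (LINT u|\<rho>. \<psi> (E t u) / 2)"
    using psi_nonneg[OF psi] by simp
  moreover have "0 \<le> (LINT u|\<rho>. \<psi> (E t u) / 2)" using psi_nonneg[OF psi] by (intro Bochner_Integration.integral_nonneg) simp
  ultimately show ?thesis using int by (simp add: mean_ineq_def d w)
qed

section \<open>The closed left end\<close>

lemma left_end_integrable:
  assumes psi: "energy_function \<psi> \<psi>'" and a: "closed_left_end I a"
  shows "integrable \<rho> (\<lambda>u. \<psi> (E a u))"
    and "((\<lambda>t. \<integral>\<^sup>+u\<in>U. ennreal (\<psi> ((norm (u t))\<^sup>2)) \<partial>\<rho>) \<longlongrightarrow> (\<integral>\<^sup>+u. ennreal (\<psi> (E a u)) \<partial>\<rho>)) (at a within I)"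
proof -
  have aI: "a \<in> I" using a by (simp add: closed_left_end_def)
  have "((\<lambda>t. \<integral>\<^sup>+u\<in>U. ennreal (\<psi> ((norm (u t))\<^sup>2)) \<partial>\<rho>)
           \<longlongrightarrow> (\<integral>\<^sup>+u\<in>U. ennreal (\<psi> ((norm (u a))\<^sup>2)) \<partial>\<rho>)) (at a within I) \<and>
        (\<integral>\<^sup>+u\<in>U. ennreal (\<psi> ((norm (u a))\<^sup>2)) \<partial>\<rho>) < \<infinity>"
    using vf a psi unfolding vishik_fursikov_measure_def by blast
  then have *: "((\<lambda>t. \<integral>\<^sup>+u\<in>U. ennreal (\<psi> ((norm (u t))\<^sup>2)) \<partial>\<rho>) \<longlongrightarrow> (\<integral>\<^sup>+u. ennreal (\<psi> (E a u)) \<partial>\<rho>)) (at a within I)"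
    "(\<integral>\<^sup>+u. ennreal (\<psi> (E a u)) \<partial>\<rho>) < \<infinity>"
    using nn_integral_U_energy[OF aI] by simp_all
  then show "((\<lambda>t. \<integral>\<^sup>+u\<in>U. ennreal (\<psi> ((norm (u t))\<^sup>2)) \<partial>\<rho>) \<longlongrightarrow> (\<integral>\<^sup>+u. ennreal (\<psi> (E a u)) \<partial>\<rho>)) (at a within I)" by simp
  show "integrable \<rho> (\<lambda>u. \<psi> (E a u))"
  proof (rule integrableI_bounded)
    show "(\<lambda>u. \<psi> (E a u)) \<in> borel_measurable \<rho>" by (intro energy_function_measurable[OF psi]) auto
    show "(\<integral>\<^sup>+u. ennreal (norm (\<psi> (E a u))) \<partial>\<rho>) < \<infinity>" using *(2) psi_nonneg[OF psi] by simp
  qed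
qed

text \<open>Good times \<open>\<tau> n\<close> tend to \<open>a\<close> from the right. The initial
  term converges by the mean continuity of the measure, the work by dominated convergence on the
  product. The dissipation near \<open>a\<close> has no bound in advance: it is first bounded from a
  fixed \<open>\<tau> m\<close> on, uniformly in \<open>m\<close>, and then from \<open>a\<close> on
  by Fatou's lemma.\<close>

lemma left_end_mean_ineq:
  assumes psi: "energy_function \<psi> \<psi>'" and a: "closed_left_end I a" and t: "t \<in> I" "a < t"
  shows "mean_ineq \<psi> \<psi>' a t"
proof -
  have aI: "a \<in> I" using a by (simp add: closed_left_end_def)
  have at: "{a..t} \<subseteq> I" by (rule interval_subset[OF aI t(1)])
  have "\<exists>\<tau>. a < \<tau> \<and> \<tau> < min t (a + inverse (real (Suc n))) \<and> good_time \<tau>" for n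
  proof -
    obtain c where c: "a < c" "c < min t (a + inverse (real (Suc n)))" "c \<notin> I - {s. good_time s}"
      using nonnull_open_interval[OF _ null_good_time, of a "min t (a + inverse (real (Suc n)))"] t(2) by auto
    then have "c \<in> {a..t}" by auto
    then have "c \<in> I" using at by blast
    then show ?thesis using c by auto
  qed
  then obtain \<tau> where \<tau>: "\<And>n. a < \<tau> n" "\<And>n. \<tau> n < min t (a + inverse (real (Suc n)))" "\<And>n. good_time (\<tau> n)" by metis
  have \<tau>t: "\<tau> n < t" for n using \<tau>(2)[of n] by simp
  have \<tau>I: "\<tau> n \<in> I" for n using \<tau>(1)[of n] \<tau>t[of n] at by auto
  have "(\<lambda>n. a + inverse (real (Suc n))) \<longlonglongrightarrow> a + 0" by (intro tendsto_intros LIMSEQ_inverse_real_of_nat)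
  then have lim: "\<tau> \<longlonglongrightarrow> a"
    using \<tau>(1,2) by (intro real_tendsto_sandwich[of "\<lambda>_. a" \<tau> _ "\<lambda>n. a + inverse (real (Suc n))"])
      (auto intro!: always_eventually less_imp_le)
  have ev: "\<forall>\<^sub>F n in sequentially. \<tau> n \<le> s" if "a < s" for s
    using order_tendstoD(2)[OF lim that] by (auto elim!: eventually_mono)
  have sub: "{\<tau> n..t} \<subseteq> {a..t}" "{\<tau> n..t} \<subseteq> I" for n using \<tau>(1)[of n] at by auto
  have mi: "mean_ineq \<psi> \<psi>' (\<tau> n) t" for n by (rule good_time_mean_ineq[OF psi \<tau>(3) t(1) \<tau>t])
  have ia: "integrable \<rho> (\<lambda>u. \<psi> (E a u))" by (rule left_end_integrable(1)[OF psi a])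
  have nn: "(\<integral>\<^sup>+u. ennreal (\<psi> (E s u)) \<partial>\<rho>) = ennreal (LINT u|\<rho>. \<psi> (E s u))" "0 \<le> (LINT u|\<rho>. \<psi> (E s u))"
    if "integrable \<rho> (\<lambda>u. \<psi> (E s u))" for s
    using that psi_nonneg[OF psi] by (auto intro!: nn_integral_eq_integral Bochner_Integration.integral_nonneg)
  have psilim: "(\<lambda>n. LINT u|\<rho>. \<psi> (E (\<tau> n) u)) \<longlonglongrightarrow> (LINT u|\<rho>. \<psi> (E a u))"
  proof -
    have "filterlim \<tau> (at a within I) sequentially"
      using lim \<tau>I \<tau>(1) by (auto simp: filterlim_at less_le intro!: always_eventually)
    from filterlim_compose[OF left_end_integrable(2)[OF psi a] this]
    have "(\<lambda>n. \<integral>\<^sup>+u. ennreal (\<psi> (E (\<tau> n) u)) \<partial>\<rho>) \<longlonglongrightarrow> (\<integral>\<^sup>+u. ennreal (\<psi> (E a u)) \<partial>\<rho>)"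
      by (simp add: nn_integral_U_energy[OF \<tau>I])
    moreover have "integrable \<rho> (\<lambda>u. \<psi> (E (\<tau> n) u))" for n using mi[of n] by (simp add: mean_ineq_def)
    ultimately have "(\<lambda>n. ennreal (LINT u|\<rho>. \<psi> (E (\<tau> n) u))) \<longlonglongrightarrow> ennreal (LINT u|\<rho>. \<psi> (E a u))"
      using nn(1) ia by simp
    then show ?thesis
      using nn(2) ia mi by (subst (asm) tendsto_ennreal_iff) (auto simp: mean_ineq_def)
  qed
  \<comment> \<open>At time \<open>a\<close> itself the indicators of \<open>{\<tau> n..t}\<close>
    stay 0, so this time is excluded on the product.\<close>
  have nea: "AE z in \<rho> \<Otimes>\<^sub>M lebesgue. snd z \<noteq> a"
  proof -
    have [measurable]: "snd \<in> borel_measurable (\<rho> \<Otimes>\<^sub>M (lebesgue :: real measure))"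
      by (rule measurable_lebesgue_imp_borel[OF measurable_snd])
    show ?thesis
    proof (rule P'.AE_pair_measure)
      show "{z \<in> space (\<rho> \<Otimes>\<^sub>M lebesgue). snd z \<noteq> a} \<in> sets (\<rho> \<Otimes>\<^sub>M lebesgue)" by measurable
      show "AE u in \<rho>. AE s in lebesgue. snd (u, s) \<noteq> a"
        unfolding snd_conv by (intro AE_I2 AE_completion AE_lborel_singleton)
    qed
  qed
  note [measurable] = energy_function_measurable[OF psi]
  have worklim: "(\<lambda>n. work \<psi>' (\<tau> n) t) \<longlonglongrightarrow> work \<psi>' a t"
    unfolding work_product(1)[OF psi sub(2)] work_product(1)[OF psi at]
  proof (rule integral_dominated_convergence[OF _ _ integrable_norm[OF work_integrable[OF psi at]]])
    show "AE z in \<rho> \<Otimes>\<^sub>M lebesgue. (\<lambda>n. indicator {\<tau> n..t} (snd z) * power_at \<psi>' z)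
        \<longlonglongrightarrow> indicator {a..t} (snd z) * power_at \<psi>' z"
      using nea
    proof eventually_elim
      case (elim z)
      have "\<forall>\<^sub>F n in sequentially. indicator {\<tau> n..t} (snd z) = (indicator {a..t} (snd z) :: real)"
      proof (cases "a < snd z")
        case True
        from ev[OF True] show ?thesis by eventually_elim (use True in \<open>auto simp: indicator_def\<close>)
      next
        case False
        then have "indicator {\<tau> n..t} (snd z) = (indicator {a..t} (snd z) :: real)" for n
          using elim \<tau>(1)[of n] by (auto simp: indicator_def)
        then show ?thesis by simp
      qed
      then show ?case by (intro tendsto_mult tendsto_const) (rule tendsto_eventually)
    qed
    show "AE z in \<rho> \<Otimes>\<^sub>M lebesgue. norm (indicator {\<tau> n..t} (snd z) * power_at \<psi>' z)
        \<le> norm (indicator {a..t} (snd z) * power_at \<psi>' z)" for n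
      using sub(1)[of n] by (intro AE_I2) (auto simp: indicator_def)
  qed measurable
  define R where "R = (LINT u|\<rho>. \<psi> (E a u) / 2) + work \<psi>' a t"
  define Rn where "Rn n = (LINT u|\<rho>. \<psi> (E (\<tau> n) u) / 2) + work \<psi>' (\<tau> n) t" for n
  have Rlim: "Rn \<longlonglongrightarrow> R"
    unfolding Rn_def R_def Bochner_Integration.integral_divide_zero by (intro tendsto_intros psilim worklim) simp
  have Rn: "0 \<le> Rn n" "(\<integral>\<^sup>+u. ennreal (\<psi> (E t u) / 2) \<partial>\<rho>) + ennreal \<nu> * dissipation \<psi>' (\<tau> n) t \<le> ennreal (Rn n)" for n
    using mi[of n] by (simp_all add: mean_ineq_def Rn_def)
  have R0: "0 \<le> R" by (rule LIMSEQ_le_const[OF Rlim]) (use Rn in auto)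
  define A where "A = (\<integral>\<^sup>+u. ennreal (\<psi> (E t u) / 2) \<partial>\<rho>)"
  \<comment> \<open>For fixed \<open>m\<close>, eventually \<open>\<tau> n \<le> \<tau> m\<close>,
    so the dissipation from \<open>\<tau> m\<close> is dominated by the one from
    \<open>\<tau> n\<close>, and \<open>n\<close> can tend to infinity on the right-hand side
    alone.\<close>
  have step: "A + ennreal \<nu> * dissipation \<psi>' (\<tau> m) t \<le> ennreal R" for m
  proof (rule tendsto_lowerbound[OF tendsto_ennrealI[OF Rlim]])
    show "\<forall>\<^sub>F n in sequentially. A + ennreal \<nu> * dissipation \<psi>' (\<tau> m) t \<le> ennreal (Rn n)"
      using ev[OF \<tau>(1)[of m]]
    proof eventually_elim
      case (elim n)
      have "dissipation \<psi>' (\<tau> m) t \<le> dissipation \<psi>' (\<tau> n) t"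
        unfolding dissipation_def using elim by (intro nn_integral_mono nn_integral_interval_mono) auto
      then have "A + ennreal \<nu> * dissipation \<psi>' (\<tau> m) t \<le> A + ennreal \<nu> * dissipation \<psi>' (\<tau> n) t"
        by (intro add_left_mono mult_left_mono) auto
      also have "\<dots> \<le> ennreal (Rn n)" using Rn(2) by (simp add: A_def)
      finally show ?case .
    qed
  qed simp
  have "A \<le> ennreal R" by (rule order_trans[OF _ step[of 0]]) simp
  then obtain A' where A': "A = ennreal A'" "0 \<le> A'" "A' \<le> R"
    using R0 by (cases A) (auto simp: top_unique)
  \<comment> \<open>The room left for the dissipation once the final energy \<open>A'\<close> is
    accounted for. Passing to real numbers avoids subtraction in \<open>ennreal\<close>.\<close>
  define X where "X = (R - A') / \<nu>"
  have dX: "dissipation \<psi>' (\<tau> m) t \<le> ennreal X" for m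
  proof (cases "dissipation \<psi>' (\<tau> m) t")
    case (real d)
    then have "ennreal (A' + \<nu> * d) \<le> ennreal R" using step[of m] A' nu by (simp add: ennreal_mult ennreal_plus)
    then have "A' + \<nu> * d \<le> R" using R0 by (subst (asm) ennreal_le_iff) auto
    then have "d \<le> X" using nu by (simp add: X_def field_simps)
    then show ?thesis using real by (simp add: ennreal_leI)
  next
    case top
    then show ?thesis using step[of m] nu by (simp add: ennreal_mult_top top_unique)
  qed
  have "dissipation \<psi>' a t \<le> (\<integral>\<^sup>+z. liminf (\<lambda>n. indicator {\<tau> n..t} (snd z) * dissipation_at \<psi>' z) \<partial>(\<rho> \<Otimes>\<^sub>M lebesgue))"
    unfolding dissipation_product[OF psi]
  proof (rule nn_integral_mono_AE, rule AE_mp[OF nea], intro AE_I2 impI Liminf_bounded)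
    fix z :: "(real \<Rightarrow> l2) \<times> real" assume z: "snd z \<noteq> a"
    show "\<forall>\<^sub>F n in sequentially. indicator {a..t} (snd z) * dissipation_at \<psi>' z
        \<le> indicator {\<tau> n..t} (snd z) * dissipation_at \<psi>' z"
    proof (cases "a < snd z")
      case True
      from ev[OF True] show ?thesis by eventually_elim (auto simp: indicator_def)
    next
      case False
      then show ?thesis using z by (auto simp: indicator_def)
    qed
  qed
  also have "\<dots> \<le> liminf (\<lambda>n. dissipation \<psi>' (\<tau> n) t)"
    unfolding dissipation_product[OF psi] by (rule nn_integral_liminf) measurable
  also have "\<dots> \<le> limsup (\<lambda>n. dissipation \<psi>' (\<tau> n) t)" by (rule Liminf_le_Limsup) simp
  also have "\<dots> \<le> ennreal X" by (rule Limsup_bounded) (simp add: dX)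
  finally have "A + ennreal \<nu> * dissipation \<psi>' a t \<le> ennreal A' + ennreal \<nu> * ennreal X"
    unfolding A'(1) by (intro add_left_mono mult_left_mono) auto
  also have "\<dots> = ennreal (A' + \<nu> * X)"
  proof -
    have "0 \<le> X" using nu A' by (simp add: X_def)
    then show ?thesis using nu A'(2) by (simp add: ennreal_mult)
  qed
  also have "A' + \<nu> * X = R" using nu by (simp add: X_def)
  finally show ?thesis using ia R0 by (simp add: mean_ineq_def A_def R_def)
qed

text \<open>Since \<open>\<nu>\<close> is positive, \<open>mean_ineq\<close> makes the dissipation
  finite, and this yields the integrability that the target states explicitly. Its integrands are
  identified with those in \<open>E\<close>, \<open>k\<close> and \<open>g\<close> for almost all
  times along each trajectory in \<open>U\<close>.\<close>

lemma mean_ineq_imp_strengthened: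
  assumes psi: "energy_function \<psi> \<psi>'" and m: "mean_ineq \<psi> \<psi>' a t" and at: "{a..t} \<subseteq> I" "a \<in> I" "t \<in> I"
  shows "strengthened_mean_energy_inequality S \<nu> f I \<rho> \<psi> \<psi>' a t"
proof -
  note [measurable] = energy_function_measurable[OF psi] inner_dissipation_measurable[OF psi]
  define R where "R = (LINT u|\<rho>. \<psi> (E a u) / 2) + work \<psi>' a t"
  have R0: "0 \<le> R" and ia: "integrable \<rho> (\<lambda>u. \<psi> (E a u))"
    and mR: "(\<integral>\<^sup>+u. ennreal (\<psi> (E t u) / 2) \<partial>\<rho>) + ennreal \<nu> * dissipation \<psi>' a t \<le> ennreal R"
    using m by (simp_all add: mean_ineq_def R_def)
  have "ennreal \<nu> * dissipation \<psi>' a t \<le> ennreal R"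
    by (rule order_trans[OF _ mR]) simp
  then have "ennreal \<nu> * dissipation \<psi>' a t < \<infinity>" by (rule le_less_trans) simp
  then have "dissipation \<psi>' a t \<noteq> \<infinity>" using nu by (auto simp: ennreal_mult_top)
  then have fin: "AE u in \<rho>. (\<integral>\<^sup>+s. indicator {a..t} s * (ennreal (\<psi>' (E s u)) * g s u) \<partial>lebesgue) \<noteq> \<infinity>"
    unfolding dissipation_def by (intro nn_integral_noteq_infinite) measurable
  define Y where "Y u = (LINT s|lebesgue. indicator {a..t} s * (\<psi>' (E s u) * enn2real (g s u)))" for u
  define Z where "Z u = (LINT s|lebesgue. indicator {a..t} s * (\<psi>' (E s u) * k s u))" for u
  have Yint: "AE u in \<rho>. u \<in> U \<and> integrable lebesgue (\<lambda>s. indicator {a..t} s * (\<psi>' (E s u) * enn2real (g s u)))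
      \<and> (\<integral>\<^sup>+s. indicator {a..t} s * (ennreal (\<psi>' (E s u)) * g s u) \<partial>lebesgue) = ennreal (Y u)"
    using fin AE_U
  proof eventually_elim
    case (elim u)
    have us: "u \<in> space \<rho>" by (rule U_space[OF elim(2)])
    note [measurable] = section_measurable[OF us]
    have [measurable]: "(\<lambda>s. \<psi>' (E s u)) \<in> borel_measurable lebesgue"
      using us by (intro energy_function_measurable[OF psi]) auto
    have nonneg: "0 \<le> indicator {a..t} s * (\<psi>' (E s u) * enn2real (g s u))" for s
      using energy_function_deriv_nonneg[OF psi E_nonneg] by simp
    have int: "integrable lebesgue (\<lambda>s. indicator {a..t} s * (\<psi>' (E s u) * enn2real (g s u)))"
    proof (rule integrableI_bounded)
      show "(\<lambda>s. indicator {a..t} s * (\<psi>' (E s u) * enn2real (g s u))) \<in> borel_measurable lebesgue" by measurable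
      show "(\<integral>\<^sup>+s. ennreal (norm (indicator {a..t} s * (\<psi>' (E s u) * enn2real (g s u)))) \<partial>lebesgue) < \<infinity>"
        using elim(1) nonneg unfolding inner_dissipation_eq[OF psi elim(2) at(1)]
        by (simp only: real_norm_def abs_of_nonneg less_top infinity_ennreal_def not_False_eq_True)
    qed
    have "(\<integral>\<^sup>+s. indicator {a..t} s * (ennreal (\<psi>' (E s u)) * g s u) \<partial>lebesgue) = ennreal (Y u)"
      unfolding inner_dissipation_eq[OF psi elim(2) at(1)] Y_def
      using nonneg by (intro nn_integral_eq_integral[OF int]) (intro AE_I2)
    with int elim(2) show ?case by blast
  qed
  have H1_eq: "AE s in lebesgue. indicator {a..t} s *\<^sub>R (\<psi>' ((norm (u s))\<^sup>2) * (H1_norm S (u s))\<^sup>2)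
      = indicator {a..t} s * (\<psi>' (E s u) * enn2real (g s u))" if "u \<in> U" for u
    using path_g_eq[OF that] by eventually_elim (use at(1) in \<open>auto simp: indicator_def E_eq subset_iff\<close>)
  have k_eq': "AE s in lebesgue. indicator {a..t} s *\<^sub>R (\<psi>' ((norm (u s))\<^sup>2) * (f s \<bullet> u s))
      = indicator {a..t} s * (\<psi>' (E s u) * k s u)" for u
    using AE_not_in[OF N0] by eventually_elim (use at(1) f_eq in \<open>auto simp: indicator_def E_eq k_eq subset_iff\<close>)
  have Y_val: "(LINT s:{a..t}|lebesgue. \<psi>' ((norm (u s))\<^sup>2) * (H1_norm S (u s))\<^sup>2) = Y u" if "u \<in> U" for u
    unfolding set_lebesgue_integral_def Y_def using U_space[OF that]
    by (intro integral_cong_AE_lebesgue[OF H1_eq[OF that]]) measurable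
  have Z_val: "(LINT s:{a..t}|lebesgue. \<psi>' ((norm (u s))\<^sup>2) * (f s \<bullet> u s)) = Z u" if "u \<in> U" for u
    unfolding set_lebesgue_integral_def Z_def using U_space[OF that]
    by (intro integral_cong_AE_lebesgue[OF k_eq']) measurable
  have P1: "AE u in \<rho>. set_integrable lebesgue {a..t} (\<lambda>s. \<psi>' ((norm (u s))\<^sup>2) * (H1_norm S (u s))\<^sup>2) \<and>
      set_integrable lebesgue {a..t} (\<lambda>s. \<psi>' ((norm (u s))\<^sup>2) * (f s \<bullet> u s))"
    using Yint work_product(3)[OF psi at(1)]
    unfolding set_integrable_def
    by eventually_elim (blast intro: integrable_cong_AE_lebesgue[OF H1_eq] integrable_cong_AE_lebesgue[OF k_eq'])
  define lhs where "lhs u = \<psi> (E t u) / 2 + \<nu> * Y u" for u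
  define rhs where "rhs u = \<psi> (E a u) / 2 + Z u" for u
  have Y_meas [measurable]: "Y \<in> borel_measurable \<rho>"
    unfolding Y_def by (rule lebesgue.borel_measurable_lebesgue_integral) (simp only: case_prod_beta', measurable)
  have Y0: "0 \<le> Y u" for u
    unfolding Y_def using energy_function_deriv_nonneg[OF psi E_nonneg] by (intro Bochner_Integration.integral_nonneg) simp
  have lhs0: "0 \<le> lhs u" for u using Y0[of u] nu psi_nonneg[OF psi, of t u] by (simp add: lhs_def)
  have lhs_nn: "(\<integral>\<^sup>+u. ennreal (lhs u) \<partial>\<rho>) \<le> ennreal R"
  proof -
    have "(\<integral>\<^sup>+u. ennreal (lhs u) \<partial>\<rho>) = (\<integral>\<^sup>+u. (ennreal (\<psi> (E t u) / 2) + ennreal \<nu> * (\<integral>\<^sup>+s. indicator {a..t} s * (ennreal (\<psi>' (E s u)) * g s u) \<partial>lebesgue)) \<partial>\<rho>)"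
      using Yint
    proof (intro nn_integral_cong_AE, eventually_elim)
      case (elim u)
      then show ?case using Y0[of u] nu psi_nonneg[OF psi, of t u] by (simp add: lhs_def ennreal_mult ennreal_plus)
    qed
    then show ?thesis using mR by (simp add: nn_integral_energy_sum[OF psi])
  qed
  have lhs_meas [measurable]: "lhs \<in> borel_measurable \<rho>" unfolding lhs_def by measurable
  have lhs_int: "integrable \<rho> lhs"
    using lhs_nn lhs0 by (intro integrableI_bounded) (auto intro: le_less_trans)
  have "ennreal (LINT u|\<rho>. lhs u) \<le> ennreal R"
    using lhs_nn nn_integral_eq_integral[OF lhs_int] lhs0 by simp
  then have lhs_R: "(LINT u|\<rho>. lhs u) \<le> R" using R0 by (subst (asm) ennreal_le_iff) auto
  have rhs_int: "integrable \<rho> rhs" unfolding rhs_def Z_def using ia work_product(2)[OF psi at(1)] by simp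
  have rhs_R: "(LINT u|\<rho>. rhs u) = R"
    unfolding rhs_def R_def Z_def work_def using ia work_product(2)[OF psi at(1)] by (subst Bochner_Integration.integral_add) auto
  \<comment> \<open>The measure is carried by \<open>U\<close>, so restricting an integral to
    \<open>U\<close> changes nothing; off \<open>U\<close> the original and the measurable
    integrands may differ.\<close>
  have U_int: "set_integrable \<rho> U h" "(LINT u:U|\<rho>. h u) = (LINT u|\<rho>. h' u)"
    if h': "integrable \<rho> h'" and eq: "\<And>u. u \<in> U \<Longrightarrow> h u = h' u" for h h' :: "(real \<Rightarrow> l2) \<Rightarrow> real"
  proof -
    have e: "(\<lambda>u. indicator U u *\<^sub>R h u) = (\<lambda>u. indicator U u *\<^sub>R h' u)" using eq by (auto simp: indicator_def)
    show "set_integrable \<rho> U h" unfolding set_integrable_def e by (rule integrable_mult_indicator[OF U_sets h'])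
    show "(LINT u:U|\<rho>. h u) = (LINT u|\<rho>. h' u)"
      unfolding set_lebesgue_integral_def e
    proof (rule integral_cong_AE)
      show "AE u in \<rho>. indicator U u *\<^sub>R h' u = h' u" using AE_U by eventually_elim simp
    qed (use h' in measurable)
  qed
  have l: "\<psi> ((norm (u t))\<^sup>2) / 2 + \<nu> * (LINT s:{a..t}|lebesgue. \<psi>' ((norm (u s))\<^sup>2) * (H1_norm S (u s))\<^sup>2) = lhs u"
    if "u \<in> U" for u by (simp only: Y_val[OF that] lhs_def E_eq[OF at(3)])
  have r: "\<psi> ((norm (u a))\<^sup>2) / 2 + (LINT s:{a..t}|lebesgue. \<psi>' ((norm (u s))\<^sup>2) * (f s \<bullet> u s)) = rhs u"
    if "u \<in> U" for u by (simp only: Z_val[OF that] rhs_def E_eq[OF at(2)])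
  show ?thesis
    unfolding strengthened_mean_energy_inequality_def Let_def
    using P1 U_int[OF lhs_int l] U_int[OF rhs_int r] lhs_R rhs_R by simp
qed
end

section \<open>Instantiation of the setup and the conclusion\<close>

lemma energy_setup_exists:
  assumes nu: "0 < \<nu>" and S: "admissible S" and I: "is_interval I"
    and f: "f \<in> L_inf I (space_H S) norm" and vf: "vishik_fursikov_measure S \<nu> f I \<rho>"
  shows "\<exists>f0 C N0 G. energy_setup S \<nu> f I \<rho> f0 C N0 G"
proof -
  have \<rho>: "borel_prob_measure (C_loc_topology S I) \<rho>"
    using vf by (simp add: vishik_fursikov_measure_def)
  obtain f0 C N0 where f0: "N0 \<in> null_sets lebesgue" "\<And>s. s \<in> I \<Longrightarrow> s \<notin> N0 \<Longrightarrow> f s = f0 s"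
    "\<And>s. norm (f0 s) \<le> C" "(\<lambda>(s, u). indicator I s * (f0 s \<bullet> u s)) \<in> borel_measurable (lebesgue \<Otimes>\<^sub>M \<rho>)"
    by (rule L_inf_representative[OF I \<rho> S f that])
  have "\<exists>A. fst ` A \<subseteq> space_H S \<and> (\<forall>u. u \<in> space_H S \<longrightarrow> u \<in> space_H1 S \<longrightarrow>
      ennreal ((norm (weak_partial S i u))\<^sup>2) = affine_sup A u)" for i
    by (rule weak_partial_affine_sup[OF S, of i]) blast
  then obtain A where A: "\<And>i. fst ` A i \<subseteq> space_H S"
    "\<And>i u. u \<in> space_H S \<Longrightarrow> u \<in> space_H1 S \<Longrightarrow> ennreal ((norm (weak_partial S i u))\<^sup>2) = affine_sup (A i) u"
    by metis
  \<comment> \<open>One family of affine functionals per coordinate direction, summed in the same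
    way as the square of \<open>H1_norm\<close>.\<close>
  define G where "G u = (\<Sum>i\<in>UNIV. affine_sup (A i) u)" for u
  have "(\<lambda>x. \<Sum>i\<in>UNIV. case x of (s, u) \<Rightarrow> indicator I s * affine_sup (A i) (u s)) \<in> borel_measurable (lebesgue \<Otimes>\<^sub>M \<rho>)"
    by (intro borel_measurable_sum affine_sup_evaluation_measurable[OF I \<rho> A(1)])
  then have G_meas: "(\<lambda>(s, u). indicator I s * G (u s)) \<in> borel_measurable (lebesgue \<Otimes>\<^sub>M \<rho>)"
    by (simp add: G_def sum_distrib_left case_prod_beta')
  define B where "B = (\<lambda>h. (2 *\<^sub>R h, (norm h)\<^sup>2)) ` space_H S"
  have "fst ` B \<subseteq> space_H S"
    using subspace_scale[OF subspace_space_H[OF S], of _ 2] by (auto simp: B_def)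
  then have "(\<lambda>x. enn2real (case x of (s, u) \<Rightarrow> indicator I s * affine_sup B (u s))) \<in> borel_measurable (lebesgue \<Otimes>\<^sub>M \<rho>)"
    by (intro measurable_compose[OF affine_sup_evaluation_measurable[OF I \<rho>]]) auto
  moreover have "enn2real (case x of (s, u) \<Rightarrow> indicator I s * affine_sup B (u s)) =
      (case x of (s, u) \<Rightarrow> indicator I s * (norm (u s))\<^sup>2)" if "x \<in> space (lebesgue \<Otimes>\<^sub>M \<rho>)" for x
  proof -
    obtain s u where x: "x = (s, u)" by force
    have "u \<in> C_loc_weak S I"
      using that x space_borel_prob_measure[OF \<rho>] topspace_C_loc[of S I] by (auto simp: space_pair_measure)
    then have "affine_sup B (u s) = ennreal ((norm (u s))\<^sup>2)" if "s \<in> I"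
      unfolding B_def using that
      by (intro norm_square_affine_sup[OF subspace_space_H[OF S], symmetric] weak_continuous_in_H)
    then show ?thesis by (cases "s \<in> I") (simp_all add: x)
  qed
  ultimately have E_meas: "(\<lambda>(s, u). indicator I s * (norm (u s))\<^sup>2) \<in> borel_measurable (lebesgue \<Otimes>\<^sub>M \<rho>)"
    by (simp cong: measurable_cong)
  have "energy_setup S \<nu> f I \<rho> f0 C N0 G"
  proof
    fix u assume u: "u \<in> space_H S" "u \<in> space_H1 S"
    show "G u = ennreal ((H1_norm S u)\<^sup>2)"
      unfolding G_def H1_norm_square by (simp add: A(2)[OF u, symmetric] sum_ennreal)
  qed (use nu S I vf f0 G_meas E_meas in auto)
  then show ?thesis by blast
qed

theorem theorem3p2:
  fixes S :: setting and \<nu> :: real and I :: "real set"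
    and f :: "real \<Rightarrow> l2" and \<rho> :: "(real \<Rightarrow> l2) measure"
  assumes "0 < \<nu>"
    and "admissible S"
    and "is_interval I"
    and "f \<in> L_inf I (space_H S) norm"
    and "vishik_fursikov_measure S \<nu> f I \<rho>"
  shows "\<exists>I'\<subseteq>I. I - I' \<in> null_sets lebesgue \<and>
    (\<forall>\<psi> \<psi>'. energy_function \<psi> \<psi>' \<longrightarrow>
       (\<forall>t' t. t' \<in> I' \<or> closed_left_end I t' \<longrightarrow> t \<in> I \<longrightarrow> t' \<le> t \<longrightarrow>
          strengthened_mean_energy_inequality S \<nu> f I \<rho> \<psi> \<psi>' t' t))"
proof -
  obtain f0 C N0 G where "energy_setup S \<nu> f I \<rho> f0 C N0 G"
    using energy_setup_exists[OF assms] by blast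
  then interpret energy_setup S \<nu> f I \<rho> f0 C N0 G .
  show ?thesis
  proof (intro exI[of _ "{s \<in> I. good_time s}"] conjI allI impI)
    have "I - {s \<in> I. good_time s} = I - {s. good_time s}" by auto
    then show "I - {s \<in> I. good_time s} \<in> null_sets lebesgue" using null_good_time by simp
    fix \<psi> \<psi>' t' t
    assume psi: "energy_function \<psi> \<psi>'" and t': "t' \<in> {s \<in> I. good_time s} \<or> closed_left_end I t'"
      and t: "t \<in> I" "t' \<le> t"
    have t'I: "t' \<in> I" using t' by (auto simp: closed_left_end_def)
    \<comment> \<open>Equal times are split off because both inequalities in the mean assume strict
      order. Integrability at the single time comes from the finite moment at a good time, or from
      the condition at the left end.\<close>
    have "mean_ineq \<psi> \<psi>' t' t"
    proof (cases "t' = t")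
      case True
      have "integrable \<rho> (\<lambda>u. \<psi> (E t u))"
        using t' left_end_integrable(1)[OF psi, of t] integrable_psi[OF psi, of t]
        by (auto simp: True good_time_def)
      then show ?thesis using mean_ineq_refl[OF psi] True by simp
    next
      case False
      then have "t' < t" using t(2) by simp
      then show ?thesis
        using t' good_time_mean_ineq[OF psi _ t(1)] left_end_mean_ineq[OF psi _ t(1)] by auto
    qed
    then show "strengthened_mean_energy_inequality S \<nu> f I \<rho> \<psi> \<psi>' t' t"
      using mean_ineq_imp_strengthened[OF psi] interval_subset[OF t'I t(1)] t'I t(1) by blast
  qed auto
qed

end
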